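(* $$\mathrm C_2=2.89847930\ldots .$$ Furthermore, if $\lambda\in[0,1]$ and $x,y\in[0,+\infty)$ satisfy $\Gamma^{(\lambda)}_{\mathrm{real}}(x,y)=+\infty$ and $x+y=\mathrm C_2$, then $x=y=\frac12\mathrm C_2$ and $$0.35865<\min(\lambda,1-\lambda)<0.35866.$$
   Context: For formal noncommuting variables $X,Y$ and $A=(\exp X)(\exp Y)$: $\Gamma(X,Y)$ is the formal noncommutative power series of $\log A$ with the coefficient of each monomial replaced by its absolute value; for $\lambda\in[0,1]$, $\Gamma^{(\lambda)}(X,Y)$ is the formal noncommutative power series of $(A-1)(\lambda+(1-\lambda)A)^{-1}$ with the coefficient of each monomial replaced by its absolute value. For $x,y\in[0,+\infty)$, $\Gamma_{\mathrm{real}}(x,y)$ and $\Gamma^{(\lambda)}_{\mathrm{real}}(x,y)$, with values in $[0,+\infty]$, are obtained by substituting $x,y$ for $X,Y$. $\mathrm C_2=\min\{x+y: x,y\in[0,+\infty),\ \Gamma_{\mathrm{real}}(x,y)=+\infty\}$ (the cumulative convergence radius of the Baker–Campbell–Hausdorff expansion in Banach algebras). The decimal value means that the decimal expansion of $\mathrm C_2$ begins with the displayed digits. *)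

theory Defs
  imports "HOL-Analysis.Analysis"
begin

text \<open>
  Formal power series over the coefficients \<open>'c\<close> in the noncommuting variables \<open>'x\<close>:
  a monomial is a word \<open>'x list\<close>, and a series is its family of coefficients.
\<close>

typedef ('x, 'c) ncps = "UNIV :: ('x list \<Rightarrow> 'c) set"
  morphisms ncps_nth Abs_ncps
  by simp

setup_lifting type_definition_ncps

lemma ncps_eq_iff: "F = G \<longleftrightarrow> (\<forall>w. ncps_nth F w = ncps_nth G w)"
  by (auto simp: ncps_nth_inject[symmetric])

lemma ncps_eqI: "(\<And>w. ncps_nth F w = ncps_nth G w) \<Longrightarrow> F = G"
  by (simp add: ncps_eq_iff)

lift_definition ncps_const :: "'c::zero \<Rightarrow> ('x, 'c) ncps"
  is "\<lambda>c w. if w = [] then c else 0" .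

lift_definition ncps_var :: "'x \<Rightarrow> ('x, 'c::zero_neq_one) ncps"
  is "\<lambda>x w. if w = [x] then 1 else 0" .

instantiation ncps :: (type, ring_1) ring_1
begin

lift_definition zero_ncps :: "('a, 'b) ncps" is "\<lambda>_. 0" .

lift_definition one_ncps :: "('a, 'b) ncps" is "\<lambda>w. if w = [] then 1 else 0" .

lift_definition plus_ncps :: "('a, 'b) ncps \<Rightarrow> ('a, 'b) ncps \<Rightarrow> ('a, 'b) ncps"
  is "\<lambda>f g w. f w + g w" .

lift_definition minus_ncps :: "('a, 'b) ncps \<Rightarrow> ('a, 'b) ncps \<Rightarrow> ('a, 'b) ncps"
  is "\<lambda>f g w. f w - g w" .

lift_definition uminus_ncps :: "('a, 'b) ncps \<Rightarrow> ('a, 'b) ncps"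
  is "\<lambda>f w. - f w" .

lift_definition times_ncps :: "('a, 'b) ncps \<Rightarrow> ('a, 'b) ncps \<Rightarrow> ('a, 'b) ncps"
  is "\<lambda>f g w. \<Sum>k = 0..length w. f (take k w) * g (drop k w)" .

instance
proof
  fix F G H :: "('a, 'b) ncps"
  show "F * G * H = F * (G * H)"
  proof (rule ncps_eqI)
    fix w :: "'a list"
    let ?f = "ncps_nth F" and ?g = "ncps_nth G" and ?h = "ncps_nth H" and ?n = "length w"
    let ?t = "\<lambda>i k (_ :: nat). ?f (take i w) * ?g (take k (drop i w)) * ?h (drop (i + k) w)"
    have "ncps_nth (F * G * H) w = (\<Sum>j = 0..?n. \<Sum>i = 0..j. ?t i (j - i) (?n - j))"
      by (auto simp: times_ncps.rep_eq sum_distrib_right drop_take intro!: sum.cong)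
    also have "\<dots> = (\<Sum>j = 0..?n. \<Sum>i = 0..?n - j. ?t j i (?n - j - i))"
      by (rule fps_mult_assoc_lemma)
    also have "\<dots> = ncps_nth (F * (G * H)) w"
      by (auto simp: times_ncps.rep_eq sum_distrib_left mult.assoc add.commute intro!: sum.cong)
    finally show "ncps_nth (F * G * H) w = ncps_nth (F * (G * H)) w" .
  qed
  show "1 * F = F"
  proof (rule ncps_eqI)
    fix w :: "'a list"
    show "ncps_nth (1 * F) w = ncps_nth F w"
      by (simp add: times_ncps.rep_eq one_ncps.rep_eq sum.atLeast_Suc_atMost)
  qed
  show "F * 1 = F"
  proof (rule ncps_eqI)
    fix w :: "'a list"
    have "ncps_nth (F * 1) w = (\<Sum>k = 0..length w. if k = length w then ncps_nth F w else 0)"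
      unfolding times_ncps.rep_eq one_ncps.rep_eq by (rule sum.cong) auto
    then show "ncps_nth (F * 1) w = ncps_nth F w"
      by simp
  qed
  show "F + G + H = F + (G + H)" "F + G = G + F" "0 + F = F" "- F + F = 0" "F - G = F + - G"
    by (transfer; simp add: fun_eq_iff algebra_simps)+
  show "(F + G) * H = F * H + G * H" "F * (G + H) = F * G + F * H"
    by (transfer; simp add: fun_eq_iff algebra_simps sum.distrib)+
  show "(0 :: ('a, 'b) ncps) \<noteq> 1"
    by (transfer; auto simp: fun_eq_iff)
qed

end

text \<open>
  Substitution \<open>\<Sum>\<^sub>k f\<^sub>k B\<^sup>k\<close> of \<open>B\<close> into a univariate series \<open>f\<close>. It is meant for \<open>B\<close> with
  vanishing constant term: then \<open>B\<^sup>k\<close> has no monomials of length less than \<open>k\<close>, so that the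
  terms with \<open>k > length w\<close> do not contribute to the coefficient of \<open>w\<close>.
\<close>

definition ncps_compose :: "'c::field fps \<Rightarrow> ('x, 'c) ncps \<Rightarrow> ('x, 'c) ncps"
  where "ncps_compose f B =
    Abs_ncps (\<lambda>w. \<Sum>k = 0..length w. fps_nth f k * ncps_nth (B ^ k) w)"

lemma ncps_nth_compose:
  "ncps_nth (ncps_compose f B) w = (\<Sum>k = 0..length w. fps_nth f k * ncps_nth (B ^ k) w)"
  by (simp add: ncps_compose_def Abs_ncps_inverse)

lemma ncps_nth_power_eq_0:
  assumes "ncps_nth B [] = 0" and "length w < k"
  shows "ncps_nth (B ^ k) w = 0"
  using assms(2)
proof (induction k arbitrary: w)
  case (Suc k)
  have "ncps_nth B (take i w) * ncps_nth (B ^ k) (drop i w) = 0" if "i \<le> length w" for i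
    using Suc that assms(1) by (cases "i = 0") auto
  then show ?case
    by (simp add: times_ncps.rep_eq)
qed simp

definition ncps_exp :: "('x, 'c::field_char_0) ncps \<Rightarrow> ('x, 'c) ncps"
  where "ncps_exp B = ncps_compose (fps_exp 1) B"

text \<open>For \<open>A\<close> with constant term 1; \<open>fps_ln 1\<close> is the series of \<open>log (1 + t)\<close>.\<close>

definition ncps_log :: "('x, 'c::field_char_0) ncps \<Rightarrow> ('x, 'c) ncps"
  where "ncps_log A = ncps_compose (fps_ln 1) (A - 1)"

definition ncps_inverse :: "('x, 'c::field) ncps \<Rightarrow> ('x, 'c) ncps"
  where "ncps_inverse F = (THE G. F * G = 1 \<and> G * F = 1)"

lemma ncps_right_inverse_exists:
  fixes F :: "('x, 'c::field) ncps"
  assumes "ncps_nth F [] \<noteq> 0"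
  shows "\<exists>G. F * G = 1 \<and> ncps_nth G [] \<noteq> 0"
proof -
  let ?f = "ncps_nth F"
  define S where "S g w = (\<Sum>k = 1..length w. ?f (take k w) * g (drop k w))"
    for g :: "'x list \<Rightarrow> 'c" and w
  define T where "T g w = ((if w = [] then 1 else 0) - S g w) / ?f []"
    for g :: "'x list \<Rightarrow> 'c" and w
  define R where "R = inv_image less_than (length :: 'x list \<Rightarrow> nat)"
  define g where "g = wfrec R T"
  have "wf R"
    by (simp add: R_def)
  then have g: "g w = T (cut g R w) w" for w
    unfolding g_def by (rule wfrec)
  have "S (cut g R w) w = S g w" for w
    unfolding S_def by (intro sum.cong) (auto simp: cut_def R_def)
  then have g: "g w = ((if w = [] then 1 else 0) - S g w) / ?f []" for w
    using g[of w] by (simp add: T_def)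
  have "F * Abs_ncps g = 1"
  proof (rule ncps_eqI)
    fix w :: "'x list"
    have "ncps_nth (F * Abs_ncps g) w = ?f [] * g w + S g w"
      by (simp add: times_ncps.rep_eq Abs_ncps_inverse sum.atLeast_Suc_atMost S_def)
    also have "\<dots> = ncps_nth 1 w"
      using assms by (subst g) (simp add: one_ncps.rep_eq)
    finally show "ncps_nth (F * Abs_ncps g) w = ncps_nth 1 w" .
  qed
  moreover have "g [] \<noteq> 0"
    using assms by (subst g) (simp add: S_def)
  ultimately show ?thesis
    by (metis Abs_ncps_inverse UNIV_I)
qed

lemma ncps_inverse:
  fixes F :: "('x, 'c::field) ncps"
  assumes "ncps_nth F [] \<noteq> 0"
  shows "F * ncps_inverse F = 1" and "ncps_inverse F * F = 1"
proof -
  obtain G where G: "F * G = 1" "ncps_nth G [] \<noteq> 0"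
    using ncps_right_inverse_exists[OF assms] by blast
  obtain H where H: "G * H = 1"
    using ncps_right_inverse_exists[OF G(2)] by blast
  have "H = F * G * H"
    by (simp add: G(1))
  also have "\<dots> = F"
    by (simp add: mult.assoc H)
  finally have HF: "H = F" .
  have "\<exists>!G. F * G = 1 \<and> G * F = 1"
  proof (rule ex1I[of _ G])
    show "F * G = 1 \<and> G * F = 1"
      using G(1) H HF by simp
    fix K assume K: "F * K = 1 \<and> K * F = 1"
    have "K = K * (F * G)"
      by (simp add: G(1))
    also have "\<dots> = G"
      by (simp add: mult.assoc[symmetric] K)
    finally show "K = G" .
  qed
  from theI'[OF this] show "F * ncps_inverse F = 1" "ncps_inverse F * F = 1"
    by (auto simp: ncps_inverse_def)
qed

lift_definition ncps_abs :: "('x, 'c::abs) ncps \<Rightarrow> ('x, 'c) ncps"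
  is "\<lambda>f w. \<bar>f w\<bar>" .

text \<open>
  The value in \<open>[0, \<infinity>]\<close> of a series with nonnegative coefficients when the variable \<open>x\<close> is
  replaced by the nonnegative number \<open>v x\<close>.
\<close>

definition ncps_eval :: "('x, real) ncps \<Rightarrow> ('x \<Rightarrow> real) \<Rightarrow> ennreal"
  where "ncps_eval F v = (\<Sum>\<^sub>\<infinity>w\<in>UNIV. ennreal (ncps_nth F w * prod_list (map v w)))"

datatype letter = LX | LY

definition BCH_A :: "(letter, real) ncps"
  where "BCH_A = ncps_exp (ncps_var LX) * ncps_exp (ncps_var LY)"

definition Gamma_BCH :: "(letter, real) ncps"
  where "Gamma_BCH = ncps_abs (ncps_log BCH_A)"

definition Gamma_lam :: "real \<Rightarrow> (letter, real) ncps"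
  where "Gamma_lam l =
    ncps_abs ((BCH_A - 1) * ncps_inverse (ncps_const l + ncps_const (1 - l) * BCH_A))"

definition Gamma_BCH_real :: "real \<Rightarrow> real \<Rightarrow> ennreal"
  where "Gamma_BCH_real x y = ncps_eval Gamma_BCH (case_letter x y)"

definition Gamma_lam_real :: "real \<Rightarrow> real \<Rightarrow> real \<Rightarrow> ennreal"
  where "Gamma_lam_real l x y = ncps_eval (Gamma_lam l) (case_letter x y)"

lemma BCH_A_nth_Nil [simp]: "ncps_nth BCH_A [] = 1"
  by (simp add: BCH_A_def times_ncps.rep_eq ncps_exp_def ncps_nth_compose one_ncps.rep_eq)

lemma Gamma_lam_denominator_nth_Nil:
  "ncps_nth (ncps_const l + ncps_const (1 - l) * BCH_A) [] = 1"
  by (simp add: plus_ncps.rep_eq times_ncps.rep_eq ncps_const.rep_eq)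

text \<open>\<open>LEAST\<close> denotes the minimum, and is unspecified if there is none.\<close>

definition C2 :: real
  where "C2 = (LEAST c. \<exists>x y. 0 \<le> x \<and> 0 \<le> y \<and> Gamma_BCH_real x y = \<infinity> \<and> c = x + y)"

end

theory Submission
  imports Defs "HOL-Complex_Analysis.Complex_Analysis"
begin

text \<open>
  Put \<open>A = exp X exp Y\<close> and \<open>R\<^sub>l = (A - 1) (l + (1 - l) A)\<inverse>\<close>. Coefficientwise \<open>log A\<close> is the
  integral of \<open>R\<^sub>l\<close> over \<open>l\<close> in \<open>[0, 1]\<close>, so that everything depends on the resolvents \<open>R\<^sub>l\<close>
  (\<open>log_nth_has_integral\<close>). In one variable the resolvent is the ordinary power series
  \<open>(e\<^sup>x - 1) / (l + (1 - l) e\<^sup>x) = \<Sum> G\<^sub>n x\<^sup>n\<close> (\<open>res_coeff\<close>), and the Cayley-type identity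
  \<open>e\<^sup>x (1 - (1 - l) g) = 1 + l g\<close> for it turns \<open>R\<^sub>l\<close> into a sum of alternating products of \<open>g(X)\<close> and
  \<open>g(Y)\<close>, in which a product of \<open>2 j\<close> factors carries the scalar \<open>\<plusminus> (l (1 - l))\<^sup>j\<close>, up to one factor
  \<open>l\<close> or \<open>1 - l\<close>. A word determines its maximal blocks, so no cancellation takes place between these
  products. With the majorant \<open>\<alpha>\<^sub>l(x) = \<Sum> \<bar>G\<^sub>n\<bar> x\<^sup>n\<close> (\<open>res_maj\<close>) the majorant of \<open>R\<^sub>l\<close> is
  therefore a geometric series with ratio \<open>l (1 - l) \<alpha>\<^sub>l(x) \<alpha>\<^sub>l(y)\<close>. If that ratio stays below some
  \<open>\<kappa> < 1\<close> for all \<open>l\<close>, integration over \<open>l\<close> makes the majorant of \<open>log A\<close> finite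
  (\<open>Gamma_BCH_real_finite\<close>), and a fixed \<open>l\<close> with infinite value has ratio at least 1
  (\<open>Gamma_lam_real_finite\<close>).
  
  The extremal problem is thus to find the smallest \<open>x + y\<close> for which the ratio reaches 1 for some
  \<open>l\<close>. Two facts solve it. First, among pairs with a given sum \<open>2 m\<close> the diagonal is strictly optimal:
  \<open>\<alpha>\<^sub>l(m (1 + s)) \<alpha>\<^sub>l(m (1 - s)) < \<alpha>\<^sub>l(m)\<^sup>2\<close> (\<open>res_maj_off_diagonal\<close>). Secondly, on the diagonal
  the quantity \<open>\<beta>\<^sub>l(m) = sqrt (l (1 - l)) \<alpha>\<^sub>l(m)\<close> (\<open>res_beta\<close>) increases for \<open>l\<close> up to 0.358653 and
  decreases from 0.358657 to 1/2; it is less than 1 for \<open>m = 1.44923965\<close> and exceeds 1 for some \<open>l\<close> when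
  \<open>m = 1.449239655\<close>. By compactness there is a least \<open>m\<close> in between at which the maximum over \<open>l\<close> equals
  1 (\<open>critical_radius_exists\<close>), and \<open>C2 = 2 m\<close>.
  
  At the critical \<open>m\<close> the series diverges (\<open>Gamma_BCH_real_critical\<close>). Restricting it to words with an
  even number of blocks and inserting the signs of the \<open>G\<^sub>n\<close> at the critical \<open>l\<^sub>0\<close> bounds it below by
  \<open>\<Sum>\<^sub>j \<integral> r(l)\<^sup>j dl\<close>, where \<open>r\<close> is Lipschitz and \<open>r(l\<^sub>0) = 1\<close>; the \<open>j\<close>-th integral is at least
  \<open>const / (j + 1)\<close>, so the harmonic series gives the divergence.
  
  The monotonicity and the off-diagonal inequality are verified by interval arithmetic on finitely
  many coefficients, with a tail controlled by \<open>l (1 - l) \<bar>G\<^sub>n\<^sub>+\<^sub>1\<bar> \<le> 0.26 / 3.14\<^sup>n\<close>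
  (\<open>res_coeff_Suc_bound\<close>); here 3.14 comes from the poles, which lie at distance at least \<open>\<pi>\<close>
  from 0.
\<close>

section \<open>The resolvent of the exponential series in one variable\<close>

definition resolvent_fps :: "'a::field_char_0 \<Rightarrow> 'a fps" where
  "resolvent_fps l = (fps_exp 1 - 1) * inverse (fps_const l + fps_const (1 - l) * fps_exp 1)"

lemma resolvent_fps_mult:
  "resolvent_fps l * (fps_const l + fps_const (1 - l) * fps_exp 1) = fps_exp 1 - 1"
proof -
  have "inverse (fps_const l + fps_const (1 - l) * fps_exp 1) * (fps_const l + fps_const (1 - l) * fps_exp 1) = 1"
    by (rule inverse_mult_eq_1) simp
  then show ?thesis
    by (simp add: resolvent_fps_def mult.assoc)
qed

text \<open>
  Solved for the exponential, the definition says that \<open>e\<^sup>x\<close> is a Moebius transform of the resolvent.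
  This form multiplies well: it is what carries the resolvent from \<open>e\<^sup>x\<close> to \<open>e\<^sup>x e\<^sup>y\<close>.
\<close>

lemma resolvent_fps_cayley:
  "fps_exp 1 * (1 - fps_const (1 - l) * resolvent_fps l) = 1 + fps_const l * resolvent_fps l"
proof -
  have c: "fps_const (1 - l) = 1 - fps_const l"
    by (simp add: fps_const_sub [symmetric] del: fps_const_sub)
  show ?thesis
    using resolvent_fps_mult[of l] unfolding c by algebra
qed

lemma resolvent_fps_nth_0 [simp]: "fps_nth (resolvent_fps l) 0 = 0"
  by (simp add: resolvent_fps_def)

text \<open>
  The resolvent solves a Riccati equation because the Moebius transforms of \<open>e\<^sup>x\<close> do. The equation
  yields a quadratic recurrence for the coefficients, which replaces their closed form everywhere below.
\<close>

lemma fps_deriv_resolvent: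
  "fps_deriv (resolvent_fps l) =
     1 - fps_const (1 - 2 * l) * resolvent_fps l - fps_const (l * (1 - l)) * (resolvent_fps l)\<^sup>2"
proof -
  define E :: "'a fps" where "E = fps_exp 1"
  define F where "F = resolvent_fps l"
  define L where "L = fps_const l"
  define D where "D = L + (1 - L) * E"
  have c: "fps_const (1 - l) = 1 - L" "fps_const (1 - 2 * l) = 1 - 2 * L" "fps_const (l * (1 - l)) = L * (1 - L)"
    by (simp_all add: L_def fps_const_sub [symmetric] fps_const_mult [symmetric] numeral_fps_const
        del: fps_const_sub fps_const_mult)
  have FD: "F * D = E - 1"
    using resolvent_fps_mult[of l] by (simp add: F_def D_def E_def c L_def[symmetric])
  have D': "fps_deriv D = (1 - L) * E"
    by (simp add: D_def E_def L_def fps_const_sub [symmetric] del: fps_const_sub)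
  have "fps_deriv (F * D) = E"
    unfolding FD by (simp add: E_def)
  then have F': "fps_deriv F * D + F * ((1 - L) * E) = E"
    by (simp add: D' algebra_simps)
  have "D $ 0 \<noteq> 0"
    by (simp add: D_def E_def L_def)
  then have "D \<noteq> 0"
    by auto
  have "fps_deriv F * D * D = (1 - (1 - 2 * L) * F - L * (1 - L) * F\<^sup>2) * D * D"
    using FD F' D_def by algebra
  then have "fps_deriv F = 1 - (1 - 2 * L) * F - L * (1 - L) * F\<^sup>2"
    using \<open>D \<noteq> 0\<close> by simp
  then show ?thesis
    by (simp add: F_def c)
qed

definition res_coeff :: "'a::field_char_0 \<Rightarrow> nat \<Rightarrow> 'a" where
  "res_coeff l n = fps_nth (resolvent_fps l) n"

lemma res_coeff_0 [simp]: "res_coeff l 0 = 0"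
  by (simp add: res_coeff_def)

lemma res_coeff_Suc:
  "of_nat (Suc n) * res_coeff l (Suc n) =
     (if n = 0 then 1 else 0) - (1 - 2 * l) * res_coeff l n
       - l * (1 - l) * (\<Sum>i\<le>n. res_coeff l i * res_coeff l (n - i))"
proof -
  have "fps_nth (fps_deriv (resolvent_fps l)) n = of_nat (Suc n) * res_coeff l (Suc n)"
    by (simp add: res_coeff_def)
  moreover have "fps_nth ((resolvent_fps l)\<^sup>2) n = (\<Sum>i\<le>n. res_coeff l i * res_coeff l (n - i))"
    by (simp add: power2_eq_square fps_mult_nth res_coeff_def atMost_atLeast0)
  ultimately show ?thesis
    unfolding fps_deriv_resolvent by (simp add: res_coeff_def)
qed

lemma res_coeff_1 [simp]: "res_coeff l (Suc 0) = 1"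
  using res_coeff_Suc[of 0 l] by simp

lemma res_coeff_of_real: "res_coeff (of_real l) n = (of_real (res_coeff l n) :: 'a::{field_char_0,real_field})"
proof (induction n rule: less_induct)
  case (less n)
  show ?case
  proof (cases n)
    case (Suc k)
    have "of_nat (Suc k) * res_coeff (of_real l :: 'a) (Suc k) = of_real (of_nat (Suc k) * res_coeff l (Suc k))"
      unfolding res_coeff_Suc using less Suc by simp
    then show ?thesis
      using Suc by (simp del: of_nat_Suc)
  qed simp
qed

text \<open>
  Replacing \<open>l\<close> by \<open>1 - l\<close> corresponds to \<open>x \<mapsto> - x\<close> and a change of sign. Absolute values are
  unaffected, which reduces every estimate to \<open>l \<le> 1/2\<close>.
\<close>

lemma res_coeff_reflect: "res_coeff (1 - l) n = (-1) ^ Suc n * res_coeff l n"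
proof (induction n rule: less_induct)
  case (less n)
  show ?case
  proof (cases n)
    case (Suc k)
    have s: "(\<Sum>i\<le>k. res_coeff (1 - l) i * res_coeff (1 - l) (k - i)) = 
          (-1) ^ k * (\<Sum>i\<le>k. res_coeff l i * res_coeff l (k - i))"
      unfolding sum_distrib_left
    proof (rule sum.cong)
      fix i assume "i \<in> {..k}"
      then have "(-1::'a) ^ Suc i * (-1) ^ Suc (k - i) = (-1) ^ k"
        by (simp add: power_add[symmetric])
      then show "res_coeff (1 - l) i * res_coeff (1 - l) (k - i) = (-1) ^ k * (res_coeff l i * res_coeff l (k - i))"
        using less[of i] less[of "k - i"] Suc \<open>i \<in> {..k}\<close> by (simp add: algebra_simps)
    qed simp
    have k: "res_coeff (1 - l) k = (-1) ^ Suc k * res_coeff l k"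
      using less[of k] Suc by simp
    have "of_nat (Suc k) * res_coeff (1 - l) (Suc k) = (-1) ^ k * (of_nat (Suc k) * res_coeff l (Suc k))"
      unfolding res_coeff_Suc s k by (cases "k = 0") (simp_all add: algebra_simps)
    then have "of_nat (Suc k) * res_coeff (1 - l) (Suc k) = of_nat (Suc k) * ((-1) ^ k * res_coeff l (Suc k))"
      by (simp only: mult.left_commute)
    then show ?thesis
      using Suc by (simp del: of_nat_Suc)
  qed simp
qed

text \<open>
  The derivative of \<open>(A - 1) / (l + (1 - l) A)\<close> in \<open>l\<close> is its square; coefficientwise this
  follows by induction along the recurrence.
\<close>

lemma has_real_derivative_res_coeff:
  "((\<lambda>l. res_coeff l n) has_real_derivative fps_nth ((resolvent_fps l)\<^sup>2) n) (at l within A)"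
proof (induction n rule: less_induct)
  case (less n)
  show ?case
  proof (cases n)
    case (Suc k)
    let ?F = "resolvent_fps l"
    have eq: "res_coeff l (Suc k) = ((if k = 0 then 1 else 0) - (1 - 2 * l) * res_coeff l k
       - l * (1 - l) * (\<Sum>i\<le>k. res_coeff l i * res_coeff l (k - i))) / of_nat (Suc k)" for l :: real
      using res_coeff_Suc[of k l] by (simp add: field_simps)
    have [derivative_intros]: "((\<lambda>l. res_coeff l i) has_real_derivative fps_nth (?F\<^sup>2) i) (at l within A)" if "i \<le> k" for i
      using less[of i] that Suc by simp
    have D: "((\<lambda>l. res_coeff l (Suc k)) has_real_derivative
        (2 * res_coeff l k - (1 - 2 * l) * fps_nth (?F\<^sup>2) k 
         - (1 - 2 * l) * (\<Sum>i\<le>k. res_coeff l i * res_coeff l (k - i))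
         - l * (1 - l) * (\<Sum>i\<le>k. res_coeff l i * fps_nth (?F\<^sup>2) (k - i) + fps_nth (?F\<^sup>2) i * res_coeff l (k - i))) 
        / of_nat (Suc k)) (at l within A)"
      unfolding eq
      by (rule derivative_eq_intros refl | simp)+ (simp add: field_simps del: of_nat_Suc)
    have s1: "(\<Sum>i\<le>k. res_coeff l i * res_coeff l (k - i)) = fps_nth (?F\<^sup>2) k"
      by (simp add: power2_eq_square fps_mult_nth res_coeff_def atMost_atLeast0)
    have "(\<Sum>i\<le>k. fps_nth (?F\<^sup>2) i * res_coeff l (k - i)) = fps_nth (?F\<^sup>2 * ?F) k"
      by (simp add: fps_mult_nth res_coeff_def atMost_atLeast0)
    moreover have "(\<Sum>i\<le>k. res_coeff l i * fps_nth (?F\<^sup>2) (k - i)) = fps_nth (?F * ?F\<^sup>2) k"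
      by (subst fps_mult_nth) (simp add: res_coeff_def atMost_atLeast0)
    ultimately have s2: "(\<Sum>i\<le>k. res_coeff l i * fps_nth (?F\<^sup>2) (k - i) + fps_nth (?F\<^sup>2) i * res_coeff l (k - i))
        = 2 * fps_nth (?F ^ 3) k"
      by (simp add: sum.distrib power2_eq_square power3_eq_cube mult.assoc)
    have "fps_nth (fps_deriv (?F\<^sup>2)) k = of_nat (Suc k) * fps_nth (?F\<^sup>2) (Suc k)"
      by simp
    moreover have "fps_deriv (?F\<^sup>2) = 2 * ?F * fps_deriv ?F"
      by (simp add: power2_eq_square)
    moreover have "2 * ?F * fps_deriv ?F
        = fps_const 2 * ?F - fps_const (2 * (1 - 2 * l)) * ?F\<^sup>2 - fps_const (2 * (l * (1 - l))) * ?F ^ 3"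
    proof -
      have c: "fps_const (2 * x) = 2 * fps_const x" for x :: real
        by (simp add: numeral_fps_const)
      show ?thesis
        unfolding fps_deriv_resolvent c numeral_fps_const[symmetric]
        by (simp add: power2_eq_square power3_eq_cube right_diff_distrib mult_ac)
    qed
    ultimately have "of_nat (Suc k) * fps_nth (?F\<^sup>2) (Suc k)
       = 2 * res_coeff l k - 2 * (1 - 2 * l) * fps_nth (?F\<^sup>2) k - 2 * (l * (1 - l)) * fps_nth (?F ^ 3) k"
      by (simp add: res_coeff_def)
    then have e1: "fps_nth (?F\<^sup>2) (Suc k) = (2 * res_coeff l k - 2 * (1 - 2 * l) * fps_nth (?F\<^sup>2) k - 2 * (l * (1 - l)) * fps_nth (?F ^ 3) k) / of_nat (Suc k)"
      by (simp add: field_simps)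
    have e2: "\<dots> = (2 * res_coeff l k - (1 - 2 * l) * fps_nth (?F\<^sup>2) k 
         - (1 - 2 * l) * (\<Sum>i\<le>k. res_coeff l i * res_coeff l (k - i))
         - l * (1 - l) * (\<Sum>i\<le>k. res_coeff l i * fps_nth (?F\<^sup>2) (k - i) + fps_nth (?F\<^sup>2) i * res_coeff l (k - i))) 
        / of_nat (Suc k)"
      unfolding s1 s2 by (simp add: algebra_simps)
    show ?thesis
      using D unfolding e1[unfolded e2, symmetric] Suc .
  qed (simp add: power2_eq_square)
qed

text \<open>
  The Riccati equation expresses the square, and hence the derivative in \<open>l\<close>, linearly through two
  consecutive coefficients. This makes the derivative accessible to the same interval bounds as the
  coefficients themselves.
\<close>

lemma res_coeff_deriv_eq:
  assumes "n \<ge> 1"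
  shows "l * (1 - l) * fps_nth ((resolvent_fps l)\<^sup>2) n = - (1 - 2 * l) * res_coeff l n - of_nat (Suc n) * res_coeff l (Suc n)"
proof -
  have "fps_nth ((resolvent_fps l)\<^sup>2) n = (\<Sum>i\<le>n. res_coeff l i * res_coeff l (n - i))"
    by (simp add: power2_eq_square fps_mult_nth res_coeff_def atMost_atLeast0)
  then show ?thesis
    using res_coeff_Suc[of n l] assms by (simp add: algebra_simps del: of_nat_Suc)
qed

section \<open>Decay of the coefficients\<close>

text \<open>
  The partial fraction expansion of the resolvent is that of a cotangent. It is obtained from the
  reflection formula of the Digamma function, whose derivatives come with explicit series.
\<close>

lemma Digamma_reflection_strip:
  fixes z :: complex
  assumes "0 < Re z" "Re z < 1"
  shows "Digamma (1 - z) - Digamma z = of_real pi * cot (of_real pi * z)"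
proof -
  define S where "S = {w::complex. 0 < Re w \<and> Re w < 1}"
  have S: "S = {w. 0 < Re w} \<inter> {w. Re w < 1}"
    by (auto simp: S_def)
  have "open S"
    unfolding S by (intro open_Int open_halfspace_Re_gt open_halfspace_Re_lt)
  have nonpos: "w \<notin> \<int>\<^sub>\<le>\<^sub>0" if "0 < Re w" for w :: complex
    using that by (auto elim!: nonpos_Ints_cases)
  have sin: "sin (of_real pi * w) \<noteq> 0" if "w \<in> S" for w
  proof
    assume "sin (of_real pi * w) = 0"
    then obtain n :: int where "of_real pi * w = of_real (n * pi)"
      by (auto simp: sin_eq_0)
    then have "w = of_int n"
      by simp
    with that show False
      by (auto simp: S_def)
  qed
  let ?g = "\<lambda>w::complex. Gamma w * Gamma (1 - w) * sin (of_real pi * w)"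
  have "((\<lambda>_. of_real pi) has_field_derivative 0) (at z)"
    by simp
  then have "(?g has_field_derivative 0) (at z)"
  proof (rule has_field_derivative_transform_within_open[OF _ \<open>open S\<close>])
    show "z \<in> S"
      using assms by (simp add: S_def)
    show "of_real pi = ?g w" if "w \<in> S" for w
      using Gamma_reflection_complex[of w] sin[OF that] by simp
  qed
  moreover have "(?g has_field_derivative
      Gamma z * Gamma (1 - z) * sin (of_real pi * z) *
      (Digamma z - Digamma (1 - z) + of_real pi * cot (of_real pi * z))) (at z)"
    using nonpos[of z] nonpos[of "1 - z"] sin[of z] assms
    by (auto intro!: derivative_eq_intros simp: cot_def S_def field_simps)
  ultimately have "Gamma z * Gamma (1 - z) * sin (of_real pi * z) *
      (Digamma z - Digamma (1 - z) + of_real pi * cot (of_real pi * z)) = 0"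
    by (rule DERIV_unique[symmetric])
  moreover have "Gamma z * Gamma (1 - z) * sin (of_real pi * z) \<noteq> 0"
    using nonpos[of z] nonpos[of "1 - z"] sin[of z] assms by (simp add: Gamma_eq_zero_iff S_def)
  ultimately have "Digamma z - Digamma (1 - z) + of_real pi * cot (of_real pi * z) = 0"
    by simp
  then show ?thesis
    by (simp add: algebra_simps add_eq_0_iff)
qed

lemma inverse_square_half_sum:
  "summable (\<lambda>k. inverse ((real k + 1/2)\<^sup>2))" "(\<Sum>k. inverse ((real k + 1/2)\<^sup>2)) \<le> 5"
proof -
  define T where "T k = (if k = 0 then 4 else inverse (real k) - inverse (real (Suc k)))" for k
  have "(\<lambda>k. inverse (real (Suc k)) - inverse (real (Suc (Suc k)))) sums (inverse (real (Suc 0)) - 0)"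
    by (rule telescope_sums'[OF LIMSEQ_inverse_real_of_nat])
  then have T: "(\<lambda>k. T (Suc k)) sums 1"
    by (simp add: T_def)
  then have T: "T sums 5"
    by (subst (asm) sums_Suc_iff) (simp add: T_def)
  have le: "inverse ((real k + 1/2)\<^sup>2) \<le> T k" for k
  proof (cases "k = 0")
    case False
    then have "inverse ((real k + 1/2)\<^sup>2) \<le> inverse (real k * real (Suc k))"
      by (intro le_imp_inverse_le mult_pos_pos) (auto simp: power2_eq_square algebra_simps)
    also have "\<dots> = T k"
      using False by (simp add: T_def field_simps)
    finally show ?thesis .
  qed (simp add: T_def power2_eq_square)
  show "summable (\<lambda>k. inverse ((real k + 1/2)\<^sup>2))"
    by (rule summable_comparison_test[OF _ sums_summable[OF T]]) (use le in \<open>auto intro!: exI[of _ 0]\<close>)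
  from suminf_le[OF le this sums_summable[OF T]] show "(\<Sum>k. inverse ((real k + 1/2)\<^sup>2)) \<le> 5"
    using sums_unique[OF T] by simp
qed

text \<open>
  Every term of the series of the Polygamma function has its pole at a distance of at least 1/2 plus an integer
  from the point, so that each further derivative costs a factor 2 in addition to the factorial.
\<close>

lemma norm_Polygamma_Suc_half_le:
  fixes z :: complex
  assumes "Re z = 1/2"
  shows "norm (Polygamma (Suc n) z) \<le> 5 * fact (Suc n) * 2 ^ n"
proof -
  have nz: "real k + 1/2 \<le> norm (z + of_nat k)" for k
    using abs_Re_le_cmod[of "z + of_nat k"] assms by simp
  have le: "norm (inverse ((z + of_nat k) ^ Suc (Suc n))) \<le> inverse ((real k + 1/2)\<^sup>2) * 2 ^ n" for k
  proof -
    have "norm (inverse ((z + of_nat k) ^ Suc (Suc n))) = inverse (norm (z + of_nat k) ^ Suc (Suc n))"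
      by (simp add: norm_inverse norm_power norm_mult)
    also have "\<dots> \<le> inverse ((real k + 1/2) ^ Suc (Suc n))"
      by (intro le_imp_inverse_le power_mono nz) auto
    also have "\<dots> = inverse ((real k + 1/2)\<^sup>2) * inverse ((real k + 1/2) ^ n)"
      by (simp add: power2_eq_square)
    also have "inverse ((real k + 1/2) ^ n) \<le> inverse ((1/2) ^ n)"
      by (intro le_imp_inverse_le power_mono) auto
    finally show ?thesis
      by (simp add: power_one_over field_simps)
  qed
  have sm: "summable (\<lambda>k. inverse ((real k + 1/2)\<^sup>2) * 2 ^ n)"
    by (intro summable_mult2 inverse_square_half_sum)
  have "norm (\<Sum>k. inverse ((z + of_nat k) ^ Suc (Suc n))) \<le> (\<Sum>k. inverse ((real k + 1/2)\<^sup>2) * 2 ^ n)"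
    by (rule norm_suminf_le[OF le sm])
  also have "\<dots> = (\<Sum>k. inverse ((real k + 1/2)\<^sup>2)) * 2 ^ n"
    by (rule suminf_mult2[symmetric]) (rule inverse_square_half_sum)
  also have "\<dots> \<le> 5 * 2 ^ n"
    by (intro mult_right_mono inverse_square_half_sum) auto
  finally have le': "norm (\<Sum>k. inverse ((z + of_nat k) ^ Suc (Suc n))) \<le> 5 * 2 ^ n" .
  have "norm (Polygamma (Suc n) z) = fact (Suc n) * norm (\<Sum>k. inverse ((z + of_nat k) ^ Suc (Suc n)))"
    unfolding Polygamma_def by (simp add: norm_mult norm_power del: fact_Suc power_Suc)
  also have "\<dots> \<le> fact (Suc n) * (5 * 2 ^ n)"
    by (intro mult_left_mono le') auto
  finally show ?thesis
    by (simp only: mult_ac)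
qed

text \<open>
  With \<open>t = ln ((1 - l) / l)\<close> the poles of the resolvent are \<open>- t + (2 k + 1) \<pi> \<i>\<close>, and on the strip
  \<open>\<bar>Im z\<bar> < \<pi>\<close> the resolvent times \<open>l (1 - l)\<close> is a constant plus a difference of two Digamma
  functions of affine arguments with slope \<open>\<plusminus> \<i> / (2 \<pi>)\<close>. At 0 these arguments have real part
  1/2, and the Polygamma bound gives the decay rate \<open>1/\<pi>\<close>, uniformly in \<open>l\<close> except for the factor
  \<open>l (1 - l)\<close>.
\<close>

lemma res_coeff_Suc_bound:
  fixes l :: real
  assumes "0 \<le> l" "l \<le> 1"
  shows "l * (1 - l) * \<bar>res_coeff l (Suc n)\<bar> \<le> 13/50 * (50/157) ^ n"
proof (cases "l = 0 \<or> l = 1")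
  case False
  then have "l \<noteq> 0" "l \<noteq> 1"
    by auto
  then have l: "0 < l" "l < 1"
    using assms by simp_all
  define t where "t = ln ((1 - l) / l)"
  define f :: "complex \<Rightarrow> complex" where "f z = (exp z - 1) * inverse (of_real l + (1 - of_real l) * exp z)" for z
  define s where "s z = \<i> / (2 * of_real pi) * z + (1/2 + \<i> * of_real t / (2 * of_real pi))" for z :: complex
  define s' where "s' z = - \<i> / (2 * of_real pi) * z + (1/2 - \<i> * of_real t / (2 * of_real pi))" for z :: complex
  define S where "S = {w::complex. \<bar>Im w\<bar> < pi}"
  have Sopen: "open S"
  proof -
    have "S = {w. Im w < pi} \<inter> {w. Im w > - pi}"
      by (auto simp: S_def)
    then show ?thesis
      by (simp add: open_Int open_halfspace_Im_lt open_halfspace_Im_gt)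
  qed
  have s1: "s' z = 1 - s z" for z
    by (simp add: s_def s'_def field_simps)
  have Re_s: "Re (s z) = 1/2 - Im z / (2 * pi)" for z
    by (simp add: s_def Re_divide Im_divide power2_eq_square)
  have str: "0 < Re (s z) \<and> Re (s z) < 1" if "z \<in> S" for z
    using that pi_gt_zero unfolding Re_s by (auto simp: S_def field_simps abs_less_iff)
  have nonpos: "w \<notin> \<int>\<^sub>\<le>\<^sub>0" if "0 < Re w" for w :: complex
    using that by (auto elim!: nonpos_Ints_cases)
  have key: "of_real (l * (1 - l)) * f z = of_real (l - 1/2) + \<i> / (2 * of_real pi) * (Digamma (s' z) - Digamma (s z))"
    if "z \<in> S" for z
  proof -
    define E where "E = exp z"
    have ew: "exp (z + of_real t) = of_real ((1 - l) / l) * E"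
    proof -
      have "exp t = (1 - l) / l"
        using l by (simp add: t_def)
      then have "exp (of_real t) = (of_real ((1 - l) / l) :: complex)"
        by (simp only: exp_of_real)
      then show ?thesis
        by (simp only: exp_add E_def mult.commute)
    qed
    have Ene: "E \<noteq> 0"
      by (simp add: E_def)
    have "2 * \<i> * (of_real pi * s z) = \<i> * of_real pi - (z + of_real t)"
      by (simp add: s_def field_simps)
    then have e2: "exp (2 * \<i> * (of_real pi * s z)) = - 1 / (of_real ((1 - l) / l) * E)"
      by (simp add: exp_diff ew)
    define c where "c = exp (\<i> * (of_real pi * s z))"
    have c2: "c\<^sup>2 = - 1 / (of_real ((1 - l) / l) * E)"
      unfolding e2[symmetric] c_def by (simp add: exp_double[symmetric] mult_ac)
    have cne: "c \<noteq> 0"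
      by (simp add: c_def)
    have sinne: "sin (of_real pi * s z) \<noteq> 0"
    proof
      assume "sin (of_real pi * s z) = 0"
      then obtain n :: int where "of_real pi * s z = of_real (n * pi)"
        by (auto simp: sin_eq_0)
      then have "s z = of_int n"
        by simp
      with str[OF that] show False
        by auto
    qed
    have sinc: "sin (of_real pi * s z) = (c - inverse c) / (2 * \<i>)" and cosc: "cos (of_real pi * s z) = (c + inverse c) / 2"
      by (simp_all add: sin_exp_eq cos_exp_eq c_def exp_minus)
    have "c\<^sup>2 - 1 \<noteq> 0"
      using sinne cne unfolding sinc by (auto simp: field_simps power2_eq_square)
    have cot: "cot (of_real pi * s z) = \<i> * (c\<^sup>2 + 1) / (c\<^sup>2 - 1)"
      using cne sinne \<open>c\<^sup>2 - 1 \<noteq> 0\<close> unfolding cot_def sinc cosc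
      by (simp add: field_simps power2_eq_square)
    have D: "of_real l + (1 - of_real l) * E \<noteq> 0"
      using \<open>c\<^sup>2 - 1 \<noteq> 0\<close> l Ene unfolding c2 by (auto simp: field_simps)
    have cot': "cot (of_real pi * s z) = \<i> * (of_real l - (1 - of_real l) * E) / (of_real l + (1 - of_real l) * E)"
    proof -
      define M N K :: complex where "M = of_real l - (1 - of_real l) * E"
        and "N = of_real l + (1 - of_real l) * E" and "K = (1 - of_real l) * E"
      have "K \<noteq> 0"
        using l Ene by (simp add: K_def)
      have "c\<^sup>2 + 1 = - M / K" "c\<^sup>2 - 1 = - N / K"
        using l Ene unfolding c2 M_def N_def K_def by (simp_all add: field_simps)
      then have "cot (of_real pi * s z) = \<i> * M / N"
        unfolding cot using D \<open>K \<noteq> 0\<close> by (simp add: N_def[symmetric])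
      then show ?thesis
        by (simp only: M_def N_def)
    qed
    have dg: "Digamma (s' z) - Digamma (s z) = of_real pi * cot (of_real pi * s z)"
      unfolding s1 using str[OF that] by (intro Digamma_reflection_strip) auto
    define x N :: complex where "x = of_real l" and "N = x + (1 - x) * E"
    have "N \<noteq> 0"
      using D by (simp add: N_def x_def)
    have "x * (1 - x) * (E - 1) * 2 = (2 * x - 1) * N - (x - (1 - x) * E)"
      unfolding N_def by algebra
    then have "x * (1 - x) * ((E - 1) * inverse N) = (x - 1/2) - (x - (1 - x) * E) / (2 * N)"
      using \<open>N \<noteq> 0\<close> by (simp add: divide_simps) (simp add: algebra_simps)
    moreover have "\<i> / (2 * of_real pi) * (of_real pi * (\<i> * (x - (1 - x) * E) / N)) = - ((x - (1 - x) * E) / (2 * N))"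
      by (simp add: minus_divide_left)
    ultimately show ?thesis
      unfolding dg cot' f_def E_def[symmetric] by (simp add: x_def N_def)
  qed
  have fexp: "f has_fps_expansion resolvent_fps (of_real l)"
    unfolding f_def resolvent_fps_def
    by (rule fps_expansion_intros | simp)+
  have zS: "0 \<in> S"
    by (simp add: S_def)
  define T where "T = {w::complex. 0 < Re w}"
  have Topen: "open T"
    by (simp add: T_def open_halfspace_Re_gt)
  have TZ: "T \<inter> \<int>\<^sub>\<le>\<^sub>0 = {}"
    using nonpos by (auto simp: T_def)
  have sT: "s z \<in> T" "s' z \<in> T" if "z \<in> S" for z
    using str[OF that] by (auto simp: T_def s1)
  have hol: "(\<lambda>z. Digamma (s z)) holomorphic_on S" "(\<lambda>z. Digamma (s' z)) holomorphic_on S"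
  proof -
    have "s holomorphic_on S" "s' holomorphic_on S"
      unfolding s_def s'_def by (intro holomorphic_intros; simp)+
    moreover have "Digamma holomorphic_on T"
      using TZ by (rule holomorphic_on_Polygamma)
    moreover have "s ` S \<subseteq> T" "s' ` S \<subseteq> T"
      using sT by blast+
    ultimately have "Digamma \<circ> s holomorphic_on S" "Digamma \<circ> s' holomorphic_on S"
      by (blast intro: holomorphic_on_compose_gen)+
    then show "(\<lambda>z. Digamma (s z)) holomorphic_on S" "(\<lambda>z. Digamma (s' z)) holomorphic_on S"
      by (simp_all add: o_def)
  qed
  have fhol: "(\<lambda>z. of_real (l - 1/2) + \<i> / (2 * of_real pi) * (Digamma (s' z) - Digamma (s z))) holomorphic_on S"
    by (intro holomorphic_intros hol)
  have cfhol: "(\<lambda>z. of_real (l * (1 - l)) * f z) holomorphic_on S"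
    by (rule holomorphic_transform[OF fhol]) (simp only: key)
  have "(deriv ^^ Suc n) (\<lambda>z. of_real (l * (1 - l)) * f z) 0 =
        (deriv ^^ Suc n) (\<lambda>z. of_real (l - 1/2) + \<i> / (2 * of_real pi) * (Digamma (s' z) - Digamma (s z))) 0"
    by (rule higher_deriv_transform_within_open[OF cfhol fhol Sopen zS]) (rule key)
  also have "\<dots> = \<i> / (2 * of_real pi) * ((deriv ^^ Suc n) (\<lambda>z. Digamma (s' z)) 0 - (deriv ^^ Suc n) (\<lambda>z. Digamma (s z)) 0)"
  proof -
    have h: "(\<lambda>z. Digamma (s' z) - Digamma (s z)) holomorphic_on S"
      by (intro holomorphic_on_diff hol)
    have "(deriv ^^ Suc n) (\<lambda>z. of_real (l - 1/2) + \<i> / (2 * of_real pi) * (Digamma (s' z) - Digamma (s z))) 0 =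
        (deriv ^^ Suc n) (\<lambda>z. of_real (l - 1/2)) 0 + (deriv ^^ Suc n) (\<lambda>z. \<i> / (2 * of_real pi) * (Digamma (s' z) - Digamma (s z))) 0"
      by (rule higher_deriv_add[OF _ _ Sopen zS]) (intro holomorphic_intros h)+
    also have "(deriv ^^ Suc n) (\<lambda>z::complex. of_real (l - 1/2) :: complex) 0 = 0"
      by (simp only: higher_deriv_const nat.distinct if_False)
    also have "(deriv ^^ Suc n) (\<lambda>z. \<i> / (2 * of_real pi) * (Digamma (s' z) - Digamma (s z))) 0
        = \<i> / (2 * of_real pi) * (deriv ^^ Suc n) (\<lambda>z. Digamma (s' z) - Digamma (s z)) 0"
      by (rule higher_deriv_cmult[OF h zS Sopen])
    also have "(deriv ^^ Suc n) (\<lambda>z. Digamma (s' z) - Digamma (s z)) 0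
        = (deriv ^^ Suc n) (\<lambda>z. Digamma (s' z)) 0 - (deriv ^^ Suc n) (\<lambda>z. Digamma (s z)) 0"
      by (rule higher_deriv_diff[OF hol(2,1) Sopen zS])
    finally show ?thesis
      by (simp only: add_0)
  qed
  also have "(deriv ^^ Suc n) (\<lambda>z. Digamma (s z)) 0 = (\<i> / (2 * of_real pi)) ^ Suc n * Polygamma (Suc n) (s 0)"
  proof -
    have "(deriv ^^ Suc n) (\<lambda>z. Digamma (s z)) 0 = (\<i> / (2 * of_real pi)) ^ Suc n * (deriv ^^ Suc n) Digamma (s 0)"
      unfolding s_def
      by (rule higher_deriv_compose_linear'[OF holomorphic_on_Polygamma[OF TZ] Sopen Topen zS])
         (use sT in \<open>simp add: s_def\<close>)
    also have "(deriv ^^ Suc n) Digamma (s 0) = Polygamma (Suc n) (s 0)"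
      using higher_deriv_Polygamma[OF nonpos, of "s 0" "Suc n" 0] str[OF zS] by (simp del: funpow.simps)
    finally show ?thesis .
  qed
  also have "(deriv ^^ Suc n) (\<lambda>z. Digamma (s' z)) 0 = (- \<i> / (2 * of_real pi)) ^ Suc n * Polygamma (Suc n) (s' 0)"
  proof -
    have "(deriv ^^ Suc n) (\<lambda>z. Digamma (s' z)) 0 = (- \<i> / (2 * of_real pi)) ^ Suc n * (deriv ^^ Suc n) Digamma (s' 0)"
      unfolding s'_def
      by (rule higher_deriv_compose_linear'[OF holomorphic_on_Polygamma[OF TZ] Sopen Topen zS])
         (use sT in \<open>simp add: s'_def\<close>)
    also have "(deriv ^^ Suc n) Digamma (s' 0) = Polygamma (Suc n) (s' 0)"
      using higher_deriv_Polygamma[OF nonpos, of "s' 0" "Suc n" 0] sT(2)[OF zS] by (simp add: T_def del: funpow.simps)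
    finally show ?thesis .
  qed
  finally have d: "(deriv ^^ Suc n) (\<lambda>z. of_real (l * (1 - l)) * f z) 0 =
      \<i> / (2 * of_real pi) * ((- \<i> / (2 * of_real pi)) ^ Suc n * Polygamma (Suc n) (s' 0) - (\<i> / (2 * of_real pi)) ^ Suc n * Polygamma (Suc n) (s 0))" .
  have "(\<lambda>z. of_real (l * (1 - l)) * f z) has_fps_expansion (fps_const (of_real (l * (1 - l))) * resolvent_fps (of_real l))"
    by (intro fps_expansion_intros fexp)
  then have "fps_nth (fps_const (of_real (l * (1 - l))) * resolvent_fps (of_real l)) (Suc n) 
      = (deriv ^^ Suc n) (\<lambda>z. of_real (l * (1 - l)) * f z) 0 / fact (Suc n)"
    by (rule fps_nth_fps_expansion)
  then have "of_real (l * (1 - l) * res_coeff l (Suc n)) = (deriv ^^ Suc n) (\<lambda>z. of_real (l * (1 - l)) * f z) 0 / fact (Suc n)"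
    by (simp add: res_coeff_def[symmetric] res_coeff_of_real del: funpow.simps fact_Suc)
  then have "norm (of_real (l * (1 - l) * res_coeff l (Suc n)) :: complex) = norm ((deriv ^^ Suc n) (\<lambda>z. of_real (l * (1 - l)) * f z) 0) / fact (Suc n)"
    by (simp only: norm_divide norm_fact)
  then have "l * (1 - l) * \<bar>res_coeff l (Suc n)\<bar> = norm ((deriv ^^ Suc n) (\<lambda>z. of_real (l * (1 - l)) * f z) 0) / fact (Suc n)"
    using l by (simp only: norm_of_real abs_mult)
  also have "norm ((deriv ^^ Suc n) (\<lambda>z. of_real (l * (1 - l)) * f z) 0) \<le> 
     (1 / (2 * pi)) * ((1 / (2 * pi)) ^ Suc n * (5 * fact (Suc n) * 2 ^ n) + (1 / (2 * pi)) ^ Suc n * (5 * fact (Suc n) * 2 ^ n))"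
  proof -
    have r: "Re (s 0) = 1/2" "Re (s' 0) = 1/2"
      by (simp_all add: s1 Re_s)
    have n1: "norm (\<i> / (2 * of_real pi)) = 1 / (2 * pi)" "norm (- \<i> / (2 * of_real pi)) = 1 / (2 * pi)"
      by (simp_all add: norm_divide norm_mult)
    show ?thesis
      unfolding d norm_mult[of "\<i> / (2 * of_real pi)"] n1
      by (intro mult_left_mono order_trans[OF norm_triangle_ineq4] add_mono)
         (auto simp only: norm_mult norm_power n1 intro!: mult_left_mono norm_Polygamma_Suc_half_le r, auto)
  qed
  finally have "l * (1 - l) * \<bar>res_coeff l (Suc n)\<bar> \<le> (1 / (2 * pi)) * ((1 / (2 * pi)) ^ Suc n * (5 * fact (Suc n) * 2 ^ n) + (1 / (2 * pi)) ^ Suc n * (5 * fact (Suc n) * 2 ^ n)) / fact (Suc n)"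
    by (simp add: divide_right_mono del: fact_Suc)
  also have "\<dots> = (1 / (2 * pi)) * (2 * ((1 / (2 * pi)) ^ Suc n * (5 * 2 ^ n)))"
    by (simp add: field_simps del: fact_Suc power_Suc)
  also have "\<dots> = 5 / (2 * pi\<^sup>2) * (1 / pi) ^ n"
    by (simp add: field_simps power2_eq_square)
  also have "\<dots> \<le> 13/50 * (50/157) ^ n"
  proof (intro mult_mono power_mono)
    have "157/50 \<le> pi"
      using pi_approx by simp
    then have "(157/50)\<^sup>2 \<le> pi\<^sup>2"
      by (intro power_mono) auto
    then show "5 / (2 * pi\<^sup>2) \<le> 13/50"
      by (simp add: field_simps power2_eq_square)
    show "1 / pi \<le> 50/157"
      using \<open>157/50 \<le> pi\<close> by (simp add: field_simps)
  qed auto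
  finally show ?thesis .
qed auto

section \<open>Majorants for extreme parameters\<close>

definition res_maj :: "real \<Rightarrow> real \<Rightarrow> real" where
  "res_maj l x = (\<Sum>n. \<bar>res_coeff l n\<bar> * x ^ n)"

text \<open>
  The decay estimate degenerates for \<open>l\<close> near 0. There a comparison of differential equations is used
  instead: the absolute values obey the recurrence with all signs made positive, so that the partial
  sums \<open>p\<close> satisfy \<open>p' \<le> (1 + l p) (1 + (1 + l) p)\<close>. The right-hand side of the claim is the solution of
  the corresponding equation.
\<close>

lemma res_coeff_partial_sum_small:
  fixes l x :: real
  assumes l: "0 \<le> l" "l \<le> 1/2" and x: "0 \<le> x" and small: "l * (exp x - 1) < 1"
  shows "(\<Sum>n\<le>N. \<bar>res_coeff l n\<bar> * x ^ n) \<le> (exp x - 1) / (1 - l * (exp x - 1))"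
proof -
  define g where "g n = \<bar>res_coeff l n\<bar>" for n
  define p where "p y = (\<Sum>n\<le>N. g n * y ^ n)" for y :: real
  define p' where "p' y = (\<Sum>n<N. real (Suc n) * g (Suc n) * y ^ n)" for y :: real
  have g0: "g 0 = 0" and g_nn: "g n \<ge> 0" for n
    by (simp_all add: g_def)
  have g_rec: "real (Suc n) * g (Suc n) \<le> (if n = 0 then 1 else 0) + (1 + 2 * l) * g n + l * (1 + l) * (\<Sum>i\<le>n. g i * g (n - i))" for n
  proof -
    have "real (Suc n) * g (Suc n) = \<bar>(if n = 0 then 1 else 0) - (1 - 2 * l) * res_coeff l n
       - l * (1 - l) * (\<Sum>i\<le>n. res_coeff l i * res_coeff l (n - i))\<bar>"
      unfolding res_coeff_Suc[symmetric] by (simp add: g_def abs_mult del: of_nat_Suc)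
    also have "\<dots> \<le> \<bar>if n = 0 then 1 else 0\<bar> + \<bar>(1 - 2 * l) * res_coeff l n\<bar>
       + \<bar>l * (1 - l) * (\<Sum>i\<le>n. res_coeff l i * res_coeff l (n - i))\<bar>"
      by linarith
    also have "\<dots> \<le> (if n = 0 then 1 else 0) + (1 + 2 * l) * g n + l * (1 + l) * (\<Sum>i\<le>n. g i * g (n - i))"
    proof (intro add_mono)
      show "\<bar>(1 - 2 * l) * res_coeff l n\<bar> \<le> (1 + 2 * l) * g n"
        using l by (auto simp: abs_mult g_def intro!: mult_right_mono)
      have "\<bar>\<Sum>i\<le>n. res_coeff l i * res_coeff l (n - i)\<bar> \<le> (\<Sum>i\<le>n. g i * g (n - i))"
        by (rule order_trans[OF sum_abs]) (simp add: abs_mult g_def)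
      then show "\<bar>l * (1 - l) * (\<Sum>i\<le>n. res_coeff l i * res_coeff l (n - i))\<bar> \<le> l * (1 + l) * (\<Sum>i\<le>n. g i * g (n - i))"
        using l by (auto simp: abs_mult intro!: mult_mono sum_nonneg g_nn)
    qed simp
    finally show ?thesis .
  qed
  have p_deriv: "(p has_real_derivative p' y) (at y)" for y
  proof -
    have "(p has_real_derivative (\<Sum>n\<le>N. g n * (real n * y ^ (n - 1)))) (at y)"
      unfolding p_def by (auto intro!: derivative_eq_intros sum.cong)
    also have "(\<Sum>n\<le>N. g n * (real n * y ^ (n - 1))) = p' y"
    proof (cases N)
      case (Suc M)
      show ?thesis
        unfolding Suc p'_def lessThan_Suc_atMost sum.atMost_Suc_shift by (simp add: mult_ac)
    qed (simp add: p'_def)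
    finally show ?thesis .
  qed
  have p_nn: "p y \<ge> 0" if "y \<ge> 0" for y
    using that by (auto simp: p_def intro!: sum_nonneg mult_nonneg_nonneg g_nn)
  have p'_le: "p' y \<le> (1 + l * p y) * (1 + (1 + l) * p y)" if "y \<ge> 0" for y
  proof -
    have "p' y \<le> (\<Sum>n<N. ((if n = 0 then 1 else 0) + (1 + 2 * l) * g n + l * (1 + l) * (\<Sum>i\<le>n. g i * g (n - i))) * y ^ n)"
      unfolding p'_def using that by (intro sum_mono mult_right_mono g_rec) auto
    also have "\<dots> = (\<Sum>n<N. (if n = 0 then 1 else 0) * y ^ n) + (1 + 2 * l) * (\<Sum>n<N. g n * y ^ n)
        + l * (1 + l) * (\<Sum>n<N. \<Sum>i\<le>n. (g i * y ^ i) * (g (n - i) * y ^ (n - i)))"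
    proof -
      have t: "((if n = 0 then 1 else 0) + (1 + 2 * l) * g n + l * (1 + l) * (\<Sum>i\<le>n. g i * g (n - i))) * y ^ n =
         (if n = 0 then 1 else 0) * y ^ n + (1 + 2 * l) * (g n * y ^ n) + l * (1 + l) * (\<Sum>i\<le>n. (g i * y ^ i) * (g (n - i) * y ^ (n - i)))" for n
      proof -
        have e: "(\<Sum>i\<le>n. g i * g (n - i)) * y ^ n = (\<Sum>i\<le>n. (g i * y ^ i) * (g (n - i) * y ^ (n - i)))"
          unfolding sum_distrib_right
        proof (rule sum.cong[OF refl])
          fix i assume "i \<in> {..n}"
          then have "y ^ n = y ^ i * y ^ (n - i)"
            by (simp add: power_add[symmetric])
          then show "g i * g (n - i) * y ^ n = (g i * y ^ i) * (g (n - i) * y ^ (n - i))"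
            by simp
        qed
        show ?thesis
          unfolding e[symmetric] by (simp add: algebra_simps)
      qed
      show ?thesis
        by (simp only: t) (simp only: sum.distrib sum_distrib_left)
    qed
    also have "\<dots> \<le> 1 + (1 + 2 * l) * p y + l * (1 + l) * (p y * p y)"
    proof (intro add_mono mult_left_mono)
      have "(\<Sum>n<N. (if n = 0 then 1 else 0) * y ^ n) = (\<Sum>n<N. if n = 0 then 1 else 0)"
        by (intro sum.cong) auto
      also have "\<dots> \<le> (1::real)"
        by simp
      finally show "(\<Sum>n<N. (if n = 0 then 1 else 0) * y ^ n) \<le> 1" .
      show "(\<Sum>n<N. g n * y ^ n) \<le> p y"
        unfolding p_def using that g_nn by (intro sum_mono2) auto
      have "(\<Sum>n<N. \<Sum>i\<le>n. (g i * y ^ i) * (g (n - i) * y ^ (n - i))) 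
          = (\<Sum>(i,j)\<in>{(i,j). i + j < N}. (g i * y ^ i) * (g j * y ^ j))"
        by (rule sum.triangle_reindex[symmetric])
      also have "\<dots> \<le> (\<Sum>(i,j)\<in>{..N} \<times> {..N}. (g i * y ^ i) * (g j * y ^ j))"
        using that g_nn by (intro sum_mono2) (auto intro!: mult_nonneg_nonneg)
      also have "\<dots> = p y * p y"
        by (simp add: p_def sum_product sum.cartesian_product)
      finally show "(\<Sum>n<N. \<Sum>i\<le>n. (g i * y ^ i) * (g (n - i) * y ^ (n - i))) \<le> p y * p y" .
    qed (use l in auto)
    also have "\<dots> = (1 + l * p y) * (1 + (1 + l) * p y)"
      by (simp add: algebra_simps)
    finally show ?thesis .
  qed
  define z where "z y = ln (1 + (1 + l) * p y) - ln (1 + l * p y) - y" for y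
  have pos: "1 + l * p y > 0" "1 + (1 + l) * p y > 0" if "y \<ge> 0" for y
    using p_nn[OF that] l by (auto intro!: add_pos_nonneg mult_nonneg_nonneg)
  have "z x \<le> z 0"
  proof (rule DERIV_nonpos_imp_nonincreasing[OF x])
    fix y assume "0 \<le> y" "y \<le> x"
    note pp = pos[OF \<open>0 \<le> y\<close>]
    have "(z has_real_derivative (1 + l) * p' y / (1 + (1 + l) * p y) - l * p' y / (1 + l * p y) - 1) (at y)"
      unfolding z_def using pp by (auto intro!: derivative_eq_intros p_deriv simp: divide_inverse mult_ac)
    moreover have "(1 + l) * p' y / (1 + (1 + l) * p y) - l * p' y / (1 + l * p y) - 1 = p' y / ((1 + l * p y) * (1 + (1 + l) * p y)) - 1"
    proof -
      have "(1 + l) * p' y / (1 + (1 + l) * p y) - l * p' y / (1 + l * p y) = ((1 + l) * p' y * (1 + l * p y) - l * p' y * (1 + (1 + l) * p y)) / ((1 + (1 + l) * p y) * (1 + l * p y))"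
        using pp by (simp add: diff_frac_eq)
      also have "(1 + l) * p' y * (1 + l * p y) - l * p' y * (1 + (1 + l) * p y) = p' y"
        by (simp add: algebra_simps)
      finally show ?thesis by (simp add: mult.commute)
    qed
    moreover have "p' y / ((1 + l * p y) * (1 + (1 + l) * p y)) \<le> 1"
      using p'_le[OF \<open>0 \<le> y\<close>] pp by (simp add: divide_le_eq)
    ultimately show "\<exists>d. (z has_real_derivative d) (at y) \<and> d \<le> 0"
      by (intro exI[of _ "p' y / ((1 + l * p y) * (1 + (1 + l) * p y)) - 1"]) simp
  qed
  moreover have "z 0 = 0"
    by (simp add: z_def p_def g0 power_0_left if_distrib cong: if_cong)
  ultimately have "ln (1 + (1 + l) * p x) \<le> x + ln (1 + l * p x)"
    by (simp add: z_def)
  then have "exp (ln (1 + (1 + l) * p x)) \<le> exp (x + ln (1 + l * p x))"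
    by simp
  then have "1 + (1 + l) * p x \<le> exp x * (1 + l * p x)"
    using pos[OF x] by (simp add: exp_add)
  then have "p x * (1 - l * (exp x - 1)) \<le> exp x - 1"
    by (simp add: algebra_simps)
  then have "p x \<le> (exp x - 1) / (1 - l * (exp x - 1))"
    using small by (simp add: pos_le_divide_eq)
  then show ?thesis
    by (simp add: p_def g_def)
qed

section \<open>The resolvent in two noncommuting variables\<close>

lemma ncps_const_mult_nth [simp]: "ncps_nth (ncps_const c * F) w = c * ncps_nth F w"
proof -
  have "ncps_nth (ncps_const c * F) w = (\<Sum>k = 0..length w. if k = 0 then c * ncps_nth F w else 0)"
    unfolding times_ncps.rep_eq ncps_const.rep_eq by (intro sum.cong) auto
  then show ?thesis
    by simp
qed

lemma mult_ncps_const_nth [simp]: "ncps_nth (F * ncps_const c) w = ncps_nth F w * c"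
proof -
  have "ncps_nth (F * ncps_const c) w = (\<Sum>k = 0..length w. if k = length w then ncps_nth F w * c else 0)"
    unfolding times_ncps.rep_eq ncps_const.rep_eq by (intro sum.cong) auto
  then show ?thesis
    by simp
qed

lemma ncps_const_commute: "F * ncps_const c = ncps_const c * (F :: ('x, 'c::comm_ring_1) ncps)"
  by (rule ncps_eqI) (simp add: mult.commute)

lemma ncps_nth_simps [simp]:
  "ncps_nth (F + G) w = ncps_nth F w + ncps_nth G w"
  "ncps_nth (F - G) w = ncps_nth F w - ncps_nth G w"
  "ncps_nth (- F) w = - ncps_nth F w"
  "ncps_nth 0 w = 0"
  by (simp_all add: plus_ncps.rep_eq minus_ncps.rep_eq uminus_ncps.rep_eq zero_ncps.rep_eq)

lemma ncps_const_diff_1: "ncps_const (1 - c) = 1 - ncps_const (c :: 'c::ring_1)"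
  by (rule ncps_eqI) (simp add: ncps_const.rep_eq one_ncps.rep_eq)

text \<open>
  Substitution of a single letter into a power series in one variable. It is a ring homomorphism, so
  identities between commutative series carry over.
\<close>

definition ncps_subst :: "'x \<Rightarrow> 'c::zero fps \<Rightarrow> ('x, 'c) ncps" where
  "ncps_subst x f = Abs_ncps (\<lambda>w. if w = replicate (length w) x then fps_nth f (length w) else 0)"

lemma ncps_nth_subst: "ncps_nth (ncps_subst x f) w = (if w = replicate (length w) x then fps_nth f (length w) else 0)"
  by (simp add: ncps_subst_def Abs_ncps_inverse)

lemma ncps_subst_mult: "ncps_subst x (f * g) = ncps_subst x f * ncps_subst x (g :: 'c::ring_1 fps)"
proof (rule ncps_eqI)
  fix w :: "'a list"
  show "ncps_nth (ncps_subst x (f * g)) w = ncps_nth (ncps_subst x f * ncps_subst x g) w"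
  proof (cases "w = replicate (length w) x")
    case True
    have *: "ncps_nth (ncps_subst x f) (take k w) * ncps_nth (ncps_subst x g) (drop k w) = fps_nth f k * fps_nth g (length w - k)"
      if "k \<le> length w" for k
    proof -
      have "take k w = replicate k x" "drop k w = replicate (length w - k) x"
        using that by (subst True, simp add: min_def)+
      then show ?thesis
        by (simp add: ncps_nth_subst)
    qed
    show ?thesis
      using True by (simp add: times_ncps.rep_eq ncps_nth_subst[of x "f * g"] fps_mult_nth *)
  next
    case False
    have "ncps_nth (ncps_subst x f) (take k w) * ncps_nth (ncps_subst x g) (drop k w) = 0" if "k \<le> length w" for k
    proof (rule ccontr)
      assume "\<not> ?thesis"
      then have "take k w = replicate (length (take k w)) x" "drop k w = replicate (length (drop k w)) x"
        by (auto simp: ncps_nth_subst split: if_splits)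
      then have "take k w @ drop k w = replicate (length (take k w) + length (drop k w)) x"
        unfolding replicate_add by argo
      with that False show False
        by simp
    qed
    with False show ?thesis
      by (simp add: times_ncps.rep_eq ncps_nth_subst[of x "f * g"])
  qed
qed

lemma ncps_subst_1: "ncps_subst x 1 = (1 :: ('x, 'c::ring_1) ncps)"
  by (rule ncps_eqI) (auto simp: ncps_nth_subst one_ncps.rep_eq)

lemma ncps_subst_add: "ncps_subst x (f + g) = ncps_subst x f + ncps_subst x (g :: 'c::ring_1 fps)"
  by (rule ncps_eqI) (auto simp: ncps_nth_subst)

lemma ncps_subst_diff: "ncps_subst x (f - g) = ncps_subst x f - ncps_subst x (g :: 'c::ring_1 fps)"
  by (rule ncps_eqI) (auto simp: ncps_nth_subst)

lemma ncps_subst_const: "ncps_subst x (fps_const c) = ncps_const (c :: 'c::ring_1)"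
  by (rule ncps_eqI) (auto simp: ncps_nth_subst ncps_const.rep_eq)

lemma ncps_subst_power: "ncps_subst x (f ^ k) = ncps_subst x (f :: 'c::ring_1 fps) ^ k"
  by (induction k) (simp_all add: ncps_subst_1 ncps_subst_mult)

lemma ncps_subst_X: "ncps_subst x fps_X = ncps_var x"
proof (rule ncps_eqI)
  fix w
  show "ncps_nth (ncps_subst x fps_X) w = ncps_nth (ncps_var x) w"
    by (cases w) (auto simp: ncps_nth_subst ncps_var.rep_eq)
qed

lemma ncps_exp_var: "ncps_exp (ncps_var x) = ncps_subst x (fps_exp 1)"
proof (rule ncps_eqI)
  fix w
  have "ncps_nth (ncps_exp (ncps_var x)) w 
      = (\<Sum>k = 0..length w. fps_nth (fps_exp 1) k * ncps_nth (ncps_subst x (fps_X ^ k)) w)"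
    by (simp add: ncps_exp_def ncps_nth_compose ncps_subst_X ncps_subst_power)
  also have "\<dots> = (\<Sum>k = 0..length w. if k = length w then ncps_nth (ncps_subst x (fps_exp 1)) w else 0)"
    by (intro sum.cong) (auto simp: ncps_nth_subst)
  finally show "ncps_nth (ncps_exp (ncps_var x)) w = ncps_nth (ncps_subst x (fps_exp 1)) w"
    by simp
qed

definition res_series :: "real \<Rightarrow> (letter, real) ncps" where
  "res_series l = (BCH_A - 1) * ncps_inverse (ncps_const l + ncps_const (1 - l) * BCH_A)"

abbreviation "resX l \<equiv> ncps_subst LX (resolvent_fps l) :: (letter, real) ncps"
abbreviation "resY l \<equiv> ncps_subst LY (resolvent_fps l) :: (letter, real) ncps"

text \<open>
  The part of the resolvent consisting of the words that begin with \<open>LX\<close>, in closed form; the next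
  definition gives the part with the words that begin with \<open>LY\<close>. Unfolding the inverse as a
  geometric series produces the alternating products of the resolvents in the single variables.
\<close>

definition res_series_X :: "real \<Rightarrow> (letter, real) ncps" where
  "res_series_X l = ncps_inverse (1 + ncps_const l * ncps_const (1 - l) * resX l * resY l) *
     (resX l + ncps_const l * resX l * resY l)"

definition res_series_Y :: "real \<Rightarrow> (letter, real) ncps" where
  "res_series_Y l = resY l - ncps_const (1 - l) * resY l * res_series_X l"

lemma ncps_subst_nth_Nil [simp]: "ncps_nth (ncps_subst x f) [] = fps_nth f 0"
  by (simp add: ncps_nth_subst)

lemma ncps_nth_mult_Nil [simp]: "ncps_nth (F * G) [] = ncps_nth F [] * ncps_nth G []"
  by (simp add: times_ncps.rep_eq)

lemma ncps_nth_1_Nil [simp]: "ncps_nth 1 [] = 1"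
  by (simp add: one_ncps.rep_eq)

lemma ncps_const_nth_Nil [simp]: "ncps_nth (ncps_const c) [] = c"
  by (simp add: ncps_const.rep_eq)

lemma res_series_X_eq: "res_series_X l = resX l + ncps_const l * resX l * res_series_Y l"
proof -
  define P Q L M where "P = resX l" and "Q = resY l" and "L = (ncps_const l :: (letter, real) ncps)" 
    and "M = (ncps_const (1 - l) :: (letter, real) ncps)"
  define D where "D = 1 + L * M * P * Q"
  have comm: "F * M = M * F" for F
    by (simp add: M_def ncps_const_commute)
  have "D * ncps_inverse D = 1"
    by (rule ncps_inverse) (simp add: D_def P_def)
  then have "D * res_series_X l = P + L * P * Q"
    unfolding res_series_X_def D_def P_def Q_def L_def M_def by (simp add: mult.assoc[symmetric])
  then have "res_series_X l = P + L * P * Q - L * M * P * Q * res_series_X l"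
    by (simp add: D_def algebra_simps)
  moreover have "L * M * P * Q = L * P * M * Q"
    using comm[of P] by (simp add: mult.assoc)
  moreover have "L * P * res_series_Y l = L * P * Q - L * P * M * Q * res_series_X l"
    by (simp add: res_series_Y_def Q_def M_def right_diff_distrib mult.assoc)
  ultimately show ?thesis
    by (simp add: P_def L_def add_diff_eq)
qed

lemma ncps_exp_cayley:
  "ncps_exp (ncps_var x) * (1 - ncps_const (1 - l) * ncps_subst x (resolvent_fps l))
     = 1 + ncps_const l * ncps_subst x (resolvent_fps l)"
  using arg_cong[OF resolvent_fps_cayley[of l], of "ncps_subst x"]
  by (simp add: ncps_exp_var ncps_subst_mult ncps_subst_diff ncps_subst_add ncps_subst_1 ncps_subst_const)

text \<open>
  The identity in two variables follows from the two identities in one variable, since the Moebius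
  transforms compose like the exponentials multiply.
\<close>

lemma res_series_cayley:
  "BCH_A * (1 - ncps_const (1 - l) * (res_series_X l + res_series_Y l))
     = 1 + ncps_const l * (res_series_X l + res_series_Y l)"
proof -
  define P Q L M where "P = resX l" and "Q = resY l" and "L = (ncps_const l :: (letter, real) ncps)" 
    and "M = (ncps_const (1 - l) :: (letter, real) ncps)"
  define S T where "S = res_series_X l" and "T = res_series_Y l"
  define eX eY where "eX = (ncps_exp (ncps_var LX) :: (letter, real) ncps)" and "eY = (ncps_exp (ncps_var LY) :: (letter, real) ncps)"
  have LP: "P * L = L * P" and MQ: "Q * M = M * Q"
    unfolding L_def M_def by (rule ncps_const_commute)+
  have S: "S = P + L * (P * T)"
    unfolding S_def T_def P_def L_def by (rule trans[OF res_series_X_eq]) (simp only: mult.assoc)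
  have T: "T = Q - M * (Q * S)"
    unfolding S_def T_def Q_def M_def by (rule trans[OF res_series_Y_def]) (simp only: mult.assoc)
  have eX: "eX * (1 - M * P) = 1 + L * P" and eY: "eY * (1 - M * Q) = 1 + L * Q"
    by (simp_all add: eX_def eY_def P_def Q_def M_def L_def ncps_exp_cayley)
  have "1 - M * (S + T) = (1 - M * Q) * (1 - M * S)"
  proof -
    have "(1 - M * Q) * (1 - M * S) = 1 - M * S - M * Q + M * (Q * M) * S"
      by (simp add: algebra_simps)
    also have "\<dots> = 1 - M * S - M * (Q - M * (Q * S))"
      unfolding MQ by (simp add: algebra_simps)
    finally show ?thesis
      unfolding T[symmetric] by (simp add: algebra_simps)
  qed
  then have "BCH_A * (1 - M * (S + T)) = eX * (eY * (1 - M * Q)) * (1 - M * S)"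
    by (simp add: BCH_A_def eX_def eY_def mult.assoc)
  also have "\<dots> = eX * ((1 + L * Q) * (1 - M * S))"
    by (simp only: eY mult.assoc)
  also have "(1 + L * Q) * (1 - M * S) = 1 - M * S + L * (Q - (Q * M) * S)"
    by (simp add: algebra_simps)
  also have "\<dots> = 1 - M * S + L * T"
    unfolding MQ by (subst T) (simp add: mult.assoc)
  also have "\<dots> = (1 - M * P) * (1 + L * T)"
  proof -
    have "(1 - M * P) * (1 + L * T) = 1 + L * T - M * (P + (P * L) * T)"
      by (simp add: algebra_simps)
    also have "\<dots> = 1 + L * T - M * S"
      unfolding LP by (subst S) (simp add: mult.assoc)
    finally show ?thesis
      by simp
  qed
  also have "eX * ((1 - M * P) * (1 + L * T)) = (1 + L * P) * (1 + L * T)"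
    by (simp only: eX mult.assoc[symmetric])
  also have "\<dots> = 1 + L * T + L * (P + (P * L) * T)"
    by (simp add: algebra_simps)
  also have "\<dots> = 1 + L * (S + T)"
    unfolding LP by (subst S) (simp add: algebra_simps)
  finally show ?thesis
    by (simp add: S_def T_def M_def L_def)
qed

lemma res_series_eq: "res_series l = res_series_X l + res_series_Y l"
proof -
  define L M D R where "L = (ncps_const l :: (letter, real) ncps)"
    and "M = (ncps_const (1 - l) :: (letter, real) ncps)" and "D = L + M * BCH_A" and "R = res_series_X l + res_series_Y l"
  have "BCH_A * (1 - M * R) = 1 + L * R"
    by (simp add: res_series_cayley M_def R_def L_def)
  then have "BCH_A - (BCH_A * M) * R = 1 + L * R"
    by (simp add: right_diff_distrib mult.assoc)
  then have DR: "D * R = BCH_A - 1"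
    by (simp add: D_def M_def ncps_const_commute algebra_simps)
  have inv: "D * ncps_inverse D = 1" "ncps_inverse D * D = 1"
    by (rule ncps_inverse, simp add: D_def L_def M_def)+
  have "BCH_A * L = L * BCH_A" "BCH_A * M = M * BCH_A"
    by (simp_all add: L_def M_def ncps_const_commute)
  then have comm: "D * (BCH_A - 1) = (BCH_A - 1) * D"
    by (simp add: D_def algebra_simps) (simp add: mult.assoc[symmetric])
  have "R = ncps_inverse D * (D * R)"
    by (simp add: mult.assoc[symmetric] inv)
  also have "\<dots> = ncps_inverse D * (BCH_A - 1) * (D * ncps_inverse D)"
    by (simp add: DR inv)
  also have "\<dots> = ncps_inverse D * (D * (BCH_A - 1)) * ncps_inverse D"
    by (simp add: comm mult.assoc)
  also have "\<dots> = (BCH_A - 1) * ncps_inverse D"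
    by (simp add: mult.assoc[symmetric] inv)
  finally show ?thesis
    by (simp add: res_series_def R_def D_def L_def M_def)
qed

text \<open>
  Iterating this equation gives the coefficients of the resolvent as polynomials in \<open>l\<close>, which can be
  integrated term by term.
\<close>

lemma res_series_fixpoint:
  "res_series l = (BCH_A - 1) - ncps_const (1 - l) * ((BCH_A - 1) * res_series l)"
proof -
  define L M R where "L = (ncps_const l :: (letter, real) ncps)"
    and "M = (ncps_const (1 - l) :: (letter, real) ncps)" and "R = res_series l"
  have M_eq: "M = 1 - L"
    by (simp add: L_def M_def ncps_const_diff_1)
  have "BCH_A * (1 - M * R) = 1 + L * R"
    using res_series_cayley[of l] by (simp add: M_def R_def L_def res_series_eq)
  then have "BCH_A - (BCH_A * M) * R = 1 + L * R"
    by (simp add: right_diff_distrib mult.assoc)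
  then have "BCH_A - (M * BCH_A) * R = 1 + L * R"
    by (simp add: M_def ncps_const_commute)
  then have "R = (BCH_A - 1) - M * ((BCH_A - 1) * R)"
    unfolding M_eq by (simp add: algebra_simps)
  then show ?thesis
    by (simp add: M_def R_def)
qed

lemma ncps_nth_power_mult_eq_0:
  assumes "ncps_nth B [] = 0" "ncps_nth R [] = 0" "length w \<le> n"
  shows "ncps_nth (B ^ n * R) w = 0"
proof -
  have "ncps_nth (B ^ n) (take i w) * ncps_nth R (drop i w) = 0" if "i \<le> length w" for i
    using ncps_nth_power_eq_0[OF assms(1), of "take i w" n] assms that by (cases "i = length w") auto
  then show ?thesis
    by (simp add: times_ncps.rep_eq)
qed

lemma res_series_nth:
  "ncps_nth (res_series l) w = (\<Sum>k<length w. (- (1 - l)) ^ k * ncps_nth ((BCH_A - 1) ^ Suc k) w)"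
proof -
  define B M R where "B = (BCH_A - 1 :: (letter, real) ncps)"
    and "M = (ncps_const (l - 1) :: (letter, real) ncps)" and "R = res_series l"
  have neg_M: "- ncps_const (1 - l) = M"
    unfolding M_def by (rule ncps_eqI) (simp add: ncps_const.rep_eq)
  have "R = B - ncps_const (1 - l) * (B * R)"
    unfolding R_def B_def by (rule res_series_fixpoint)
  also have "\<dots> = B + M * (B * R)"
    unfolding neg_M[symmetric] by simp
  finally have R: "R = B + M * (B * R)" .
  have MB: "F * M = M * F" for F
    by (simp add: M_def ncps_const_commute)
  have iter: "R = (\<Sum>k<n. M ^ k * B ^ Suc k) + M ^ n * (B ^ n * R)" for n
  proof (induction n)
    case (Suc n)
    have "B ^ n * M = M * B ^ n"
      by (rule MB)
    have "M ^ n * (B ^ n * R) = M ^ n * (B ^ n * (B + M * (B * R)))"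
      using R by simp
    also have "\<dots> = M ^ n * B ^ Suc n + M ^ n * (B ^ n * M) * (B * R)"
      by (simp add: algebra_simps power_commutes)
    also have "M ^ n * (B ^ n * M) * (B * R) = M ^ Suc n * (B ^ Suc n * R)"
      unfolding MB by (simp add: mult.assoc power_commutes) (simp add: mult.assoc[symmetric] power_commutes)
    finally show ?case
      using Suc by (simp add: add.assoc)
  qed simp
  have Mk: "ncps_nth (M ^ k * F) w = (l - 1) ^ k * ncps_nth F w" for k F w
    by (induction k arbitrary: F) (simp_all add: M_def mult.assoc)
  have sum: "ncps_nth (sum f A) w = (\<Sum>k\<in>A. ncps_nth (f k) w)" for f :: "nat \<Rightarrow> (letter, real) ncps" and A w
    by (induction A rule: infinite_finite_induct) auto
  have "ncps_nth B [] = 0"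
    by (simp add: B_def)
  then have "ncps_nth R [] = 0"
    using R by (metis mult_zero_left mult_zero_right ncps_nth_mult_Nil ncps_nth_simps(1) add_0)
  then have "ncps_nth R w = (\<Sum>k<length w. (l - 1) ^ k * ncps_nth (B ^ Suc k) w)"
    using ncps_nth_power_mult_eq_0[OF \<open>ncps_nth B [] = 0\<close>, of R w "length w"]
    by (subst iter[of "length w"]) (simp add: Mk sum del: power_Suc)
  then show ?thesis
    by (simp add: R_def B_def)
qed

lemma continuous_on_res_series_nth: "continuous_on A (\<lambda>l. ncps_nth (res_series l) w)"
  unfolding res_series_nth by (intro continuous_intros)

text \<open>
  Termwise, the integral of \<open>(- (1 - l))\<^sup>k\<close> over \<open>[0, 1]\<close> is \<open>(-1)\<^sup>k / (k + 1)\<close>, the coefficient of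
  \<open>log (1 + t)\<close> at \<open>t\<^sup>k\<^sup>+\<^sup>1\<close>.
\<close>

lemma log_nth_has_integral:
  "((\<lambda>l. ncps_nth (res_series l) w) has_integral ncps_nth (ncps_log BCH_A) w) {0..1}"
proof -
  have int: "((\<lambda>l::real. (- (1 - l)) ^ k) has_integral (-1) ^ k / real (Suc k)) {0..1}" for k
  proof -
    have "((\<lambda>l::real. (- (1 - l)) ^ k) has_integral ((1 - 1) ^ Suc k / real (Suc k) - (0 - 1) ^ Suc k / real (Suc k))) {0..1}"
      by (rule fundamental_theorem_of_calculus)
         (auto intro!: derivative_eq_intros simp: has_real_derivative_iff_has_vector_derivative[symmetric] simp del: power_Suc of_nat_Suc)
    then show ?thesis
      by simp
  qed
  have "((\<lambda>l. ncps_nth (res_series l) w) has_integral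
     (\<Sum>k<length w. (-1) ^ k / real (Suc k) * ncps_nth ((BCH_A - 1) ^ Suc k) w)) {0..1}"
    unfolding res_series_nth by (intro has_integral_sum has_integral_mult_left int) auto
  also have "(\<Sum>k<length w. (-1) ^ k / real (Suc k) * ncps_nth ((BCH_A - 1) ^ Suc k) w) = ncps_nth (ncps_log BCH_A) w"
  proof -
    have "ncps_nth (ncps_log BCH_A) w = (\<Sum>k\<in>{0..length w}. fps_nth (fps_ln 1) k * ncps_nth ((BCH_A - 1) ^ k) w)"
      by (simp add: ncps_log_def ncps_nth_compose)
    also have "{0..length w} = insert 0 (Suc ` {..<length w})"
      by (simp add: atLeast0AtMost lessThan_Suc_atMost[symmetric] lessThan_Suc_eq_insert_0)
    also have "(\<Sum>k\<in>\<dots>. fps_nth (fps_ln 1) k * ncps_nth ((BCH_A - 1) ^ k) w) 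
        = (\<Sum>k<length w. fps_nth (fps_ln 1) (Suc k) * ncps_nth ((BCH_A - 1) ^ Suc k) w)"
      by (subst sum.insert) (auto simp: sum.reindex fps_ln_nth simp del: power_Suc)
    finally show ?thesis
      by (simp add: fps_ln_nth del: power_Suc of_nat_Suc)
  qed
  finally show ?thesis .
qed

section \<open>Upper bounds for the majorant series\<close>

definition word_weight :: "('x \<Rightarrow> real) \<Rightarrow> 'x list \<Rightarrow> real" where
  "word_weight v w = prod_list (map v w)"

lemma word_weight_append [simp]: "word_weight v (u @ w) = word_weight v u * word_weight v w"
  by (simp add: word_weight_def)

lemma word_weight_Nil [simp]: "word_weight v [] = 1"
  by (simp add: word_weight_def)

lemma word_weight_replicate [simp]: "word_weight v (replicate n x) = v x ^ n"
  by (induction n) (simp_all add: word_weight_def)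

lemma word_weight_nonneg: "(\<And>x. 0 \<le> v x) \<Longrightarrow> 0 \<le> word_weight v w"
  by (induction w) (simp_all add: word_weight_def)

text \<open>
  Weighted \<open>\<ell>\<^sup>1\<close> norms truncated by word length. The truncation keeps all quantities finite, so that
  an inequality such as \<open>s \<le> a + \<kappa> s\<close> may be solved for \<open>s\<close> before any convergence is known.
\<close>

definition trunc_norm :: "nat \<Rightarrow> ('x \<Rightarrow> real) \<Rightarrow> ('x, real) ncps \<Rightarrow> real" where
  "trunc_norm n v F = (\<Sum>w | length w \<le> n. \<bar>ncps_nth F w\<bar> * word_weight v w)"

lemma UNIV_letter: "(UNIV :: letter set) = {LX, LY}"
  using letter.exhaust by auto

instance letter :: finite
  by standard (simp add: UNIV_letter)

lemma finite_words: "finite {w :: 'x::finite list. length w \<le> n}"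
  using finite_lists_length_le[of "UNIV :: 'x set" n] by simp

lemma trunc_norm_add: "(\<And>x. 0 \<le> v x) \<Longrightarrow> trunc_norm n v (F + G) \<le> trunc_norm n v F + trunc_norm n v G"
  unfolding trunc_norm_def sum.distrib[symmetric]
  by (intro sum_mono) (auto simp: distrib_right[symmetric] intro!: mult_right_mono word_weight_nonneg)

lemma trunc_norm_diff: "(\<And>x. 0 \<le> v x) \<Longrightarrow> trunc_norm n v (F - G) \<le> trunc_norm n v F + trunc_norm n v G"
  unfolding trunc_norm_def sum.distrib[symmetric]
  by (intro sum_mono) (auto simp: distrib_right[symmetric] intro!: mult_right_mono word_weight_nonneg)

lemma trunc_norm_const_mult: "trunc_norm n v (ncps_const c * F) = \<bar>c\<bar> * trunc_norm n v F"
  by (simp add: trunc_norm_def abs_mult sum_distrib_left mult.assoc)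

lemma trunc_norm_nonneg: "(\<And>x. 0 \<le> v x) \<Longrightarrow> 0 \<le> trunc_norm n v F"
  unfolding trunc_norm_def by (intro sum_nonneg mult_nonneg_nonneg word_weight_nonneg) auto

text \<open>
  A word of length at most \<open>n\<close> splits into two words of length at most \<open>n\<close>; distinct products of
  prefix and suffix are counted separately on the right.
\<close>

lemma trunc_norm_mult:
  fixes F G :: "('x::finite, real) ncps"
  assumes v: "\<And>x. 0 \<le> v x"
  shows "trunc_norm n v (F * G) \<le> trunc_norm n v F * trunc_norm n v G"
proof -
  define W where "W = {w :: 'x list. length w \<le> n}"
  have fin: "finite W"
    unfolding W_def by (rule finite_words)
  define h where "h = (\<lambda>(p, q). (\<bar>ncps_nth F p\<bar> * word_weight v p) * (\<bar>ncps_nth G q\<bar> * word_weight v q))"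
  define \<phi> where "\<phi> = (\<lambda>(w :: 'x list, k). (take k w, drop k w))"
  have h_nn: "0 \<le> h z" for z
    by (auto simp: h_def split: prod.splits intro!: mult_nonneg_nonneg word_weight_nonneg v)
  have "trunc_norm n v (F * G) \<le> (\<Sum>w\<in>W. \<Sum>k\<in>{0..length w}. h (\<phi> (w, k)))"
    unfolding trunc_norm_def W_def[symmetric]
  proof (rule sum_mono)
    fix w assume "w \<in> W"
    have "\<bar>ncps_nth (F * G) w\<bar> * word_weight v w \<le> (\<Sum>k\<in>{0..length w}. \<bar>ncps_nth F (take k w) * ncps_nth G (drop k w)\<bar>) * word_weight v w"
      unfolding times_ncps.rep_eq by (intro mult_right_mono sum_abs word_weight_nonneg v)
    also have "\<dots> = (\<Sum>k\<in>{0..length w}. h (\<phi> (w, k)))"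
      unfolding sum_distrib_right
    proof (rule sum.cong[OF refl])
      fix k
      have "word_weight v w = word_weight v (take k w) * word_weight v (drop k w)"
        by (metis append_take_drop_id word_weight_append)
      then show "\<bar>ncps_nth F (take k w) * ncps_nth G (drop k w)\<bar> * word_weight v w = h (\<phi> (w, k))"
        by (simp add: h_def \<phi>_def abs_mult)
    qed
    finally show "\<bar>ncps_nth (F * G) w\<bar> * word_weight v w \<le> (\<Sum>k\<in>{0..length w}. h (\<phi> (w, k)))" .
  qed
  also have "\<dots> = (\<Sum>z\<in>Sigma W (\<lambda>w. {0..length w}). h (\<phi> z))"
    by (subst sum.Sigma) (use fin in \<open>auto intro!: sum.cong\<close>)
  also have "\<dots> = (\<Sum>z\<in>\<phi> ` Sigma W (\<lambda>w. {0..length w}). h z)"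
  proof (subst sum.reindex)
    show "inj_on \<phi> (Sigma W (\<lambda>w. {0..length w}))"
    proof (rule inj_onI)
      fix a b assume ab: "a \<in> Sigma W (\<lambda>w. {0..length w})" "b \<in> Sigma W (\<lambda>w. {0..length w})" "\<phi> a = \<phi> b"
      obtain w k where a: "a = (w, k)" by (cases a)
      obtain w' k' where b: "b = (w', k')" by (cases b)
      have eq: "take k w = take k' w'" "drop k w = drop k' w'" and le: "k \<le> length w" "k' \<le> length w'"
        using ab by (auto simp: \<phi>_def a b)
      from eq(1) have "min (length w) k = min (length w') k'"
        by (metis length_take)
      with le have "k = k'"
        by simp
      moreover have "w = w'"
        using eq by (metis append_take_drop_id)
      ultimately show "a = b"
        by (simp add: a b)
    qed
  qed (simp add: o_def)
  also have "\<dots> \<le> (\<Sum>z\<in>W \<times> W. h z)"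
    by (rule sum_mono2) (use fin h_nn in \<open>auto simp: \<phi>_def W_def\<close>)
  also have "\<dots> = trunc_norm n v F * trunc_norm n v G"
    unfolding trunc_norm_def W_def[symmetric] sum_product h_def by (simp add: sum.cartesian_product)
  finally show ?thesis .
qed

lemma trunc_norm_subst:
  fixes f :: "real fps"
  shows "trunc_norm n v (ncps_subst (x :: 'x::finite) f) = (\<Sum>k\<le>n. \<bar>fps_nth f k\<bar> * v x ^ k)"
proof -
  have "trunc_norm n v (ncps_subst x f) = (\<Sum>w\<in>(\<lambda>k. replicate k x) ` {..n}. \<bar>ncps_nth (ncps_subst x f) w\<bar> * word_weight v w)"
    unfolding trunc_norm_def
  proof (rule sum.mono_neutral_right)
    show "\<forall>w\<in>{w. length w \<le> n} - (\<lambda>k. replicate k x) ` {..n}. \<bar>ncps_nth (ncps_subst x f) w\<bar> * word_weight v w = 0"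
      by (auto simp: ncps_nth_subst image_iff)
  qed (use finite_words in auto)
  also have "\<dots> = (\<Sum>k\<le>n. \<bar>fps_nth f k\<bar> * v x ^ k)"
    by (subst sum.reindex) (auto simp: inj_on_def ncps_nth_subst dest: arg_cong[where f = length])
  finally show ?thesis .
qed

lemma ennreal_infsum_le:
  assumes "\<And>F. finite F \<Longrightarrow> sum f F \<le> (B :: ennreal)"
  shows "infsum f UNIV \<le> B"
  by (subst nonneg_infsum_complete) (auto intro!: SUP_least assms)

lemma ncps_eval_le:
  fixes F :: "('x::finite, real) ncps"
  assumes v: "\<And>x. 0 \<le> v x" and B: "\<And>n. trunc_norm n v F \<le> B"
  shows "ncps_eval (ncps_abs F) v \<le> ennreal B"
  unfolding ncps_eval_def
proof (rule ennreal_infsum_le)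
  fix W :: "'x list set" assume W: "finite W"
  define n where "n = Max (insert 0 (length ` W))"
  have sub: "W \<subseteq> {w. length w \<le> n}"
    using W by (auto simp: n_def)
  have "(\<Sum>w\<in>W. ennreal (ncps_nth (ncps_abs F) w * prod_list (map v w))) = (\<Sum>w\<in>W. ennreal (\<bar>ncps_nth F w\<bar> * word_weight v w))"
    by (simp add: ncps_abs.rep_eq word_weight_def)
  also have "\<dots> = ennreal (\<Sum>w\<in>W. \<bar>ncps_nth F w\<bar> * word_weight v w)"
    by (rule sum_ennreal) (simp add: word_weight_nonneg v)
  also have "\<dots> \<le> ennreal (trunc_norm n v F)"
    unfolding trunc_norm_def by (intro ennreal_leI sum_mono2 sub finite_words) (simp add: word_weight_nonneg v)
  also have "\<dots> \<le> ennreal B"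
    by (intro ennreal_leI B)
  finally show "(\<Sum>w\<in>W. ennreal (ncps_nth (ncps_abs F) w * prod_list (map v w))) \<le> ennreal B" .
qed

lemma sum_le_ncps_eval:
  fixes F :: "('x::finite, real) ncps"
  assumes v: "\<And>x. 0 \<le> v x" and W: "finite W"
  shows "ennreal (\<Sum>w\<in>W. \<bar>ncps_nth F w\<bar> * word_weight v w) \<le> ncps_eval (ncps_abs F) v"
proof -
  have "ennreal (\<Sum>w\<in>W. \<bar>ncps_nth F w\<bar> * word_weight v w) = (\<Sum>w\<in>W. ennreal (\<bar>ncps_nth F w\<bar> * word_weight v w))"
    by (rule sum_ennreal[symmetric]) (simp add: word_weight_nonneg v)
  also have "\<dots> = (\<Sum>w\<in>W. ennreal (ncps_nth (ncps_abs F) w * prod_list (map v w)))"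
    by (simp add: ncps_abs.rep_eq word_weight_def)
  also have "\<dots> \<le> ncps_eval (ncps_abs F) v"
    unfolding ncps_eval_def by (subst nonneg_infsum_complete) (auto intro!: SUP_upper W)
  finally show ?thesis .
qed

lemma letter_val_nonneg: "0 \<le> x \<Longrightarrow> 0 \<le> y \<Longrightarrow> 0 \<le> case_letter x y c"
  by (cases c) auto

text \<open>
  The two parts of the resolvent satisfy a linear system with coefficients \<open>l a\<close> and \<open>(1 - l) b\<close>; its
  determinant \<open>1 - l (1 - l) a b\<close> has to stay positive.
\<close>

lemma trunc_norm_res_series_le:
  fixes l x y a b \<kappa> :: real
  assumes l: "0 \<le> l" "l \<le> 1" and xy: "0 \<le> x" "0 \<le> y"
    and a: "\<And>N. (\<Sum>n\<le>N. \<bar>res_coeff l n\<bar> * x ^ n) \<le> a"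
    and b: "\<And>N. (\<Sum>n\<le>N. \<bar>res_coeff l n\<bar> * y ^ n) \<le> b"
    and \<kappa>: "l * (1 - l) * (a * b) \<le> \<kappa>" "\<kappa> < 1"
  shows "trunc_norm n (case_letter x y) (res_series l) \<le> (1 + b) * ((a + a * b) / (1 - \<kappa>)) + b"
proof -
  define v where "v = case_letter x y"
  have v: "0 \<le> v c" for c
    using xy by (simp add: v_def letter_val_nonneg)
  define p q s t where "p = trunc_norm n v (resX l)" and "q = trunc_norm n v (resY l)"
    and "s = trunc_norm n v (res_series_X l)" and "t = trunc_norm n v (res_series_Y l)"
  have p: "p \<le> a" and q: "q \<le> b"
    using a[of n] b[of n] by (simp_all add: p_def q_def trunc_norm_subst v_def res_coeff_def)
  have nn: "0 \<le> p" "0 \<le> q" "0 \<le> s" "0 \<le> t"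
    by (simp_all add: p_def q_def s_def t_def trunc_norm_nonneg v)
  then have ab: "0 \<le> a" "0 \<le> b"
    using p q by linarith+
  have "s \<le> p + trunc_norm n v (ncps_const l * (resX l * res_series_Y l))"
    unfolding s_def p_def by (subst res_series_X_eq) (simp add: mult.assoc trunc_norm_add v)
  also have "\<dots> \<le> p + l * (p * t)"
    using l by (auto simp: trunc_norm_const_mult p_def t_def intro!: mult_left_mono trunc_norm_mult v)
  finally have s1: "s \<le> p + l * (p * t)" .
  have "t \<le> q + trunc_norm n v (ncps_const (1 - l) * (resY l * res_series_X l))"
    unfolding t_def q_def by (subst res_series_Y_def) (simp add: mult.assoc trunc_norm_diff v)
  also have "\<dots> \<le> q + (1 - l) * (q * s)"
    using l by (auto simp: trunc_norm_const_mult q_def s_def intro!: mult_left_mono trunc_norm_mult v)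
  finally have t1: "t \<le> q + (1 - l) * (q * s)" .
  have "s \<le> a + l * (a * (b + (1 - l) * (b * s)))"
  proof (rule order_trans[OF s1], intro add_mono mult_mono)
    show "t \<le> b + (1 - l) * (b * s)"
      by (rule order_trans[OF t1], intro add_mono mult_mono) (use q l nn ab in auto)
  qed (use p l nn ab in auto)
  also have "\<dots> = a + l * (a * b) + (l * (1 - l) * (a * b)) * s"
    by (simp add: algebra_simps)
  also have "\<dots> \<le> a + 1 * (a * b) + \<kappa> * s"
    using l ab nn \<kappa> by (intro add_mono mult_right_mono) auto
  finally have "s * (1 - \<kappa>) \<le> a + a * b"
    by (simp add: algebra_simps)
  then have s2: "s \<le> (a + a * b) / (1 - \<kappa>)"
    using \<kappa> by (simp add: pos_le_divide_eq)
  have "trunc_norm n v (res_series l) \<le> s + t"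
    unfolding res_series_eq s_def t_def by (rule trunc_norm_add) (rule v)
  also have "\<dots> \<le> s + (b + 1 * (b * s))"
    by (intro add_left_mono order_trans[OF t1] add_mono mult_mono) (use q l nn ab in auto)
  also have "\<dots> = (1 + b) * s + b"
    by (simp add: algebra_simps)
  also have "\<dots> \<le> (1 + b) * ((a + a * b) / (1 - \<kappa>)) + b"
    using s2 ab by (intro add_right_mono mult_left_mono) auto
  finally show ?thesis
    by (simp add: v_def)
qed

lemma Gamma_lam_real_finite:
  fixes l x y a b :: real
  assumes "0 \<le> l" "l \<le> 1" "0 \<le> x" "0 \<le> y"
    and "\<And>N. (\<Sum>n\<le>N. \<bar>res_coeff l n\<bar> * x ^ n) \<le> a"
    and "\<And>N. (\<Sum>n\<le>N. \<bar>res_coeff l n\<bar> * y ^ n) \<le> b"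
    and "l * (1 - l) * (a * b) < 1"
  shows "Gamma_lam_real l x y \<noteq> \<infinity>"
proof -
  have "Gamma_lam_real l x y = ncps_eval (ncps_abs (res_series l)) (case_letter x y)"
    by (simp add: Gamma_lam_real_def Gamma_lam_def res_series_def)
  also have "\<dots> \<le> ennreal ((1 + b) * ((a + a * b) / (1 - l * (1 - l) * (a * b))) + b)"
    by (rule ncps_eval_le[OF letter_val_nonneg[OF assms(3,4)]])
       (rule trunc_norm_res_series_le[OF assms(1-6) order_refl assms(7)])
  finally show ?thesis
    by (auto simp: top_unique)
qed

text \<open>
  The bound for the resolvents is uniform in \<open>l\<close>, so it survives the integration over \<open>l\<close> that gives
  the logarithm.
\<close>

lemma Gamma_BCH_real_finite:
  fixes x y A \<kappa> :: real and a b :: "real \<Rightarrow> real"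
  assumes xy: "0 \<le> x" "0 \<le> y"
    and a: "\<And>l N. 0 \<le> l \<Longrightarrow> l \<le> 1 \<Longrightarrow> (\<Sum>n\<le>N. \<bar>res_coeff l n\<bar> * x ^ n) \<le> a l"
    and b: "\<And>l N. 0 \<le> l \<Longrightarrow> l \<le> 1 \<Longrightarrow> (\<Sum>n\<le>N. \<bar>res_coeff l n\<bar> * y ^ n) \<le> b l"
    and A: "\<And>l. 0 \<le> l \<Longrightarrow> l \<le> 1 \<Longrightarrow> a l \<le> A \<and> b l \<le> A"
    and \<kappa>: "\<And>l. 0 \<le> l \<Longrightarrow> l \<le> 1 \<Longrightarrow> l * (1 - l) * (a l * b l) \<le> \<kappa>" "\<kappa> < 1"
  shows "Gamma_BCH_real x y \<noteq> \<infinity>"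
proof -
  define v where "v = case_letter x y"
  have v: "0 \<le> v c" for c
    using xy by (simp add: v_def letter_val_nonneg)
  define B where "B = (1 + A) * ((A + A * A) / (1 - \<kappa>)) + A"
  have R: "trunc_norm n v (res_series l) \<le> B" if l: "0 \<le> l" "l \<le> 1" for l n
  proof -
    have nn: "0 \<le> a l" "0 \<le> b l"
      using a[OF l, of 0] b[OF l, of 0] by simp_all
    have "trunc_norm n v (res_series l) \<le> (1 + b l) * ((a l + a l * b l) / (1 - \<kappa>)) + b l"
      unfolding v_def by (rule trunc_norm_res_series_le[OF l xy a[OF l] b[OF l] \<kappa>(1)[OF l] \<kappa>(2)])
    also have "\<dots> \<le> B"
      unfolding B_def using nn A[OF l] \<kappa>(2)
      by (intro add_mono mult_mono divide_right_mono mult_nonneg_nonneg divide_nonneg_nonneg add_nonneg_nonneg) auto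
    finally show ?thesis .
  qed
  have "trunc_norm n v (ncps_log BCH_A) \<le> B" for n
  proof -
    define W where "W = {w :: letter list. length w \<le> n}"
    have int: "(\<lambda>l. \<bar>ncps_nth (res_series l) w\<bar>) integrable_on {0..1}" for w
      by (intro integrable_continuous_interval continuous_intros continuous_on_res_series_nth)
    have "trunc_norm n v (ncps_log BCH_A) \<le> (\<Sum>w\<in>W. integral {0..1} (\<lambda>l. \<bar>ncps_nth (res_series l) w\<bar>) * word_weight v w)"
      unfolding trunc_norm_def W_def[symmetric]
    proof (intro sum_mono mult_right_mono word_weight_nonneg v)
      fix w :: "letter list"
      have "ncps_nth (ncps_log BCH_A) w = integral {0..1} (\<lambda>l. ncps_nth (res_series l) w)"
        using log_nth_has_integral[of w] by (simp add: integral_unique)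
      also have "\<bar>\<dots>\<bar> \<le> integral {0..1} (\<lambda>l. \<bar>ncps_nth (res_series l) w\<bar>)"
        using integral_norm_bound_integral[OF has_integral_integrable[OF log_nth_has_integral[of w]] int[of w]] by simp
      finally show "\<bar>ncps_nth (ncps_log BCH_A) w\<bar> \<le> integral {0..1} (\<lambda>l. \<bar>ncps_nth (res_series l) w\<bar>)" .
    qed
    also have "\<dots> = integral {0..1} (\<lambda>l. \<Sum>w\<in>W. \<bar>ncps_nth (res_series l) w\<bar> * word_weight v w)"
      by (subst integral_sum) (use finite_words int in \<open>auto simp: W_def intro!: integrable_on_mult_left\<close>)
    also have "\<dots> = integral {0..1} (\<lambda>l. trunc_norm n v (res_series l))"
      by (simp add: trunc_norm_def W_def)
    also have "\<dots> \<le> integral {0..1} (\<lambda>l::real. B)"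
    proof (rule integral_le)
      show "(\<lambda>l. trunc_norm n v (res_series l)) integrable_on {0..1}"
        unfolding trunc_norm_def
        by (intro integrable_continuous_interval continuous_intros continuous_on_res_series_nth)
    qed (use R in auto)
    finally show ?thesis
      by simp
  qed
  then have "ncps_eval (ncps_abs (ncps_log BCH_A)) v \<le> ennreal B"
    by (rule ncps_eval_le[OF v])
  then show ?thesis
    by (auto simp: Gamma_BCH_real_def Gamma_BCH_def v_def top_unique)
qed

section \<open>A lower bound by words with an even number of blocks\<close>

text \<open>
  The list contains the lengths of the blocks, and the first block consists of \<open>LX\<close> if the flag is set.
\<close>

fun alternating_word :: "bool \<Rightarrow> nat list \<Rightarrow> letter list" where
  "alternating_word b [] = []"
| "alternating_word b (k # ks) = replicate k (if b then LX else LY) @ alternating_word (\<not> b) ks"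

lemma alternating_word_cases:
  "\<forall>k\<in>set ks. 0 < k \<Longrightarrow> alternating_word b ks = [] \<or> hd (alternating_word b ks) = (if b then LX else LY)"
  by (cases ks) (auto simp: hd_append)

text \<open>
  Positive block lengths can be read off from the word. This is why coefficients of different
  block patterns never interfere.
\<close>

lemma alternating_word_inj:
  "\<forall>k\<in>set ks. 0 < k \<Longrightarrow> \<forall>k\<in>set js. 0 < k \<Longrightarrow> alternating_word b ks = alternating_word b js \<Longrightarrow> ks = js"
proof (induction ks arbitrary: b js)
  case Nil
  then show ?case
    by (cases js) auto
next
  case (Cons k ks)
  obtain j js' where js: "js = j # js'"
    using Cons.prems by (cases js) auto
  define c where "c = (if b then LX else LY)"
  have tw: "takeWhile (\<lambda>x. x = c) (replicate i c @ alternating_word (\<not> b) is) = replicate i c" 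
    if "\<forall>k\<in>set is. 0 < k" for i "is"
    using alternating_word_cases[OF that, of "\<not> b"]
    by (cases "alternating_word (\<not> b) is") (auto simp: takeWhile_append c_def split: if_splits)
  have eq: "replicate k c @ alternating_word (\<not> b) ks = replicate j c @ alternating_word (\<not> b) js'"
    using Cons.prems(3) by (simp add: js c_def)
  have "replicate k c = replicate j c"
    using arg_cong[OF eq, of "takeWhile (\<lambda>x. x = c)"] tw[of ks k] tw[of js' j] Cons.prems by (simp add: js)
  then have "k = j"
    by (metis length_replicate)
  with eq have "alternating_word (\<not> b) ks = alternating_word (\<not> b) js'"
    by simp
  with Cons.IH[of js' "\<not> b"] Cons.prems show ?case
    by (simp add: js \<open>k = j\<close>)
qed

lemma word_weight_alternating_word: "word_weight (\<lambda>_. m) (alternating_word b ks) = m ^ sum_list ks"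
proof -
  have "word_weight (\<lambda>_. m) w = m ^ length w" for w :: "letter list"
    by (induction w) (simp_all add: word_weight_def)
  moreover have "length (alternating_word b ks) = sum_list ks"
    by (induction ks arbitrary: b) auto
  ultimately show ?thesis
    by simp
qed

lemma ncps_subst_mult_nth_other:
  fixes f :: "'c::comm_ring_1 fps"
  assumes "fps_nth f 0 = 0" and "w = [] \<or> hd w \<noteq> x"
  shows "ncps_nth (ncps_subst x f * T) w = 0"
proof -
  have "ncps_nth (ncps_subst x f) (take i w) = 0" for i
    using assms by (cases i; cases w) (auto simp: ncps_nth_subst)
  then show ?thesis
    by (simp add: times_ncps.rep_eq)
qed

lemma ncps_subst_mult_nth_replicate:
  fixes f :: "'c::comm_ring_1 fps"
  assumes T: "\<And>u. u \<noteq> [] \<Longrightarrow> hd u = x \<Longrightarrow> ncps_nth T u = 0" and w: "w = [] \<or> hd w \<noteq> x"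
  shows "ncps_nth (ncps_subst x f * T) (replicate k x @ w) = fps_nth f k * ncps_nth T w"
proof -
  define u where "u = replicate k x @ w"
  have "ncps_nth (ncps_subst x f) (take i u) * ncps_nth T (drop i u)
      = (if i = k then fps_nth f k * ncps_nth T w else 0)" if "i \<le> length u" for i
  proof (cases i k rule: linorder_cases)
    case less
    then obtain d where d: "k = i + Suc d"
      by (metis add_Suc_right less_imp_Suc_add)
    have "u = replicate i x @ (x # replicate d x @ w)"
      unfolding u_def d replicate_add by simp
    then have "drop i u = x # (replicate d x @ w)"
      by simp
    with less T show ?thesis
      by simp
  next
    case equal
    then show ?thesis
      by (simp add: ncps_nth_subst u_def)
  next
    case greater
    with that obtain c w' where cw: "w = c # w'" "c \<noteq> x"
      using w by (cases w) (auto simp: u_def)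
    moreover obtain d where "i = k + Suc d"
      using greater by (metis add_Suc_right less_imp_Suc_add)
    ultimately have "c \<in> set (take i u)"
      by (simp add: u_def)
    then have "take i u \<noteq> replicate n x" for n
      using cw by (metis in_set_replicate)
    with greater show ?thesis
      by (simp add: ncps_nth_subst)
  qed
  then have "ncps_nth (ncps_subst x f * T) u = (\<Sum>i = 0..length u. if i = k then fps_nth f k * ncps_nth T w else 0)"
    unfolding times_ncps.rep_eq by (intro sum.cong) auto
  then show ?thesis
    by (simp add: u_def)
qed

fun alternating_coeff :: "real \<Rightarrow> bool \<Rightarrow> nat list \<Rightarrow> real" where
  "alternating_coeff l b [] = 1"
| "alternating_coeff l b (k # ks) =
     (if b then - (1 - l) else l) * res_coeff l k * alternating_coeff l (\<not> b) ks"

lemma res_series_X_factor: "res_series_X l = resX l * (1 + ncps_const l * res_series_Y l)"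
proof -
  have "ncps_const l * resX l = resX l * ncps_const l"
    by (rule ncps_const_commute[symmetric])
  then show ?thesis
    by (subst res_series_X_eq) (simp add: distrib_left mult.assoc[symmetric])
qed

lemma res_series_Y_factor: "res_series_Y l = resY l * (1 - ncps_const (1 - l) * res_series_X l)"
proof -
  have "ncps_const (1 - l) * resY l = resY l * ncps_const (1 - l)"
    by (rule ncps_const_commute[symmetric])
  then show ?thesis
    by (subst res_series_Y_def) (simp add: right_diff_distrib mult.assoc[symmetric])
qed

text \<open>
  Peeling off the first block: by the two factorizations above, a word starting with \<open>LX\<close> is produced only by the
  single-variable resolvent of \<open>X\<close> followed by a word starting with \<open>LY\<close>, and vice versa.
\<close>

lemma alternating_coeff_correct:
  assumes "\<forall>k\<in>set ks. 0 < k"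
  shows "ncps_nth (1 - ncps_const (1 - l) * res_series_X l) (alternating_word True ks) = alternating_coeff l True ks"
    and "ncps_nth (1 + ncps_const l * res_series_Y l) (alternating_word False ks) = alternating_coeff l False ks"
  using assms
proof (induction ks)
  case Nil
  case 1 show ?case
    by (simp add: res_series_X_factor)
  case 2 show ?case
    by (simp add: res_series_Y_factor)
next
  case (Cons k ks)
  define TX TY where "TX = 1 - ncps_const (1 - l) * res_series_X l" and "TY = 1 + ncps_const l * res_series_Y l"
  have SX: "res_series_X l = resX l * TY" and SY: "res_series_Y l = resY l * TX"
    unfolding TX_def TY_def by (rule res_series_X_factor res_series_Y_factor)+
  have TX: "ncps_nth TX u = 0" if "u \<noteq> []" "hd u = LY" for u
    using that unfolding TX_def SX by (simp add: ncps_subst_mult_nth_other one_ncps.rep_eq)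
  have TY: "ncps_nth TY u = 0" if "u \<noteq> []" "hd u = LX" for u
    using that unfolding TY_def SY by (simp add: ncps_subst_mult_nth_other one_ncps.rep_eq)
  have ks: "\<forall>k\<in>set ks. 0 < k" and k: "0 < k" if "\<forall>k\<in>set (k # ks). 0 < k"
    using that by auto
  case 1
  have "ncps_nth (res_series_X l) (replicate k LX @ alternating_word False ks) = res_coeff l k * ncps_nth TY (alternating_word False ks)"
    unfolding SX res_coeff_def
    by (rule ncps_subst_mult_nth_replicate) (use TY alternating_word_cases[OF ks[OF 1], of False] in auto)
  then show ?case
    using Cons.IH(2)[OF ks[OF 1], folded TY_def] k[OF 1] by (simp add: one_ncps.rep_eq minus_mult_left)
  case 2
  have "ncps_nth (res_series_Y l) (replicate k LY @ alternating_word True ks) = res_coeff l k * ncps_nth TX (alternating_word True ks)"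
    unfolding SY res_coeff_def
    by (rule ncps_subst_mult_nth_replicate) (use TX alternating_word_cases[OF ks[OF 2], of True] in auto)
  then show ?case
    using Cons.IH(1)[OF ks[OF 2], folded TX_def] k[OF 2] by (simp add: one_ncps.rep_eq)
qed

lemma res_series_nth_alternating_word:
  assumes "\<forall>k\<in>set (k # ks). 0 < k"
  shows "ncps_nth (res_series l) (alternating_word True (k # ks)) = res_coeff l k * alternating_coeff l False ks"
proof -
  define TX TY where "TX = 1 - ncps_const (1 - l) * res_series_X l" and "TY = 1 + ncps_const l * res_series_Y l"
  have SX: "res_series_X l = resX l * TY" and SY: "res_series_Y l = resY l * TX"
    unfolding TX_def TY_def by (rule res_series_X_factor res_series_Y_factor)+
  have TY: "ncps_nth TY u = 0" if "u \<noteq> []" "hd u = LX" for u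
    using that unfolding TY_def SY by (simp add: ncps_subst_mult_nth_other one_ncps.rep_eq)
  have w: "alternating_word True (k # ks) = replicate k LX @ alternating_word False ks"
    by simp
  have ks: "\<forall>k\<in>set ks. 0 < k"
    using assms by simp
  have "ncps_nth (res_series_X l) (replicate k LX @ alternating_word False ks) = res_coeff l k * ncps_nth TY (alternating_word False ks)"
    unfolding SX res_coeff_def
    by (rule ncps_subst_mult_nth_replicate) (use TY alternating_word_cases[OF ks, of False] in auto)
  also have "ncps_nth TY (alternating_word False ks) = alternating_coeff l False ks"
    unfolding TY_def by (rule alternating_coeff_correct(2)[OF ks])
  finally have "ncps_nth (res_series_X l) (alternating_word True (k # ks)) = res_coeff l k * alternating_coeff l False ks"
    unfolding w .
  moreover have "ncps_nth (res_series_Y l) (alternating_word True (k # ks)) = 0"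
    unfolding SY by (rule ncps_subst_mult_nth_other) (use assms in \<open>auto simp: hd_append\<close>)
  ultimately show ?thesis
    by (simp add: res_series_eq)
qed

definition block_lists :: "nat \<Rightarrow> nat \<Rightarrow> nat list set" where
  "block_lists A n = {ks. set ks \<subseteq> {1..A} \<and> length ks = n}"

lemma finite_block_lists: "finite (block_lists A n)"
  unfolding block_lists_def by (rule finite_lists_length_eq) simp

lemma block_lists_0: "block_lists A 0 = {[]}"
  by (auto simp: block_lists_def)

lemma sum_block_lists_Suc: "(\<Sum>ks\<in>block_lists A (Suc n). h ks) = (\<Sum>k=1..A. \<Sum>ks\<in>block_lists A n. h (k # ks))"
proof -
  have "block_lists A (Suc n) = (\<lambda>(k, ks). k # ks) ` ({1..A} \<times> block_lists A n)"
    by (auto simp: block_lists_def length_Suc_conv image_iff)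
  then have "(\<Sum>ks\<in>block_lists A (Suc n). h ks) = (\<Sum>(k, ks)\<in>{1..A} \<times> block_lists A n. h (k # ks))"
    by (simp add: sum.reindex inj_on_def case_prod_unfold)
  then show ?thesis
    by (simp add: sum.cartesian_product)
qed

lemma sum_alternating_coeff:
  fixes l :: real and A :: nat and c :: "nat \<Rightarrow> real"
  defines "r \<equiv> (\<Sum>k=1..A. c k * res_coeff l k)"
  shows "(\<Sum>ks\<in>block_lists A (Suc n). prod_list (map c ks) * alternating_coeff l b ks) =
     (if b then - (1 - l) else l) * r * (\<Sum>ks\<in>block_lists A n. prod_list (map c ks) * alternating_coeff l (\<not> b) ks)"
proof -
  have "(\<Sum>ks\<in>block_lists A (Suc n). prod_list (map c ks) * alternating_coeff l b ks) =
    (\<Sum>k=1..A. (if b then - (1 - l) else l) * (c k * res_coeff l k) * (\<Sum>ks\<in>block_lists A n. prod_list (map c ks) * alternating_coeff l (\<not> b) ks))"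
    unfolding sum_block_lists_Suc sum_distrib_left by (intro sum.cong) (auto simp: mult_ac)
  then show ?thesis
    by (simp add: r_def sum_distrib_left sum_distrib_right mult_ac)
qed

lemma sum_alternating_coeff_even:
  fixes l :: real
  defines "r \<equiv> (\<lambda>A c. \<Sum>k=1..A. c k * res_coeff l k)"
  shows "(\<Sum>ks\<in>block_lists A (2 * j). prod_list (map c ks) * alternating_coeff l b ks) = (- (l * (1 - l) * (r A c)\<^sup>2)) ^ j"
proof (induction j)
  case (Suc j)
  define X M where "X = r A c" and "M = 1 - l"
  have "2 * Suc j = Suc (Suc (2 * j))"
    by simp
  moreover have "(\<Sum>ks\<in>block_lists A (Suc (Suc (2 * j))). prod_list (map c ks) * alternating_coeff l b ks) =
     (if b then - M else l) * X * ((if \<not> b then - M else l) * X * (- (l * M * X\<^sup>2)) ^ j)"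
    using Suc by (simp only: sum_alternating_coeff not_not X_def M_def r_def)
  ultimately show ?case
    unfolding X_def[symmetric] M_def[symmetric] by (cases b) (simp_all add: power2_eq_square mult_ac)
qed (simp add: block_lists_0)

text \<open>
  Since the coefficient of an alternating word is a product over its blocks, summation over all block
  lengths up to \<open>A\<close> factorizes. The weights \<open>c\<close> will carry powers of the radius and signs.
\<close>

lemma sum_res_series_alternating:
  fixes l :: real
  defines "r \<equiv> (\<lambda>A c. \<Sum>k=1..A. c k * res_coeff l k)"
  shows "(\<Sum>ks\<in>block_lists A (2 * Suc j). prod_list (map c ks) * ncps_nth (res_series l) (alternating_word True ks)) =
     (-1) ^ j * (l * (r A c)\<^sup>2 * (l * (1 - l) * (r A c)\<^sup>2) ^ j)"
proof -
  have pos: "\<forall>i\<in>set (k # ks). 0 < i" if "k \<in> {1..A}" "ks \<in> block_lists A n" for k ks n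
    using that by (force simp: block_lists_def)
  have "(\<Sum>ks\<in>block_lists A (2 * Suc j). prod_list (map c ks) * ncps_nth (res_series l) (alternating_word True ks)) =
    (\<Sum>k=1..A. \<Sum>ks\<in>block_lists A (Suc (2 * j)). (c k * res_coeff l k) * (prod_list (map c ks) * alternating_coeff l False ks))"
    unfolding mult_Suc_right add_2_eq_Suc sum_block_lists_Suc[of _ _ "Suc (2 * j)"]
    by (intro sum.cong refl, subst res_series_nth_alternating_word[OF pos]) (auto simp: mult_ac)
  also have "\<dots> = r A c * (\<Sum>ks\<in>block_lists A (Suc (2 * j)). prod_list (map c ks) * alternating_coeff l False ks)"
    by (simp add: r_def sum_distrib_left[symmetric] sum_distrib_right)
  also have "\<dots> = r A c * (l * r A c * (- (l * (1 - l) * (r A c)\<^sup>2)) ^ j)"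
    by (simp add: sum_alternating_coeff sum_alternating_coeff_even r_def)
  also have "(- (l * (1 - l) * (r A c)\<^sup>2)) ^ j = (-1) ^ j * (l * (1 - l) * (r A c)\<^sup>2) ^ j"
    by (rule power_minus)
  finally show ?thesis
    by (simp add: power2_eq_square mult_ac)
qed

text \<open>
  The words with \<open>2 (j + 1)\<close> blocks contribute, after multiplication with signs of modulus at most 1 and
  integration over \<open>l\<close>, the \<open>j\<close>-th integral, up to the sign \<open>(-1)\<^sup>j\<close>. The triangle inequality and
  the injectivity of the block description bound the sum over \<open>j\<close> by the full majorant series.
\<close>

lemma Gamma_BCH_real_lower_bound:
  fixes m :: real
  assumes m: "0 \<le> m" and fin: "Gamma_BCH_real m m \<noteq> \<infinity>"
  shows "\<exists>B. \<forall>A J s. (\<forall>k. \<bar>s k\<bar> \<le> 1) \<longrightarrow>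
    (\<Sum>j<J. integral {0..1} (\<lambda>l. l * (\<Sum>k=1..A. s k * m ^ k * res_coeff l k)\<^sup>2 *
        (l * (1 - l) * (\<Sum>k=1..A. s k * m ^ k * res_coeff l k)\<^sup>2) ^ j)) \<le> B"
proof -
  define v where "v = (\<lambda>_ :: letter. m)"
  have v: "0 \<le> v c" for c
    using m by (simp add: v_def)
  define f where "f w = ncps_nth (ncps_log BCH_A) w" for w
  have cl: "case_letter m m = v"
    by (auto simp: v_def fun_eq_iff split: letter.splits)
  obtain B where B: "0 \<le> B" "Gamma_BCH_real m m = ennreal B"
    using fin by (cases "Gamma_BCH_real m m") auto
  have bound: "(\<Sum>w\<in>W. \<bar>f w\<bar> * word_weight v w) \<le> B" if "finite W" for W
  proof -
    have "ennreal (\<Sum>w\<in>W. \<bar>f w\<bar> * word_weight v w) \<le> ennreal B"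
      using sum_le_ncps_eval[of v, OF v that, of "ncps_log BCH_A"] B(2)
      by (simp add: Gamma_BCH_real_def Gamma_BCH_def cl f_def)
    then show ?thesis
      using B(1) by simp
  qed
  show ?thesis
  proof (intro exI[of _ B] allI impI)
    fix A J and s :: "nat \<Rightarrow> real"
    assume s: "\<forall>k. \<bar>s k\<bar> \<le> 1"
    define c where "c k = s k * m ^ k" for k
    define r where "r l = (\<Sum>k=1..A. c k * res_coeff l k)" for l :: real
    have r_cont: "continuous_on S r" for S
      unfolding r_def
      by (intro continuous_intros DERIV_continuous_on[OF has_real_derivative_res_coeff])
    define K where "K = (\<Union>j<J. block_lists A (2 * Suc j))"
    have K: "finite K"
      by (auto simp: K_def finite_block_lists)
    have prod_c: "\<bar>prod_list (map c ks)\<bar> \<le> m ^ sum_list ks" for ks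
    proof (induction ks)
      case (Cons k ks)
      have "\<bar>s k\<bar> * m ^ k \<le> 1 * m ^ k"
        using s m by (intro mult_right_mono) auto
      then have "\<bar>c k\<bar> \<le> m ^ k"
        using m by (simp add: c_def abs_mult)
      with Cons show ?case
        using m by (auto simp: abs_mult power_add intro!: mult_mono)
    qed simp
    have "integral {0..1} (\<lambda>l. l * (r l)\<^sup>2 * (l * (1 - l) * (r l)\<^sup>2) ^ j) \<le> 
       (\<Sum>ks\<in>block_lists A (2 * Suc j). \<bar>f (alternating_word True ks)\<bar> * m ^ sum_list ks)" for j
    proof -
      have "((\<lambda>l. \<Sum>ks\<in>block_lists A (2 * Suc j). prod_list (map c ks) * ncps_nth (res_series l) (alternating_word True ks)) has_integral
          (\<Sum>ks\<in>block_lists A (2 * Suc j). prod_list (map c ks) * f (alternating_word True ks))) {0..1}"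
        unfolding f_def by (intro has_integral_sum finite_block_lists has_integral_mult_right log_nth_has_integral)
      then have "((\<lambda>l. (-1) ^ j * (l * (r l)\<^sup>2 * (l * (1 - l) * (r l)\<^sup>2) ^ j)) has_integral
          (\<Sum>ks\<in>block_lists A (2 * Suc j). prod_list (map c ks) * f (alternating_word True ks))) {0..1}"
        unfolding sum_res_series_alternating r_def .
      from integral_unique[OF this]
      have e: "(-1) ^ j * integral {0..1} (\<lambda>l. l * (r l)\<^sup>2 * (l * (1 - l) * (r l)\<^sup>2) ^ j) =
         (\<Sum>ks\<in>block_lists A (2 * Suc j). prod_list (map c ks) * f (alternating_word True ks))"
        by (simp only: integral_mult_right)
      have le: "x \<le> \<bar>(-1) ^ j * x\<bar>" for x :: real
        by (simp add: abs_mult power_abs)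
      have "integral {0..1} (\<lambda>l. l * (r l)\<^sup>2 * (l * (1 - l) * (r l)\<^sup>2) ^ j) \<le>
         \<bar>\<Sum>ks\<in>block_lists A (2 * Suc j). prod_list (map c ks) * f (alternating_word True ks)\<bar>"
        by (rule order_trans[OF le]) (simp only: e order_refl)
      also have "\<dots> \<le> (\<Sum>ks\<in>block_lists A (2 * Suc j). \<bar>prod_list (map c ks) * f (alternating_word True ks)\<bar>)"
        by (rule sum_abs)
      also have "\<dots> \<le> (\<Sum>ks\<in>block_lists A (2 * Suc j). \<bar>f (alternating_word True ks)\<bar> * m ^ sum_list ks)"
        unfolding abs_mult
        by (intro sum_mono, subst mult.commute, intro mult_left_mono prod_c) simp
      finally show ?thesis .
    qed
    then have "(\<Sum>j<J. integral {0..1} (\<lambda>l. l * (r l)\<^sup>2 * (l * (1 - l) * (r l)\<^sup>2) ^ j)) \<le>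
       (\<Sum>j<J. \<Sum>ks\<in>block_lists A (2 * Suc j). \<bar>f (alternating_word True ks)\<bar> * m ^ sum_list ks)"
      by (intro sum_mono)
    also have "\<dots> = (\<Sum>ks\<in>K. \<bar>f (alternating_word True ks)\<bar> * m ^ sum_list ks)"
      unfolding K_def by (rule sum.UNION_disjoint[symmetric]) (auto simp: finite_block_lists, auto simp: block_lists_def)
    also have "\<dots> = (\<Sum>w\<in>alternating_word True ` K. \<bar>f w\<bar> * word_weight v w)"
    proof (subst sum.reindex)
      show "inj_on (alternating_word True) K"
      proof (rule inj_onI)
        fix ks js assume "ks \<in> K" "js \<in> K" and eq: "alternating_word True ks = alternating_word True js"
        then have "\<forall>k\<in>set ks. 0 < k" "\<forall>k\<in>set js. 0 < k"
          by (fastforce simp: K_def block_lists_def)+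
        then show "ks = js"
          using eq by (rule alternating_word_inj)
      qed
    qed (simp add: v_def word_weight_alternating_word)
    also have "\<dots> \<le> B"
      by (rule bound) (simp add: K)
    finally show "(\<Sum>j<J. integral {0..1} (\<lambda>l. l * (\<Sum>k=1..A. s k * m ^ k * res_coeff l k)\<^sup>2 *
        (l * (1 - l) * (\<Sum>k=1..A. s k * m ^ k * res_coeff l k)\<^sup>2) ^ j)) \<le> B"
      by (simp add: r_def c_def)
  qed
qed

section \<open>Balanced arguments maximize the product of two majorants\<close>

lemma summable_res_maj:
  fixes l x :: real
  assumes l: "0 < l" "l < 1" and x: "0 \<le> x" "x < 157/50"
  shows "summable (\<lambda>n. \<bar>res_coeff l n\<bar> * x ^ n)"
proof -
  have c: "0 < l * (1 - l)"
    using l by simp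
  have "summable (\<lambda>n. (13/50) / (l * (1 - l)) * x * (50 * x / 157) ^ n)"
    using x by (intro summable_mult summable_geometric) simp
  then have "summable (\<lambda>n. \<bar>res_coeff l (Suc n)\<bar> * x ^ Suc n)"
  proof (rule summable_comparison_test[rotated], intro exI allI impI)
    fix n
    have "\<bar>res_coeff l (Suc n)\<bar> \<le> 13/50 * (50/157) ^ n / (l * (1 - l))"
      using res_coeff_Suc_bound[of l n] l c by (simp add: pos_le_divide_eq mult.commute)
    then have "\<bar>res_coeff l (Suc n)\<bar> * x ^ Suc n \<le> 13/50 * (50/157) ^ n / (l * (1 - l)) * x ^ Suc n"
      using x by (intro mult_right_mono) auto
    also have "\<dots> = (13/50) / (l * (1 - l)) * x * (50 * x / 157) ^ n"
      by (simp add: power_divide power_mult_distrib field_simps)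
    finally show "norm (\<bar>res_coeff l (Suc n)\<bar> * x ^ Suc n) \<le> (13/50) / (l * (1 - l)) * x * (50 * x / 157) ^ n"
      using x by simp
  qed
  then show ?thesis
    by (subst (asm) summable_Suc_iff)
qed

lemma res_maj_partial_sum_le:
  fixes l x :: real
  assumes "0 < l" "l < 1" "0 \<le> x" "x < 157/50"
  shows "(\<Sum>n\<le>N. \<bar>res_coeff l n\<bar> * x ^ n) \<le> res_maj l x"
  unfolding res_maj_def
  by (rule sum_le_suminf[OF summable_res_maj[OF assms]]) (use assms in auto)

lemma res_maj_nonneg:
  fixes l x :: real
  assumes "0 < l" "l < 1" "0 \<le> x" "x < 157/50"
  shows "0 \<le> res_maj l x"
  unfolding res_maj_def by (rule suminf_nonneg[OF summable_res_maj[OF assms]]) (use assms in auto)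

text \<open>
  The majorant has no constant term, so each of its terms scales at least linearly.
\<close>

lemma res_maj_scale:
  fixes l x t :: real
  assumes l: "0 < l" "l < 1" and x: "0 \<le> x" "x < 157/50" and t: "0 \<le> t" "t \<le> 1"
  shows "res_maj l (t * x) \<le> t * res_maj l x"
proof -
  have tx: "0 \<le> t * x" "t * x < 157/50"
    using x t mult_left_le_one_le[of x t] by auto
  have "res_maj l (t * x) \<le> (\<Sum>n. t * (\<bar>res_coeff l n\<bar> * x ^ n))"
    unfolding res_maj_def
  proof (rule suminf_le[OF _ summable_res_maj[OF l tx] summable_mult[OF summable_res_maj[OF l x]]])
    fix n
    have "\<bar>res_coeff l n\<bar> * (t * x) ^ n \<le> \<bar>res_coeff l n\<bar> * (t * x ^ n)"
    proof (cases n)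
      case (Suc k)
      have "t ^ Suc k \<le> t"
        using t by (simp add: mult_left_le power_le_one)
      then show ?thesis
        unfolding Suc power_mult_distrib using x by (intro mult_left_mono mult_right_mono) auto
    qed simp
    then show "\<bar>res_coeff l n\<bar> * (t * x) ^ n \<le> t * (\<bar>res_coeff l n\<bar> * x ^ n)"
      by (simp add: mult_ac)
  qed
  also have "\<dots> = t * res_maj l x"
    unfolding res_maj_def by (rule suminf_mult[OF summable_res_maj[OF l x]])
  finally show ?thesis .
qed

lemma res_maj_reflect: "res_maj (1 - l) x = res_maj l x"
  by (simp add: res_maj_def res_coeff_reflect abs_mult power_abs)

text \<open>
  By the inequality \<open>4 U V \<le> (U + V)\<^sup>2\<close> it suffices to bound a sum of the two values with weights
  \<open>(1 - s)\<^sup>2 (1 + \<eta> s)\<^sup>2\<close> and \<open>(1 + s)\<^sup>2 (1 - \<eta> s)\<^sup>2\<close>. These interchange when \<open>s\<close> changes sign, so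
  the sum is even in \<open>s\<close>; their product is a square that enters the right-hand side; and the parameter
  \<open>\<eta>\<close> tunes the contribution of the linear term of the majorant.
\<close>

lemma res_maj_weighted_sum:
  fixes l m s \<eta> :: real
  assumes l: "0 < l" "l < 1" and m: "0 < m" and s: "0 < s" "s < 1" and ms: "m * (1 + s) < 157/50"
    and \<eta>: "0 \<le> \<eta>" "\<eta> < 1"
    and less: "(\<Sum>n. \<bar>res_coeff l n\<bar> * m ^ n * ((1 + s) ^ n * (1 - s) * (1 + \<eta> * s)\<^sup>2 * (1 - s) +
        (1 - s) ^ n * (1 + s) * (1 - \<eta> * s)\<^sup>2 * (1 + s))) < 2 * (1 - s\<^sup>2) * (1 - \<eta>\<^sup>2 * s\<^sup>2) * res_maj l m"
  shows "res_maj l (m * (1 + s)) * res_maj l (m * (1 - s)) < (res_maj l m)\<^sup>2"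
proof -
  define A B where "A = res_maj l (m * (1 + s))" and "B = res_maj l (m * (1 - s))"
  define C where "C = (1 - s\<^sup>2) * (1 - \<eta>\<^sup>2 * s\<^sup>2)"
  define U V where "U = A * ((1 - s)\<^sup>2 * (1 + \<eta> * s)\<^sup>2)" and "V = B * ((1 + s)\<^sup>2 * (1 - \<eta> * s)\<^sup>2)"
  have ms': "m * (1 - s) < 157/50"
    using m s by (intro le_less_trans[OF _ ms] mult_left_mono) auto
  have nn: "0 \<le> m * (1 + s)" "0 \<le> m * (1 - s)"
    using m s by auto
  have "\<eta> * s < 1"
    using \<eta> s mult_strict_mono[of \<eta> 1 s 1] by auto
  then have "\<eta>\<^sup>2 * s\<^sup>2 < 1"
    using \<eta> s by (simp add: power_mult_distrib[symmetric] power_less_one_iff abs_square_less_1)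
  moreover have "s\<^sup>2 < 1"
    using s by (simp add: abs_square_less_1)
  ultimately have C: "C > 0"
    by (simp add: C_def)
  have sA: "(\<lambda>n. \<bar>res_coeff l n\<bar> * (m * (1 + s)) ^ n) sums A"
    unfolding A_def res_maj_def by (rule summable_sums[OF summable_res_maj[OF l nn(1) ms]])
  have sB: "(\<lambda>n. \<bar>res_coeff l n\<bar> * (m * (1 - s)) ^ n) sums B"
    unfolding B_def res_maj_def by (rule summable_sums[OF summable_res_maj[OF l nn(2) ms']])
  have t: "c * (m * p) ^ n * (q\<^sup>2 * r) + c * (m * q) ^ n * (p\<^sup>2 * r') = c * m ^ n * (p ^ n * q * r * q + q ^ n * p * r' * p)"
    for c p q r r' :: real and n
    by (simp add: power_mult_distrib power2_eq_square distrib_left mult_ac)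
  have "(\<lambda>n. \<bar>res_coeff l n\<bar> * (m * (1 + s)) ^ n * ((1 - s)\<^sup>2 * (1 + \<eta> * s)\<^sup>2) + 
     \<bar>res_coeff l n\<bar> * (m * (1 - s)) ^ n * ((1 + s)\<^sup>2 * (1 - \<eta> * s)\<^sup>2)) sums (U + V)"
    unfolding U_def V_def by (intro sums_add sums_mult2 sA sB)
  then have "U + V = (\<Sum>n. \<bar>res_coeff l n\<bar> * m ^ n * ((1 + s) ^ n * (1 - s) * (1 + \<eta> * s)\<^sup>2 * (1 - s) +
        (1 - s) ^ n * (1 + s) * (1 - \<eta> * s)\<^sup>2 * (1 + s)))"
    unfolding t by (rule sums_unique)
  with less have "U + V < 2 * (1 - s\<^sup>2) * (1 - \<eta>\<^sup>2 * s\<^sup>2) * res_maj l m"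
    by (simp only:)
  then have UV: "U + V < 2 * (C * res_maj l m)"
    by (simp only: C_def mult.assoc)
  have AB: "0 \<le> A" "0 \<le> B"
    unfolding A_def B_def by (intro res_maj_nonneg l nn ms ms')+
  then have "0 \<le> U" "0 \<le> V"
    by (simp_all add: U_def V_def)
  have "U * V = C\<^sup>2 * (A * B)"
    by (simp add: U_def V_def C_def power2_eq_square algebra_simps)
  moreover have "4 * (U * V) \<le> (U + V)\<^sup>2"
    using zero_le_square[of "U - V"] by (simp add: power2_eq_square algebra_simps)
  moreover have "(U + V)\<^sup>2 < (2 * (C * res_maj l m))\<^sup>2"
    using UV \<open>0 \<le> U\<close> \<open>0 \<le> V\<close> by (intro power_strict_mono) auto
  ultimately have "4 * (C\<^sup>2 * (A * B)) < 4 * (C\<^sup>2 * (res_maj l m)\<^sup>2)"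
    by (simp add: power_mult_distrib)
  then show ?thesis
    using C by (simp add: A_def B_def)
qed

text \<open>
  The coefficient of \<open>s\<^sup>2\<^sup>j\<close> in \<open>(1 + s)\<^sup>n (1 + \<eta> s)\<^sup>2\<close>. The case distinctions discard the terms
  that truncated subtraction would produce for \<open>j = 0\<close>.
\<close>

definition even_part_weight :: "real \<Rightarrow> nat \<Rightarrow> nat \<Rightarrow> real" where
  "even_part_weight \<eta> j n = real (n choose (2 * j)) + 2 * \<eta> * (if j = 0 then 0 else real (n choose (2 * j - 1)))
     + \<eta>\<^sup>2 * (if j = 0 then 0 else real (n choose (2 * j - 2)))"

lemma even_part_weight_0 [simp]: "even_part_weight \<eta> 0 n = 1"
  by (simp add: even_part_weight_def)

lemma even_part_weight_nonneg: "0 \<le> \<eta> \<Longrightarrow> 0 \<le> even_part_weight \<eta> j n"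
  by (simp add: even_part_weight_def)

lemma even_part_expansion:
  fixes s \<eta> :: real
  assumes "n \<le> N"
  shows "(1 + s) ^ n * (1 + \<eta> * s)\<^sup>2 + (1 - s) ^ n * (1 - \<eta> * s)\<^sup>2 = 2 * (\<Sum>j\<le>Suc N. even_part_weight \<eta> j n * (s\<^sup>2) ^ j)"
proof -
  have bin: "(1 + x) ^ n = (\<Sum>k\<le>n. real (n choose k) * x ^ k)" for x :: real
    using binomial_ring[of x 1 n] by (simp add: add.commute)
  have bin': "(1 + x) ^ n = (\<Sum>k\<le>2*N+1. real (n choose k) * x ^ k)" for x :: real
    unfolding bin by (rule sum.mono_neutral_left) (use assms in auto)
  have split: "(\<Sum>k\<le>2*M+1. f k) = (\<Sum>j\<le>M. f (2 * j)) + (\<Sum>j\<le>M. f (2 * j + 1))" for f :: "nat \<Rightarrow> real" and M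
    by (induction M) (simp_all add: algebra_simps)
  define E where "E = (\<Sum>j\<le>N. real (n choose (2 * j)) * (s\<^sup>2) ^ j)"
  define D where "D = (\<Sum>j\<le>N. real (n choose (2 * j + 1)) * (s\<^sup>2) ^ j)"
  have pw: "x ^ (2 * j) = (x\<^sup>2) ^ j" "x ^ (2 * j + 1) = x * (x\<^sup>2) ^ j" for x :: real and j
    by (simp_all add: power_mult)
  have pm: "(1 + x) ^ n = (\<Sum>j\<le>N. real (n choose (2 * j)) * (x\<^sup>2) ^ j) + x * (\<Sum>j\<le>N. real (n choose (2 * j + 1)) * (x\<^sup>2) ^ j)" for x
    unfolding bin' split pw sum_distrib_left by (simp only: mult.left_commute)
  have p: "(1 + s) ^ n = E + s * D" 
    unfolding pm E_def D_def ..
  have q: "(1 - s) ^ n = E - s * D"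
    using pm[of "- s"] by (simp add: E_def D_def)
  have "(\<Sum>j\<le>Suc N. even_part_weight \<eta> j n * (s\<^sup>2) ^ j) = 
     (\<Sum>j\<le>Suc N. real (n choose (2 * j)) * (s\<^sup>2) ^ j) + 
     2 * \<eta> * (\<Sum>j\<le>Suc N. (if j = 0 then 0 else real (n choose (2 * j - 1))) * (s\<^sup>2) ^ j) +
     \<eta>\<^sup>2 * (\<Sum>j\<le>Suc N. (if j = 0 then 0 else real (n choose (2 * j - 2))) * (s\<^sup>2) ^ j)"
    by (simp add: even_part_weight_def sum_distrib_left sum.distrib[symmetric] algebra_simps)
  also have "(\<Sum>j\<le>Suc N. real (n choose (2 * j)) * (s\<^sup>2) ^ j) = E"
    using assms by (simp add: E_def)
  also have "(\<Sum>j\<le>Suc N. (if j = 0 then 0 else real (n choose (2 * j - 1))) * (s\<^sup>2) ^ j) = s\<^sup>2 * D"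
    unfolding sum.atMost_Suc_shift D_def sum_distrib_left by (simp add: mult_ac)
  also have "(\<Sum>j\<le>Suc N. (if j = 0 then 0 else real (n choose (2 * j - 2))) * (s\<^sup>2) ^ j) = s\<^sup>2 * E"
    unfolding sum.atMost_Suc_shift E_def sum_distrib_left by (simp add: mult_ac)
  finally have "2 * (\<Sum>j\<le>Suc N. even_part_weight \<eta> j n * (s\<^sup>2) ^ j) = 2 * (E + 2 * \<eta> * (s\<^sup>2 * D) + \<eta>\<^sup>2 * (s\<^sup>2 * E))"
    by simp
  also have "\<dots> = (E + s * D) * (1 + \<eta> * s)\<^sup>2 + (E - s * D) * (1 - \<eta> * s)\<^sup>2"
    by (simp add: power2_eq_square algebra_simps)
  finally show ?thesis
    unfolding p q by simp
qed

text \<open>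
  After division by \<open>(1 - s\<^sup>2)\<close> the weighted sum becomes a power series in \<open>s\<^sup>2\<close>. If all its coefficients
  beyond the first are bounded by \<open>Q\<close>, the geometric series in \<open>s\<^sup>2\<close> reduces the strict inequality for
  all \<open>s\<close> at once to the single inequality on \<open>Q\<close>.
\<close>

lemma res_maj_mult_less:
  fixes l m s \<eta> Q :: real
  defines "h \<equiv> \<lambda>n. \<bar>res_coeff l n\<bar> * m ^ n"
  assumes l: "0 < l" "l < 1" and m: "0 < m" and s: "0 < s" "s < 1" and ms: "m * (1 + s) < 157/50"
    and \<eta>: "0 \<le> \<eta>" "\<eta> < 1"
    and Q: "\<And>j N. 1 \<le> j \<Longrightarrow> (\<Sum>n\<le>N. h (n + 2) * even_part_weight \<eta> j n) \<le> Q"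
    and Q_less: "Q < (1 - \<eta>\<^sup>2) * (\<Sum>n\<le>M. h (n + 2)) + 2 * \<eta> * (1 - \<eta>) * m"
  shows "res_maj l (m * (1 + s)) * res_maj l (m * (1 - s)) < (res_maj l m)\<^sup>2"
proof (rule res_maj_weighted_sum[OF l m s ms \<eta>])
  define \<tau> where "\<tau> = s\<^sup>2"
  have \<tau>: "0 < \<tau>" "\<tau> < 1"
    using s by (auto simp: \<tau>_def abs_square_less_1)
  have m': "0 \<le> m" "m < 157/50"
    using m s ms mult_pos_pos[OF m s(1)] unfolding distrib_left by linarith+
  have h_nn: "0 \<le> h n" for n
    using m by (simp add: h_def)
  have sum_h: "summable h"
    unfolding h_def by (rule summable_res_maj[OF l m'])
  then have sum_h2: "summable (\<lambda>n. h (n + 2))"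
    by (subst summable_iff_shift)
  define H2 where "H2 = (\<Sum>n. h (n + 2))"
  have h1: "h 0 = 0" "h 1 = m"
    by (simp_all add: h_def)
  have maj: "res_maj l m = m + H2"
    using suminf_split_initial_segment[OF sum_h, of 2] h1
    by (simp add: res_maj_def h_def[symmetric] H2_def numeral_2_eq_2)
  have H2_ge: "(\<Sum>n\<le>N. h (n + 2)) \<le> H2" for N
    unfolding H2_def by (rule sum_le_suminf[OF sum_h2]) (auto intro: h_nn)
  define T where "T n = (1 + s) ^ n * (1 - s) * (1 + \<eta> * s)\<^sup>2 * (1 - s) + (1 - s) ^ n * (1 + s) * (1 - \<eta> * s)\<^sup>2 * (1 + s)" for n
  define Q1 where "Q1 = (1 - \<eta>\<^sup>2) * H2 + 2 * \<eta> * (1 - \<eta>) * m"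
  have "Q < Q1"
    using Q_less mult_left_mono[OF H2_ge[of M], of "1 - \<eta>\<^sup>2"] \<eta> by (simp add: Q1_def power_le_one)
  have Q_nn: "0 \<le> Q"
    using Q[of 1 0] mult_nonneg_nonneg[OF h_nn[of 2] even_part_weight_nonneg[OF \<eta>(1), of 1 0]]
    by (simp add: numeral_2_eq_2)
  have ms': "m * (1 - s) < 157/50"
    using m s by (intro le_less_trans[OF _ ms] mult_left_mono) auto
  have nn: "0 \<le> m * (1 + s)" "0 \<le> m * (1 - s)"
    using m s by auto
  have sum_T: "summable (\<lambda>n. h n * T n)"
  proof -
    have "summable (\<lambda>n. \<bar>res_coeff l n\<bar> * (m * (1 + s)) ^ n * ((1 - s) * (1 + \<eta> * s)\<^sup>2 * (1 - s)) + 
       \<bar>res_coeff l n\<bar> * (m * (1 - s)) ^ n * ((1 + s) * (1 - \<eta> * s)\<^sup>2 * (1 + s)))"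
      by (intro summable_add summable_mult2 summable_res_maj l nn ms ms')
    moreover have "c * (m * p) ^ n * (q * r * q) + c * (m * q) ^ n * (p * r' * p) = c * m ^ n * (p ^ n * q * r * q + q ^ n * p * r' * p)"
      for c p q r r' :: real and n
      by (simp add: power_mult_distrib distrib_left mult_ac)
    ultimately show ?thesis
      by (simp only: h_def T_def)
  qed
  have T1: "T 1 = 2 * (1 - \<tau>) * (1 + \<eta>\<^sup>2 * \<tau> - 2 * \<eta> * \<tau>)"
    by (simp add: T_def \<tau>_def power2_eq_square algebra_simps)
  have T2: "T (n + 2) = (1 - \<tau>)\<^sup>2 * ((1 + s) ^ n * (1 + \<eta> * s)\<^sup>2 + (1 - s) ^ n * (1 - \<eta> * s)\<^sup>2)" for n
    by (simp add: T_def \<tau>_def power2_eq_square algebra_simps)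
  have part: "(\<Sum>n\<le>N. h (n + 2) * T (n + 2)) \<le> 2 * (1 - \<tau>)\<^sup>2 * (H2 + Q * \<tau> / (1 - \<tau>))" for N
  proof -
    have "(\<Sum>n\<le>N. h (n + 2) * T (n + 2)) = 2 * (1 - \<tau>)\<^sup>2 * (\<Sum>n\<le>N. \<Sum>j\<le>Suc N. h (n + 2) * even_part_weight \<eta> j n * \<tau> ^ j)"
      unfolding sum_distrib_left
    proof (rule sum.cong[OF refl])
      fix n assume "n \<in> {..N}"
      then show "h (n + 2) * T (n + 2) = (\<Sum>j\<le>Suc N. 2 * (1 - \<tau>)\<^sup>2 * (h (n + 2) * even_part_weight \<eta> j n * \<tau> ^ j))"
        using even_part_expansion[of n N s \<eta>] unfolding T2
        by (simp add: sum_distrib_left \<tau>_def mult_ac del: sum.atMost_Suc)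
    qed
    also have "(\<Sum>n\<le>N. \<Sum>j\<le>Suc N. h (n + 2) * even_part_weight \<eta> j n * \<tau> ^ j) 
       = (\<Sum>j\<le>Suc N. (\<Sum>n\<le>N. h (n + 2) * even_part_weight \<eta> j n) * \<tau> ^ j)"
      unfolding sum_distrib_right by (rule sum.swap)
    also have "\<dots> = (\<Sum>n\<le>N. h (n + 2)) + (\<Sum>j\<le>N. (\<Sum>n\<le>N. h (n + 2) * even_part_weight \<eta> (Suc j) n) * \<tau> ^ Suc j)"
      by (subst sum.atMost_Suc_shift) simp
    also have "\<dots> \<le> H2 + (\<Sum>j\<le>N. Q * \<tau> ^ Suc j)"
      using \<tau> by (intro add_mono sum_mono mult_right_mono Q H2_ge) auto
    also have "(\<Sum>j\<le>N. Q * \<tau> ^ Suc j) = Q * \<tau> * (\<Sum>j\<le>N. \<tau> ^ j)"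
      by (simp add: sum_distrib_left mult_ac)
    also have "\<dots> \<le> Q * \<tau> * (1 / (1 - \<tau>))"
    proof (intro mult_left_mono)
      have "(\<Sum>j\<le>N. \<tau> ^ j) \<le> (\<Sum>j. \<tau> ^ j)"
        using \<tau> by (intro sum_le_suminf summable_geometric) auto
      then show "(\<Sum>j\<le>N. \<tau> ^ j) \<le> 1 / (1 - \<tau>)"
        using \<tau> by (simp add: suminf_geometric)
    qed (use Q_nn \<tau> in auto)
    finally show ?thesis
      using \<tau> by simp
  qed
  have "(\<Sum>n. h n * T n) = m * T 1 + (\<Sum>n. h (n + 2) * T (n + 2))"
    using suminf_split_initial_segment[OF sum_T, of 2] h1 by (simp add: numeral_2_eq_2)
  also have "(\<Sum>n. h (n + 2) * T (n + 2)) \<le> 2 * (1 - \<tau>)\<^sup>2 * (H2 + Q * \<tau> / (1 - \<tau>))"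
  proof (rule suminf_le_const)
    show "summable (\<lambda>n. h (n + 2) * T (n + 2))"
      using sum_T by (subst summable_iff_shift[where f = "\<lambda>n. h n * T n"])
    show "(\<Sum>n<N. h (n + 2) * T (n + 2)) \<le> 2 * (1 - \<tau>)\<^sup>2 * (H2 + Q * \<tau> / (1 - \<tau>))" for N
    proof (cases N)
      case 0
      then show ?thesis
        using h_nn Q_nn \<tau> suminf_nonneg[OF sum_h2] by (simp add: H2_def)
    next
      case (Suc N')
      then show ?thesis
        using part[of N'] by (simp add: lessThan_Suc_atMost)
    qed
  qed
  also have "2 * (1 - \<tau>)\<^sup>2 * (H2 + Q * \<tau> / (1 - \<tau>)) = 2 * (1 - \<tau>) * ((1 - \<tau>) * H2 + Q * \<tau>)"
    using \<tau> by (simp add: field_simps power2_eq_square)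
  also have "\<dots> < 2 * (1 - \<tau>) * ((1 - \<tau>) * H2 + Q1 * \<tau>)"
    using \<tau> \<open>Q < Q1\<close> by simp
  also have "m * T 1 + 2 * (1 - \<tau>) * ((1 - \<tau>) * H2 + Q1 * \<tau>) = 2 * (1 - \<tau>) * (1 - \<eta>\<^sup>2 * \<tau>) * res_maj l m"
    unfolding T1 maj Q1_def by (simp add: algebra_simps power2_eq_square)
  finally show "(\<Sum>n. \<bar>res_coeff l n\<bar> * m ^ n * ((1 + s) ^ n * (1 - s) * (1 + \<eta> * s)\<^sup>2 * (1 - s) +
        (1 - s) ^ n * (1 + s) * (1 - \<eta> * s)\<^sup>2 * (1 + s))) < 2 * (1 - s\<^sup>2) * (1 - \<eta>\<^sup>2 * s\<^sup>2) * res_maj l m"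
    by (simp add: h_def T_def \<tau>_def)
qed

section \<open>Integer interval arithmetic for the coefficients\<close>

type_synonym interval = "int \<times> int"

text \<open>
  The real number \<open>x\<close> is enclosed by the interval after scaling by \<open>S\<close>. Products of enclosures have
  scale \<open>S * S\<close> and are rescaled by outward rounded integer division.
\<close>

definition encl :: "int \<Rightarrow> real \<Rightarrow> interval \<Rightarrow> bool" where
  "encl S x I \<longleftrightarrow> of_int (fst I) \<le> of_int S * x \<and> of_int S * x \<le> of_int (snd I)"

fun iv_add :: "interval \<Rightarrow> interval \<Rightarrow> interval" where
  "iv_add (a, b) (c, d) = (a + c, b + d)"

fun iv_mul :: "interval \<Rightarrow> interval \<Rightarrow> interval" where
  "iv_mul (a, b) (c, d) =
     (if 0 \<le> a then (if 0 \<le> c then (a * c, b * d) else if d \<le> 0 then (b * c, a * d) else (b * c, b * d))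
      else if b \<le> 0 then (if 0 \<le> c then (a * d, b * c) else if d \<le> 0 then (b * d, a * c) else (a * d, a * c))
      else (if 0 \<le> c then (a * d, b * d) else if d \<le> 0 then (b * c, a * c)
            else (min (a * d) (b * c), max (a * c) (b * d))))"

fun iv_neg_div :: "int \<Rightarrow> interval \<Rightarrow> interval" where
  "iv_neg_div d (a, b) = ((- b) div d, - (a div d))"

fun iv_div :: "int \<Rightarrow> interval \<Rightarrow> interval" where
  "iv_div d (a, b) = (a div d, - ((- b) div d))"

fun iv_dot :: "interval list \<Rightarrow> interval list \<Rightarrow> interval" where
  "iv_dot [] Js = (0, 0)"
| "iv_dot (I # Is) [] = (0, 0)"
| "iv_dot (I # Is) (J # Js) = iv_add (iv_mul I J) (iv_dot Is Js)"

lemma encl_add: "encl S x I \<Longrightarrow> encl S y J \<Longrightarrow> encl S (x + y) (iv_add I J)"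
  by (cases I; cases J) (auto simp: encl_def algebra_simps)

lemma mult_corner:
  fixes a b c d x y :: real
  assumes "a \<le> x" "x \<le> b" "c \<le> y" "y \<le> d"
  shows "0 \<le> a \<Longrightarrow> 0 \<le> c \<Longrightarrow> a * c \<le> x * y" "0 \<le> a \<Longrightarrow> 0 \<le> c \<Longrightarrow> x * y \<le> b * d"
    "0 \<le> a \<Longrightarrow> c \<le> 0 \<Longrightarrow> b * c \<le> x * y" "0 \<le> a \<Longrightarrow> d \<le> 0 \<Longrightarrow> x * y \<le> a * d" "0 \<le> a \<Longrightarrow> 0 \<le> d \<Longrightarrow> x * y \<le> b * d"
    "b \<le> 0 \<Longrightarrow> 0 \<le> d \<Longrightarrow> a * d \<le> x * y" "b \<le> 0 \<Longrightarrow> 0 \<le> c \<Longrightarrow> x * y \<le> b * c"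
    "b \<le> 0 \<Longrightarrow> d \<le> 0 \<Longrightarrow> b * d \<le> x * y" "b \<le> 0 \<Longrightarrow> c \<le> 0 \<Longrightarrow> x * y \<le> a * c"
    "a \<le> 0 \<Longrightarrow> 0 \<le> c \<Longrightarrow> a * d \<le> x * y" "0 \<le> b \<Longrightarrow> 0 \<le> c \<Longrightarrow> x * y \<le> b * d"
    "0 \<le> b \<Longrightarrow> d \<le> 0 \<Longrightarrow> b * c \<le> x * y" "a \<le> 0 \<Longrightarrow> d \<le> 0 \<Longrightarrow> x * y \<le> a * c"
    "a \<le> 0 \<Longrightarrow> 0 \<le> b \<Longrightarrow> c \<le> 0 \<Longrightarrow> 0 \<le> d \<Longrightarrow> min (a * d) (b * c) \<le> x * y"
    "a \<le> 0 \<Longrightarrow> 0 \<le> b \<Longrightarrow> c \<le> 0 \<Longrightarrow> 0 \<le> d \<Longrightarrow> x * y \<le> max (a * c) (b * d)"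
proof -
  have 1: "a * y + x * c - a * c \<le> x * y" "b * y + x * d - b * d \<le> x * y"
    "x * y \<le> a * y + x * d - a * d" "x * y \<le> b * y + x * c - b * c"
    using mult_nonneg_nonneg[of "x - a" "y - c"] mult_nonneg_nonneg[of "b - x" "d - y"]
      mult_nonneg_nonneg[of "x - a" "d - y"] mult_nonneg_nonneg[of "b - x" "y - c"] assms
    by (simp_all add: algebra_simps)
  have A: "0 \<le> a \<Longrightarrow> a * c \<le> a * y" "0 \<le> a \<Longrightarrow> a * y \<le> a * d" "a \<le> 0 \<Longrightarrow> a * d \<le> a * y" "a \<le> 0 \<Longrightarrow> a * y \<le> a * c"
    "0 \<le> b \<Longrightarrow> b * c \<le> b * y" "0 \<le> b \<Longrightarrow> b * y \<le> b * d" "b \<le> 0 \<Longrightarrow> b * d \<le> b * y" "b \<le> 0 \<Longrightarrow> b * y \<le> b * c"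
    "0 \<le> c \<Longrightarrow> a * c \<le> x * c" "0 \<le> c \<Longrightarrow> x * c \<le> b * c" "c \<le> 0 \<Longrightarrow> b * c \<le> x * c" "c \<le> 0 \<Longrightarrow> x * c \<le> a * c"
    "0 \<le> d \<Longrightarrow> a * d \<le> x * d" "0 \<le> d \<Longrightarrow> x * d \<le> b * d" "d \<le> 0 \<Longrightarrow> b * d \<le> x * d" "d \<le> 0 \<Longrightarrow> x * d \<le> a * d"
    using assms by (auto intro: mult_left_mono mult_right_mono mult_left_mono_neg mult_right_mono_neg)
  have bd: "a \<le> b" "c \<le> d"
    using assms by linarith+
  show "0 \<le> a \<Longrightarrow> 0 \<le> c \<Longrightarrow> a * c \<le> x * y" "0 \<le> a \<Longrightarrow> 0 \<le> c \<Longrightarrow> x * y \<le> b * d"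
    "0 \<le> a \<Longrightarrow> c \<le> 0 \<Longrightarrow> b * c \<le> x * y" "0 \<le> a \<Longrightarrow> d \<le> 0 \<Longrightarrow> x * y \<le> a * d" "0 \<le> a \<Longrightarrow> 0 \<le> d \<Longrightarrow> x * y \<le> b * d"
    "b \<le> 0 \<Longrightarrow> 0 \<le> d \<Longrightarrow> a * d \<le> x * y" "b \<le> 0 \<Longrightarrow> 0 \<le> c \<Longrightarrow> x * y \<le> b * c"
    "b \<le> 0 \<Longrightarrow> d \<le> 0 \<Longrightarrow> b * d \<le> x * y" "b \<le> 0 \<Longrightarrow> c \<le> 0 \<Longrightarrow> x * y \<le> a * c"
    "a \<le> 0 \<Longrightarrow> 0 \<le> c \<Longrightarrow> a * d \<le> x * y" "0 \<le> b \<Longrightarrow> 0 \<le> c \<Longrightarrow> x * y \<le> b * d"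
    "0 \<le> b \<Longrightarrow> d \<le> 0 \<Longrightarrow> b * c \<le> x * y" "a \<le> 0 \<Longrightarrow> d \<le> 0 \<Longrightarrow> x * y \<le> a * c"
    using 1 A bd by argo+
  show "a \<le> 0 \<Longrightarrow> 0 \<le> b \<Longrightarrow> c \<le> 0 \<Longrightarrow> 0 \<le> d \<Longrightarrow> min (a * d) (b * c) \<le> x * y"
    "a \<le> 0 \<Longrightarrow> 0 \<le> b \<Longrightarrow> c \<le> 0 \<Longrightarrow> 0 \<le> d \<Longrightarrow> x * y \<le> max (a * c) (b * d)"
    unfolding min_le_iff_disj le_max_iff_disj
    using 1 A assms
    by (cases "0 \<le> x"; smt (verit) mult_left_mono mult_right_mono mult_left_mono_neg)+
qed

lemma encl_mul:
  assumes "encl S x I" "encl T y J"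
  shows "encl (S * T) (x * y) (iv_mul I J)"
proof -
  obtain a b c d where I: "I = (a, b)" and J: "J = (c, d)"
    by (cases I, cases J)
  define X Y where "X = of_int S * x" and "Y = of_int T * y"
  have X: "of_int a \<le> X" "X \<le> of_int b" and Y: "of_int c \<le> Y" "Y \<le> of_int d"
    using assms by (simp_all add: encl_def I J X_def Y_def)
  note C = mult_corner[OF X Y, folded of_int_mult of_int_min of_int_max, unfolded of_int_0_le_iff of_int_le_0_iff]
  have "of_int (S * T) * (x * y) = X * Y"
    by (simp add: X_def Y_def)
  then show ?thesis
    unfolding encl_def I J using C by auto
qed

lemma encl_div:
  assumes "encl (S * d) x I" "0 < d"
  shows "encl S x (iv_div d I)"
proof -
  obtain a b where I: "I = (a, b)"
    by (cases I)
  have "of_int (a div d) \<le> of_int a / (of_int d :: real)" "of_int ((- b) div d) \<le> of_int (- b) / (of_int d :: real)"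
    by (rule real_of_int_div4)+
  moreover have "of_int a / of_int d \<le> of_int S * x" "of_int S * x \<le> of_int b / of_int d"
    using assms by (simp_all add: encl_def I field_simps)
  ultimately show ?thesis
    by (simp add: encl_def I)
qed

lemma encl_neg_div:
  assumes "encl (S * d) x I" "0 < d"
  shows "encl S (- x) (iv_neg_div d I)"
proof -
  obtain a b where I: "I = (a, b)"
    by (cases I)
  have "encl (S * d) (- x) (- b, - a)"
    using assms(1) by (simp add: encl_def I)
  from encl_div[OF this assms(2)] show ?thesis
    by (simp add: I)
qed

lemma encl_dot:
  "list_all2 (encl S) xs Is \<Longrightarrow> list_all2 (encl S) ys Js \<Longrightarrow>
    encl (S * S) (\<Sum>(x, y)\<leftarrow>zip xs ys. x * y) (iv_dot Is Js)"
proof (induction xs Is arbitrary: ys Js rule: list_all2_induct)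
  case (Cons x xs I Is)
  show ?case
  proof (cases ys)
    case Nil
    with Cons.prems show ?thesis
      by (simp add: encl_def)
  next
    case C: (Cons y ys')
    with Cons.prems obtain J Js' where J: "Js = J # Js'" "encl S y J" "list_all2 (encl S) ys' Js'"
      by (auto simp: list_all2_Cons1)
    then show ?thesis
      using Cons.IH[OF J(3)] Cons.hyps(1) by (simp add: C encl_add encl_mul)
  qed
qed (simp add: encl_def)

text \<open>
  One step of the quadratic recurrence for \<open>G\<^sub>n m\<^sup>n\<close>. The list holds the enclosures of the earlier
  coefficients with the latest one first, so the convolution is a scalar product with the reversed tail.
\<close>

fun next_coeff_iv :: "int \<Rightarrow> interval \<Rightarrow> interval \<Rightarrow> int \<Rightarrow> interval list \<Rightarrow> interval" where
  "next_coeff_iv S U C n [] = (0, 0)"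
| "next_coeff_iv S U C n (H # Hs) =
     iv_neg_div (S * n) (iv_add (iv_mul U H) (iv_mul C (iv_div S (iv_dot Hs (rev Hs)))))"

function coeff_ivs :: "int \<Rightarrow> interval \<Rightarrow> interval \<Rightarrow> int \<Rightarrow> int \<Rightarrow> interval list \<Rightarrow> interval list" where
  "coeff_ivs S U C n N Hs =
     (if n \<le> N then coeff_ivs S U C (n + 1) N (next_coeff_iv S U C n Hs # Hs) else Hs)"
  by pat_completeness auto
termination
  by (relation "Wellfounded.measure (\<lambda>(S, U, C, n, N, Hs). nat (N + 1 - n))") auto

declare coeff_ivs.simps [simp del]

definition scaled_coeffs :: "real \<Rightarrow> real \<Rightarrow> nat \<Rightarrow> real list" where
  "scaled_coeffs l m n = map (\<lambda>k. res_coeff l k * m ^ k) (rev [1..<Suc n])"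

lemma scaled_coeffs_Suc: "scaled_coeffs l m (Suc n) = res_coeff l (Suc n) * m ^ Suc n # scaled_coeffs l m n"
  by (simp add: scaled_coeffs_def)

lemma next_coeff_iv_correct:
  assumes S: "0 < S" and U: "encl S ((1 - 2 * l) * m) U" and C: "encl S (l * (1 - l) * m) C"
    and Hs: "list_all2 (encl S) (scaled_coeffs l m (Suc n)) Hs"
  shows "encl S (res_coeff l (Suc (Suc n)) * m ^ Suc (Suc n)) (next_coeff_iv S U C (int n + 2) Hs)"
proof -
  define h where "h k = res_coeff l k * m ^ k" for k
  obtain H Hs' where H: "Hs = H # Hs'" "encl S (h (Suc n)) H" "list_all2 (encl S) (scaled_coeffs l m n) Hs'"
    using Hs by (auto simp: scaled_coeffs_Suc list_all2_Cons1 h_def)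
  have "(\<Sum>(x, y)\<leftarrow>zip (scaled_coeffs l m n) (rev (scaled_coeffs l m n)). x * y) = (\<Sum>i<n. h (n - i) * h (Suc i))"
  proof -
    have 1: "scaled_coeffs l m n = map (\<lambda>i. h (n - i)) [0..<n]"
      by (rule nth_equalityI) (auto simp: scaled_coeffs_def rev_nth h_def Suc_diff_Suc simp del: upt_Suc simp flip: power_Suc)
    have 2: "rev (scaled_coeffs l m n) = map (\<lambda>i. h (Suc i)) [0..<n]"
      by (rule nth_equalityI) (auto simp: scaled_coeffs_def rev_map h_def simp del: upt_Suc)
    have "(\<Sum>(x, y)\<leftarrow>zip (scaled_coeffs l m n) (rev (scaled_coeffs l m n)). x * y) = (\<Sum>i\<leftarrow>[0..<n]. h (n - i) * h (Suc i))"
      unfolding 2 unfolding 1 by (simp add: zip_map_map zip_same_conv_map o_def)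
    then show ?thesis
      by (simp add: interv_sum_list_conv_sum_set_nat atLeast0LessThan)
  qed
  also have "\<dots> = m ^ Suc n * (\<Sum>i\<le>Suc n. res_coeff l i * res_coeff l (Suc n - i))"
  proof -
    have "(\<Sum>i\<le>Suc n. res_coeff l i * res_coeff l (Suc n - i)) = (\<Sum>i\<le>n. res_coeff l (Suc i) * res_coeff l (n - i))"
      by (subst sum.atMost_Suc_shift) simp
    also have "\<dots> = (\<Sum>i<n. res_coeff l (Suc i) * res_coeff l (n - i))"
      by (simp add: lessThan_Suc_atMost[symmetric])
    finally have e: "(\<Sum>i\<le>Suc n. res_coeff l i * res_coeff l (Suc n - i)) = (\<Sum>i<n. res_coeff l (Suc i) * res_coeff l (n - i))" .
    show ?thesis
      unfolding e unfolding sum_distrib_left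
    proof (intro sum.cong refl)
      fix i assume "i \<in> {..<n}"
      then have e2: "m ^ Suc n = m ^ (n - i) * m ^ Suc i"
        by (simp add: power_add[symmetric])
      show "h (n - i) * h (Suc i) = m ^ Suc n * (res_coeff l (Suc i) * res_coeff l (n - i))"
        unfolding h_def e2 by (simp only: mult_ac)
    qed
  qed
  finally have conv: "encl (S * S) (m ^ Suc n * (\<Sum>i\<le>Suc n. res_coeff l i * res_coeff l (Suc n - i))) (iv_dot Hs' (rev Hs'))"
    using encl_dot[OF H(3) list_all2_rev[THEN iffD2, OF H(3)]] by simp
  define y where "y = (1 - 2 * l) * m * h (Suc n) + l * (1 - l) * m * (m ^ Suc n * (\<Sum>i\<le>Suc n. res_coeff l i * res_coeff l (Suc n - i)))"
  have "encl (S * S) y (iv_add (iv_mul U H) (iv_mul C (iv_div S (iv_dot Hs' (rev Hs')))))"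
    unfolding y_def by (intro encl_add encl_mul encl_div U C H conv S)
  moreover have "y = - (real (Suc (Suc n)) * h (Suc (Suc n)))"
  proof -
    define g G Q where "g = res_coeff l (Suc n)" and "G = real (Suc (Suc n)) * res_coeff l (Suc (Suc n))"
      and "Q = (\<Sum>i\<le>Suc n. res_coeff l i * res_coeff l (Suc n - i))"
    have G: "G = - ((1 - 2 * l) * g) - l * (1 - l) * Q"
      using res_coeff_Suc[of "Suc n" l] by (simp add: G_def g_def Q_def)
    have "y = m ^ Suc (Suc n) * ((1 - 2 * l) * g + l * (1 - l) * Q)"
      by (simp add: y_def h_def g_def[symmetric] Q_def[symmetric] algebra_simps del: sum.atMost_Suc)
    also have "\<dots> = - (m ^ Suc (Suc n) * G)"
      unfolding G by (simp add: algebra_simps)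
    finally show ?thesis
      by (simp add: G_def h_def mult_ac)
  qed
  ultimately have "encl (S * (S * (int n + 2))) (- h (Suc (Suc n))) (iv_add (iv_mul U H) (iv_mul C (iv_div S (iv_dot Hs' (rev Hs')))))"
    by (simp add: encl_def algebra_simps)
  from encl_neg_div[OF this] S show ?thesis
    by (simp add: H(1) h_def)
qed

text \<open>
  One run of the recurrence serves all \<open>l\<close> and \<open>m\<close> that lie in the intervals behind \<open>U\<close> and \<open>C\<close>.
\<close>

lemma coeff_ivs_correct:
  assumes S: "0 < S" and U: "encl S ((1 - 2 * l) * m) U" and C: "encl S (l * (1 - l) * m) C"
  shows "list_all2 (encl S) (scaled_coeffs l m (Suc n)) Hs \<Longrightarrow>
    list_all2 (encl S) (scaled_coeffs l m (Suc n + k)) (coeff_ivs S U C (int n + 2) (int (Suc n + k)) Hs)"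
proof (induction k arbitrary: n Hs)
  case 0
  then show ?case
    by (subst coeff_ivs.simps) simp
next
  case (Suc k)
  have "list_all2 (encl S) (scaled_coeffs l m (Suc (Suc n))) (next_coeff_iv S U C (int n + 2) Hs # Hs)"
    using Suc.prems next_coeff_iv_correct[OF S U C Suc.prems] by (simp only: scaled_coeffs_Suc list_all2_Cons)
  from Suc.IH[OF this] show ?case
    by (subst coeff_ivs.simps) (simp add: add_ac)
qed

section \<open>Monotonicity in the parameter\<close>

definition res_beta :: "real \<Rightarrow> real \<Rightarrow> real" where
  "res_beta l m = sqrt (l * (1 - l)) * res_maj l m"

text \<open>
  Up to the factor \<open>- 2 m\<close>, the derivative of the \<open>n\<close>-th term of the majorant without absolute value
  in the angle \<open>t\<close> introduced next.
\<close>

definition slope_term :: "real \<Rightarrow> real \<Rightarrow> nat \<Rightarrow> real" where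
  "slope_term m l n = (1 - 2 * l) * m * (res_coeff l n * m ^ n) + 2 * real (Suc n) * (res_coeff l (Suc n) * m ^ Suc n)"

text \<open>
  The substitution \<open>l = (1 - cos t) / 2\<close> turns the factor \<open>sqrt (l (1 - l))\<close> into \<open>sin t / 2\<close>; in
  this coordinate the derivatives of the terms are linear in the coefficients.
\<close>

definition half_cos :: "real \<Rightarrow> real" where
  "half_cos t = (1 - cos t) / 2"

definition trig_term :: "real \<Rightarrow> nat \<Rightarrow> real \<Rightarrow> real" where
  "trig_term m n t = sin t / 2 * (res_coeff (half_cos t) n * m ^ n)"

lemma half_cos_mult: "half_cos t * (1 - half_cos t) = (sin t / 2)\<^sup>2"
proof -
  have "half_cos t * (1 - half_cos t) = (1 - (cos t)\<^sup>2) / 4"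
    by (simp add: half_cos_def power2_eq_square field_simps)
  then show ?thesis
    by (simp add: sin_squared_eq power_divide)
qed

lemma trig_term_has_derivative:
  assumes "n \<ge> 1" "m > 0"
  shows "(trig_term m n has_real_derivative - slope_term m (half_cos t) n / (2 * m)) (at t)"
proof -
  define F where "F = fps_nth ((resolvent_fps (half_cos t))\<^sup>2) n"
  have h: "(half_cos has_real_derivative sin t / 2) (at t)"
    unfolding half_cos_def by (auto intro!: derivative_eq_intros)
  have r: "((\<lambda>t. res_coeff (half_cos t) n) has_real_derivative F * (sin t / 2)) (at t)"
    unfolding F_def by (rule DERIV_chain2[OF has_real_derivative_res_coeff h])
  have "(trig_term m n has_real_derivative (cos t / 2 * (res_coeff (half_cos t) n * m ^ n) + F * (sin t / 2) * m ^ n * (sin t / 2))) (at t)"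
    unfolding trig_term_def by (auto intro!: derivative_eq_intros r)
  also have "F * (sin t / 2) * m ^ n * (sin t / 2) = (half_cos t * (1 - half_cos t) * F) * m ^ n"
    unfolding half_cos_mult by (simp add: power2_eq_square)
  also have "half_cos t * (1 - half_cos t) * F = - (1 - 2 * half_cos t) * res_coeff (half_cos t) n - real (Suc n) * res_coeff (half_cos t) (Suc n)"
    unfolding F_def by (rule res_coeff_deriv_eq[OF assms(1)])
  also have "cos t = 1 - 2 * half_cos t"
    by (simp add: half_cos_def field_simps)
  also have "(1 - 2 * half_cos t) / 2 * (res_coeff (half_cos t) n * m ^ n) + (- (1 - 2 * half_cos t) * res_coeff (half_cos t) n - real (Suc n) * res_coeff (half_cos t) (Suc n)) * m ^ n
     = - slope_term m (half_cos t) n / (2 * m)"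
    using assms(2) by (simp add: slope_term_def field_simps)
  finally show ?thesis .
qed

lemma half_cos_mono: "0 \<le> s \<Longrightarrow> s \<le> t \<Longrightarrow> t \<le> pi \<Longrightarrow> half_cos s \<le> half_cos t"
  unfolding half_cos_def using cos_monotone_0_pi_le[of s t] by simp

text \<open>
  A lower bound \<open>w\<close> for the derivative of \<open>\<sigma>\<close> times the absolute value of the \<open>n\<close>-th term, up to a
  positive factor. The third case serves coefficients whose sign changes in \<open>J\<close>: the absolute value is
  Lipschitz.
\<close>

definition slope_bound :: "real \<Rightarrow> real set \<Rightarrow> real \<Rightarrow> nat \<Rightarrow> real \<Rightarrow> bool" where
  "slope_bound m J \<sigma> n w \<longleftrightarrow>
     (\<forall>l\<in>J. 0 \<le> res_coeff l n \<and> w \<le> - \<sigma> * slope_term m l n) \<or>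
     (\<forall>l\<in>J. res_coeff l n \<le> 0 \<and> w \<le> \<sigma> * slope_term m l n) \<or>
     (\<forall>l\<in>J. w \<le> - \<bar>slope_term m l n\<bar>)"

lemma trig_term_increment:
  assumes n: "n \<ge> 1" and m: "m > 0" and \<sigma>: "\<sigma> = 1 \<or> \<sigma> = -1"
    and t: "0 \<le> s" "s \<le> t" "t \<le> pi" and J: "{half_cos s..half_cos t} \<subseteq> J"
    and w: "slope_bound m J \<sigma> n w"
  shows "w / (2 * m) * (t - s) \<le> \<sigma> * (\<bar>trig_term m n t\<bar> - \<bar>trig_term m n s\<bar>)"
proof -
  have J': "half_cos r \<in> J" if "s \<le> r" "r \<le> t" for r
    using that t J half_cos_mono[of s r] half_cos_mono[of r t] by auto
  have lin: "w / (2 * m) * (t - s) \<le> \<rho> * trig_term m n t - \<rho> * trig_term m n s"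
    if "\<And>l. l \<in> J \<Longrightarrow> w \<le> - \<rho> * slope_term m l n" for \<rho>
  proof -
    define f where "f r = \<rho> * trig_term m n r - w / (2 * m) * r" for r
    have "f s \<le> f t"
    proof (rule DERIV_nonneg_imp_nondecreasing[OF t(2)])
      fix r assume r: "s \<le> r" "r \<le> t"
      have "(f has_real_derivative \<rho> * (- slope_term m (half_cos r) n / (2 * m)) - w / (2 * m)) (at r)"
        unfolding f_def using m by (auto intro!: derivative_eq_intros trig_term_has_derivative n)
      moreover have "\<rho> * (- slope_term m (half_cos r) n / (2 * m)) - w / (2 * m) = (- \<rho> * slope_term m (half_cos r) n - w) / (2 * m)"
        using m by (simp add: field_simps)
      moreover have "\<dots> \<ge> 0"
        using that[OF J'[OF r]] m by simp
      ultimately show "\<exists>d. (f has_real_derivative d) (at r) \<and> 0 \<le> d"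
        by metis
    qed
    then show ?thesis
      by (simp add: f_def algebra_simps diff_divide_distrib)
  qed
  have sn: "0 \<le> sin s / 2" "0 \<le> sin t / 2"
    using t by (auto intro: sin_ge_zero)
  have ends: "half_cos s \<in> J" "half_cos t \<in> J"
    using J' t by auto
  from w consider 
      (pos) "\<forall>l\<in>J. 0 \<le> res_coeff l n \<and> w \<le> - \<sigma> * slope_term m l n" 
    | (neg) "\<forall>l\<in>J. res_coeff l n \<le> 0 \<and> w \<le> \<sigma> * slope_term m l n"
    | (any) "\<forall>l\<in>J. w \<le> - \<bar>slope_term m l n\<bar>"
    unfolding slope_bound_def by blast
  then show ?thesis
  proof cases
    case pos
    then have "\<bar>trig_term m n t\<bar> = trig_term m n t" "\<bar>trig_term m n s\<bar> = trig_term m n s"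
      unfolding trig_term_def using ends sn m by (auto intro!: abs_of_nonneg mult_nonneg_nonneg)
    with lin[of \<sigma>] pos show ?thesis
      by (simp add: right_diff_distrib)
  next
    case neg
    then have a: "res_coeff (half_cos s) n * m ^ n \<le> 0" "res_coeff (half_cos t) n * m ^ n \<le> 0"
      using ends m by (simp_all add: mult_nonpos_nonneg)
    have "trig_term m n s \<le> 0" "trig_term m n t \<le> 0"
      unfolding trig_term_def using mult_nonneg_nonpos[OF sn(1) a(1)] mult_nonneg_nonpos[OF sn(2) a(2)] .
    then have "\<bar>trig_term m n t\<bar> = - trig_term m n t" "\<bar>trig_term m n s\<bar> = - trig_term m n s"
      by (auto intro: abs_of_nonpos)
    with lin[of "- \<sigma>"] neg show ?thesis
      by (simp add: right_diff_distrib)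
  next
    case any
    have both: "w \<le> - \<rho> * slope_term m l n" if "l \<in> J" "\<rho> = 1 \<or> \<rho> = -1" for \<rho> l
      using any that by fastforce
    then have "w / (2 * m) * (t - s) \<le> trig_term m n t - trig_term m n s" "w / (2 * m) * (t - s) \<le> - trig_term m n t + trig_term m n s"
      using lin[OF both, of 1] lin[OF both, of "-1"] by simp_all
    then show ?thesis
      using \<sigma> by (auto simp: abs_if)
  qed
qed

lemma sum_arith_geometric_le:
  fixes q :: real
  assumes q: "0 \<le> q" "q < 1"
  shows "(\<Sum>a=Suc N..N+k. real (Suc a) * q ^ (a - 1)) \<le> q ^ N * ((real N + 2) / (1 - q) + q / (1 - q)\<^sup>2)"
proof -
  define R where "R N = q ^ N * ((real N + 2) / (1 - q) + q / (1 - q)\<^sup>2)" for N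
  have step: "R N = real (Suc (Suc N)) * q ^ N + R (Suc N)" for N
  proof -
    define d where "d = 1 - q"
    have d: "d \<noteq> 0" and qd: "q = 1 - d"
      using q by (auto simp: d_def)
    have "(real N + 2) / d + q / d\<^sup>2 = (real N + 2) + q * ((real N + 3) / d + q / d\<^sup>2)"
      using d unfolding qd by (simp add: divide_simps power2_eq_square) (simp add: algebra_simps)
    then show ?thesis
      by (simp add: R_def d_def[symmetric] algebra_simps)
  qed
  have nn: "0 \<le> R N" for N
    using q by (auto simp: R_def)
  have "(\<Sum>a=Suc N..N+k. real (Suc a) * q ^ (a - 1)) + R (N + k) = R N"
  proof (induction k)
    case (Suc k)
    have "(\<Sum>a=Suc N..N+Suc k. real (Suc a) * q ^ (a - 1)) + R (N + Suc k) = 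
      (\<Sum>a=Suc N..N+k. real (Suc a) * q ^ (a - 1)) + (real (Suc (Suc (N + k))) * q ^ (N + k) + R (Suc (N + k)))"
      by simp
    also have "\<dots> = R N"
      unfolding step[symmetric] by (rule Suc)
    finally show ?case .
  qed simp
  with nn[of "N + k"] show ?thesis
    by (simp add: R_def)
qed

lemma scaled_coeff_tail:
  fixes l m c :: real
  assumes l: "0 < l" "l < 1" and c: "0 < c" "c \<le> l * (1 - l)" and m: "0 < m" "m \<le> 29/20" and mq: "50 * m / 157 \<le> 577/1250"
  shows "\<bar>res_coeff l (Suc n)\<bar> * m ^ Suc n \<le> 13/50 * m / c * (577/1250) ^ n"
proof -
  have lc: "0 < l * (1 - l)"
    using l by simp
  have "c * \<bar>res_coeff l (Suc n)\<bar> \<le> l * (1 - l) * \<bar>res_coeff l (Suc n)\<bar>"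
    using c by (intro mult_right_mono) auto
  also have "\<dots> \<le> 13/50 * (50/157) ^ n"
    using l by (intro res_coeff_Suc_bound) auto
  finally have "\<bar>res_coeff l (Suc n)\<bar> \<le> 13/50 * (50/157) ^ n / c"
    using c by (simp add: pos_le_divide_eq mult_ac)
  then have "\<bar>res_coeff l (Suc n)\<bar> * m ^ Suc n \<le> 13/50 * (50/157) ^ n / c * m ^ Suc n"
    using m by (intro mult_right_mono) auto
  also have "\<dots> = 13/50 * m / c * (50 * m / 157) ^ n"
    by (simp add: power_divide power_mult_distrib field_simps)
  also have "\<dots> \<le> 13/50 * m / c * (577/1250) ^ n"
    using m c mq by (intro mult_left_mono power_mono) auto
  finally show ?thesis .
qed

text \<open>
  The constant is \<open>0.26 * 1.45 * 1.1\<close>; the factor 1.1 absorbs the term without the factor \<open>n + 1\<close>, which is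
  possible from \<open>n = 9\<close> on.
\<close>

lemma slope_term_tail:
  fixes l m c :: real
  assumes l: "0 < l" "l \<le> 1/2" and c: "0 < c" "c \<le> l * (1 - l)" and m: "0 < m" "m \<le> 29/20" and mq: "50 * m / 157 \<le> 577/1250"
    and n: "n \<ge> 9"
  shows "\<bar>slope_term m l n\<bar> \<le> 4147/10000 / c * (real (Suc n) * (577/1250) ^ (n - 1))"
proof -
  define q :: real where "q = 577/1250"
  obtain k where k: "n = Suc k"
    using n by (cases n) auto
  have b1: "\<bar>res_coeff l n * m ^ n\<bar> \<le> 13/50 * m / c * q ^ k"
    using scaled_coeff_tail[of l c m k] assms m by (simp add: k abs_mult q_def)
  have b2: "\<bar>res_coeff l (Suc n) * m ^ Suc n\<bar> \<le> 13/50 * m / c * (q * q ^ k)"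
    using scaled_coeff_tail[of l c m n] assms m by (simp add: k abs_mult q_def)
  have "\<bar>slope_term m l n\<bar> \<le> \<bar>(1 - 2 * l) * m * (res_coeff l n * m ^ n)\<bar> + \<bar>2 * real (Suc n) * (res_coeff l (Suc n) * m ^ Suc n)\<bar>"
    unfolding slope_term_def by (rule abs_triangle_ineq)
  also have "\<dots> = (1 - 2 * l) * m * \<bar>res_coeff l n * m ^ n\<bar> + 2 * real (Suc n) * \<bar>res_coeff l (Suc n) * m ^ Suc n\<bar>"
    using l m by (simp add: abs_mult)
  also have "\<dots> \<le> 1 * (29/20) * (13/50 * m / c * q ^ k) + 2 * real (Suc n) * (13/50 * m / c * (q * q ^ k))"
    using l m c by (intro add_mono mult_mono b1 b2) (auto simp: q_def)
  also have "\<dots> = 13/50 * m * (29/20 + 2 * q * real (Suc n)) * (q ^ k / c)"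
    using c by (simp add: field_simps)
  also have "\<dots> \<le> 13/50 * (29/20) * (11/10 * real (Suc n)) * (q ^ k / c)"
  proof (intro mult_right_mono mult_mono)
    have "9 \<le> real n"
      using n by simp
    moreover have "11/10 * real (Suc n) - (29/20 + 2 * q * real (Suc n)) = 221/1250 * real n - 3183/2500"
      by (simp add: q_def field_simps)
    ultimately show "29/20 + 2 * q * real (Suc n) \<le> 11/10 * real (Suc n)"
      by linarith
  qed (use m c in \<open>auto simp: q_def\<close>)
  also have "\<dots> = 4147/10000 / c * (real (Suc n) * q ^ k)"
    using c by (simp add: field_simps)
  finally show ?thesis
    by (simp add: k q_def)
qed

lemma res_beta_half_cos:
  assumes "0 \<le> t" "t \<le> pi"
  shows "res_beta (half_cos t) m = sin t / 2 * res_maj (half_cos t) m"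
  using assms sin_ge_zero[of t] by (simp add: res_beta_def half_cos_mult)

text \<open>
  Summation of the termwise increments, computed bounds for \<open>n \<le> N\<close> and the tail estimate beyond.
  The rational function of \<open>N\<close> is an upper bound for
  \<open>0.4147 ((N + 2) / (1 - q) + q / (1 - q)\<^sup>2)\<close> with \<open>q = 577/1250\<close>.
\<close>

lemma res_beta_increment:
  fixes \<sigma> m c W :: real and w :: "nat \<Rightarrow> real"
  assumes \<sigma>: "\<sigma> = 1 \<or> \<sigma> = -1" and m: "0 < m" "m \<le> 29/20" and mq: "50 * m / 157 \<le> 577/1250"
    and t: "0 \<le> s" "s \<le> t" "t \<le> pi" and J: "{half_cos s..half_cos t} \<subseteq> J"
    and Jb: "\<And>l. l \<in> J \<Longrightarrow> 0 < l \<and> l \<le> 1/2 \<and> c \<le> l * (1 - l)" and c: "0 < c"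
    and N: "8 \<le> N" and w: "\<And>n. n \<in> {1..N} \<Longrightarrow> slope_bound m J \<sigma> n (w n)"
    and W: "W \<le> (\<Sum>n=1..N. w n) - (577/1250) ^ N * (7703 * N + 22010) / 10000 / c"
  shows "W / (2 * m) * (t - s) \<le> \<sigma> * (res_beta (half_cos t) m - res_beta (half_cos s) m)"
proof -
  define q :: real where "q = 577/1250"
  define v where "v n = (if n \<le> N then w n else - (4147/10000 / c * (real (Suc n) * q ^ (n - 1))))" for n
  have v: "slope_bound m J \<sigma> n (v n)" if "1 \<le> n" for n
  proof (cases "n \<le> N")
    case True
    with that w show ?thesis
      by (simp add: v_def)
  next
    case False
    then have "\<forall>l\<in>J. v n \<le> - \<bar>slope_term m l n\<bar>"
      using slope_term_tail[of _ c m n] Jb c m mq N by (auto simp: v_def q_def)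
    then show ?thesis
      unfolding slope_bound_def by blast
  qed
  have Vsum: "W \<le> (\<Sum>n=1..N+k. v n)" for k
  proof -
    have "(\<Sum>n=1..N+k. v n) = (\<Sum>n=1..N. v n) + (\<Sum>n=Suc N..N+k. v n)"
      using sum.ub_add_nat[of 1 N v k] by simp
    also have "(\<Sum>n=1..N. v n) = (\<Sum>n=1..N. w n)"
      by (rule sum.cong) (auto simp: v_def)
    also have "(\<Sum>n=Suc N..N+k. v n) = - (4147/10000 / c * (\<Sum>n=Suc N..N+k. real (Suc n) * q ^ (n - 1)))"
      unfolding sum_distrib_left sum_negf[symmetric] by (rule sum.cong) (auto simp: v_def)
    finally have e: "(\<Sum>n=1..N+k. v n) = (\<Sum>n=1..N. w n) - 4147/10000 / c * (\<Sum>n=Suc N..N+k. real (Suc n) * q ^ (n - 1))"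
      by simp
    have "4147/10000 / c * (\<Sum>n=Suc N..N+k. real (Suc n) * q ^ (n - 1)) \<le> 4147/10000 / c * (q ^ N * ((real N + 2) / (1 - q) + q / (1 - q)\<^sup>2))"
      using c by (intro mult_left_mono sum_arith_geometric_le) (auto simp: q_def)
    also have "\<dots> = q ^ N * (4147/10000 * ((real N + 2) / (1 - q) + q / (1 - q)\<^sup>2)) / c"
      using c by (simp add: field_simps)
    also have "\<dots> \<le> q ^ N * ((7703 * N + 22010) / 10000) / c"
    proof (intro divide_right_mono mult_left_mono)
      have "(real N + 2) / (1 - q) = 1250/673 * real N + 2500/673" "q / (1 - q)\<^sup>2 = 721250/452929"
        by (simp_all add: q_def power2_eq_square)
      then have "(7703 * N + 22010) / 10000 - 4147/10000 * ((real N + 2) / (1 - q) + q / (1 - q)\<^sup>2)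
          = (7703 * N + 22010) / 10000 - 4147/10000 * (1250/673 * real N + 2500/673 + 721250/452929)"
        by (simp only:)
      also have "\<dots> = 369/6730000 * real N + 616040/4529290000"
        by (simp add: field_simps)
      finally have "(7703 * N + 22010) / 10000 - 4147/10000 * ((real N + 2) / (1 - q) + q / (1 - q)\<^sup>2) = 369/6730000 * real N + 616040/4529290000" .
      moreover have "0 \<le> 369/6730000 * real N + 616040/4529290000"
        by simp
      ultimately show "4147/10000 * ((real N + 2) / (1 - q) + q / (1 - q)\<^sup>2) \<le> (7703 * N + 22010) / 10000"
        by linarith
    qed (use c in \<open>auto simp: q_def\<close>)
    finally show ?thesis
      using W unfolding e by (simp add: q_def)
  qed
  have nn: "0 \<le> half_cos s" "half_cos s \<in> J" "half_cos t \<in> J"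
    using J half_cos_mono[OF t] t by (auto simp: half_cos_def)
  have conv: "(\<lambda>n. \<bar>trig_term m n r\<bar>) sums res_beta (half_cos r) m" if "0 \<le> r" "r \<le> pi" "half_cos r \<in> J" for r
  proof -
    have "summable (\<lambda>n. \<bar>res_coeff (half_cos r) n\<bar> * m ^ n)"
      using Jb[OF that(3)] m by (intro summable_res_maj) auto
    then have "(\<lambda>n. \<bar>res_coeff (half_cos r) n\<bar> * m ^ n) sums res_maj (half_cos r) m"
      unfolding res_maj_def by (rule summable_sums)
    then have "(\<lambda>n. sin r / 2 * (\<bar>res_coeff (half_cos r) n\<bar> * m ^ n)) sums (sin r / 2 * res_maj (half_cos r) m)"
      by (rule sums_mult)
    moreover have "\<bar>trig_term m n r\<bar> = sin r / 2 * (\<bar>res_coeff (half_cos r) n\<bar> * m ^ n)" for n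
      using m sin_ge_zero[OF that(1,2)] by (simp add: trig_term_def abs_mult)
    ultimately show ?thesis
      unfolding res_beta_half_cos[OF that(1,2)] by (simp only:)
  qed
  have lim: "(\<lambda>n. \<sigma> * (\<bar>trig_term m n t\<bar> - \<bar>trig_term m n s\<bar>)) sums (\<sigma> * (res_beta (half_cos t) m - res_beta (half_cos s) m))"
    using t nn by (intro sums_mult sums_diff conv) auto
  show ?thesis
  proof (rule LIMSEQ_le_const[OF lim[unfolded sums_def_le]], intro exI allI impI)
    fix n assume "N \<le> n"
    then obtain k where k: "n = N + k"
      using le_Suc_ex by blast
    have "W / (2 * m) * (t - s) \<le> (\<Sum>n=1..N+k. v n) / (2 * m) * (t - s)"
      using Vsum[of k] m t by (intro mult_right_mono divide_right_mono) auto
    also have "\<dots> = (\<Sum>n=1..N+k. v n / (2 * m) * (t - s))"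
      by (simp add: sum_divide_distrib sum_distrib_right)
    also have "\<dots> \<le> (\<Sum>n=1..N+k. \<sigma> * (\<bar>trig_term m n t\<bar> - \<bar>trig_term m n s\<bar>))"
      using v by (intro sum_mono trig_term_increment[OF _ m(1) \<sigma> t J]) auto
    also have "\<dots> = (\<Sum>n\<le>N+k. \<sigma> * (\<bar>trig_term m n t\<bar> - \<bar>trig_term m n s\<bar>))"
    proof -
      have "{..N+k} = insert 0 {1..N+k}"
        by auto
      then show ?thesis
        by (simp add: trig_term_def)
    qed
    finally show "W / (2 * m) * (t - s) \<le> (\<Sum>n\<le>n. \<sigma> * (\<bar>trig_term m n t\<bar> - \<bar>trig_term m n s\<bar>))"
      by (simp add: k)
  qed
qed

text \<open>
  Parameters are multiples of \<open>10\<^sup>-\<^sup>7\<close> and radii multiples of \<open>10\<^sup>-\<^sup>9\<close>. The first two intervals enclose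
  \<open>(1 - 2 l) m\<close> and \<open>l (1 - l) m\<close> for \<open>l\<close> between \<open>L1\<close> and \<open>L2\<close> and \<open>m\<close> between \<open>A\<close> and \<open>B\<close> in these units.
\<close>

definition cell_coeffs :: "int \<Rightarrow> int \<Rightarrow> int \<Rightarrow> int \<Rightarrow> int \<Rightarrow> int \<Rightarrow> interval list" where
  "cell_coeffs S A B L1 L2 n = coeff_ivs S
     (iv_div (10 ^ 16) (S * (10 ^ 7 - 2 * L2) * A, S * (10 ^ 7 - 2 * L1) * B))
     (iv_div (10 ^ 23) (S * L1 * (10 ^ 7 - L1) * A, S * L2 * (10 ^ 7 - L2) * B))
     2 n [iv_div (10 ^ 9) (S * A, S * B)]"

definition cell :: "int \<Rightarrow> int \<Rightarrow> real set" where
  "cell L1 L2 = {real_of_int L1 / 10 ^ 7..real_of_int L2 / 10 ^ 7}"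

definition radii :: "int \<Rightarrow> int \<Rightarrow> real set" where
  "radii A B = {real_of_int A / 10 ^ 9..real_of_int B / 10 ^ 9}"

lemma logistic_mono:
  fixes x y :: real
  assumes "x \<le> y" "y \<le> 1/2"
  shows "x * (1 - x) \<le> y * (1 - y)"
  using mult_nonneg_nonneg[of "y - x" "1 - x - y"] assms by (simp add: algebra_simps)

lemma cell_encl:
  assumes S: "0 < S" and L: "0 < L1" "L2 \<le> 5000000" and A: "0 < A"
    and l: "l \<in> cell L1 L2" and m: "m \<in> radii A B"
  shows "encl S ((1 - 2 * l) * m) (iv_div (10 ^ 16) (S * (10 ^ 7 - 2 * L2) * A, S * (10 ^ 7 - 2 * L1) * B))"
    and "encl S (l * (1 - l) * m) (iv_div (10 ^ 23) (S * L1 * (10 ^ 7 - L1) * A, S * L2 * (10 ^ 7 - L2) * B))"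
    and "encl S m (iv_div (10 ^ 9) (S * A, S * B))"
    and "real_of_int L1 / 10 ^ 7 * (1 - real_of_int L1 / 10 ^ 7) \<le> l * (1 - l)"
    and "0 < l" "l \<le> 1/2" "0 < m"
proof -
  define x1 x2 a b s where "x1 = real_of_int L1 / 10 ^ 7" and "x2 = real_of_int L2 / 10 ^ 7"
    and "a = real_of_int A / 10 ^ 9" and "b = real_of_int B / 10 ^ 9" and "s = real_of_int S"
  have e: "real_of_int L1 = 10 ^ 7 * x1" "real_of_int L2 = 10 ^ 7 * x2" "real_of_int A = 10 ^ 9 * a" "real_of_int B = 10 ^ 9 * b"
    by (simp_all add: x1_def x2_def a_def b_def)
  have x: "0 < x1" "x1 \<le> l" "l \<le> x2" "x2 \<le> 1/2" "0 < a" "a \<le> m" "m \<le> b" "0 < s"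
    using L l m A S by (simp_all add: x1_def x2_def a_def b_def s_def cell_def radii_def)
  have c: "x1 * (1 - x1) \<le> l * (1 - l)" "l * (1 - l) \<le> x2 * (1 - x2)"
    using x by (auto intro!: logistic_mono)
  then show "real_of_int L1 / 10 ^ 7 * (1 - real_of_int L1 / 10 ^ 7) \<le> l * (1 - l)"
    by (simp add: x1_def)
  show "0 < l" "l \<le> 1/2" "0 < m"
    using x by auto
  have "encl (S * 10 ^ 16) ((1 - 2 * l) * m) (S * (10 ^ 7 - 2 * L2) * A, S * (10 ^ 7 - 2 * L1) * B)"
  proof -
    have "s * 10 ^ 16 * ((1 - 2 * x2) * a) \<le> s * 10 ^ 16 * ((1 - 2 * l) * m)"
      using x by (intro mult_left_mono mult_mono) auto
    moreover have "s * 10 ^ 16 * ((1 - 2 * l) * m) \<le> s * 10 ^ 16 * ((1 - 2 * x1) * b)"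
      using x by (intro mult_left_mono mult_mono) auto
    ultimately show ?thesis
      by (simp add: encl_def e s_def algebra_simps)
  qed
  then show "encl S ((1 - 2 * l) * m) (iv_div (10 ^ 16) (S * (10 ^ 7 - 2 * L2) * A, S * (10 ^ 7 - 2 * L1) * B))"
    by (rule encl_div) simp
  have "encl (S * 10 ^ 23) (l * (1 - l) * m) (S * L1 * (10 ^ 7 - L1) * A, S * L2 * (10 ^ 7 - L2) * B)"
  proof -
    have "s * 10 ^ 23 * ((x1 * (1 - x1)) * a) \<le> s * 10 ^ 23 * ((l * (1 - l)) * m)"
      using x by (intro mult_left_mono mult_mono c) auto
    moreover have "s * 10 ^ 23 * ((l * (1 - l)) * m) \<le> s * 10 ^ 23 * ((x2 * (1 - x2)) * b)"
      using x by (intro mult_left_mono mult_mono c) auto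
    ultimately show ?thesis
      by (simp add: encl_def e s_def algebra_simps)
  qed
  then show "encl S (l * (1 - l) * m) (iv_div (10 ^ 23) (S * L1 * (10 ^ 7 - L1) * A, S * L2 * (10 ^ 7 - L2) * B))"
    by (rule encl_div) simp
  have "encl (S * 10 ^ 9) m (S * A, S * B)"
  proof -
    have "s * 10 ^ 9 * a \<le> s * 10 ^ 9 * m" "s * 10 ^ 9 * m \<le> s * 10 ^ 9 * b"
      using x by (intro mult_left_mono; auto)+
    then show ?thesis
      by (simp add: encl_def e s_def algebra_simps)
  qed
  then show "encl S m (iv_div (10 ^ 9) (S * A, S * B))"
    by (rule encl_div) simp
qed

lemma cell_coeffs_correct:
  assumes "0 < S" "0 < L1" "L2 \<le> 5000000" "0 < A" "l \<in> cell L1 L2" "m \<in> radii A B" "0 < n"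
  shows "list_all2 (encl S) (scaled_coeffs l m n) (cell_coeffs S A B L1 L2 (int n))"
proof -
  note E = cell_encl[OF assms(1-6)]
  have "list_all2 (encl S) (scaled_coeffs l m (Suc 0)) [iv_div (10 ^ 9) (S * A, S * B)]"
    using E(3) by (simp add: scaled_coeffs_def)
  from coeff_ivs_correct[OF assms(1) E(1,2) this, of "n - 1"] show ?thesis
    using assms(7) by (simp add: cell_coeffs_def)
qed

fun slope_low :: "bool \<Rightarrow> interval \<Rightarrow> interval \<Rightarrow> int" where
  "slope_low inc (p, q) (r, t) =
     (if 0 \<le> p then (if inc then - t else r) else if q \<le> 0 then (if inc then r else - t) else min r (- t))"

text \<open>
  The argument \<open>n\<close> is the index of the second entry of the list, which is ordered by decreasing index.
\<close>

fun slope_sum :: "bool \<Rightarrow> int \<Rightarrow> interval \<Rightarrow> int \<Rightarrow> interval list \<Rightarrow> int" where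
  "slope_sum inc S U n [] = 0"
| "slope_sum inc S U n [H] = 0"
| "slope_sum inc S U n (H' # H # Hs) =
     slope_low inc H (iv_add (iv_mul U H) (iv_mul (2 * S * (n + 1), 2 * S * (n + 1)) H')) + slope_sum inc S U (n - 1) (H # Hs)"

text \<open>
  An upper bound for \<open>S (577/1250)\<^sup>k\<close>, where \<open>k\<close> is the length of the list.
\<close>

fun geo_up :: "int \<Rightarrow> 'a list \<Rightarrow> int" where
  "geo_up S [] = S"
| "geo_up S (x # xs) = (geo_up S xs * 577) div 1250 + 1"

text \<open>
  The computed slopes minus the tail of \<open>res_beta_increment\<close> for \<open>c = l (1 - l)\<close> at the left end, all
  scaled by \<open>S\<^sup>2\<close>.
\<close>

definition slope_total :: "bool \<Rightarrow> int \<Rightarrow> int \<Rightarrow> int \<Rightarrow> int \<Rightarrow> interval \<Rightarrow> interval list \<Rightarrow> int" where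
  "slope_total inc S L1 L2 n U Hs = slope_sum inc S U n Hs
     - ((S * geo_up S (tl Hs) * (7703 * n + 22010) * 10 ^ 14) div (10 ^ 4 * L1 * (10 ^ 7 - L1)) + 1)"

definition cell_slope :: "bool \<Rightarrow> int \<Rightarrow> int \<Rightarrow> int \<Rightarrow> int \<Rightarrow> int" where
  "cell_slope inc S L1 L2 n = slope_total inc S L1 L2 n
     (iv_div (10 ^ 16) (S * (10 ^ 7 - 2 * L2) * 1449239650, S * (10 ^ 7 - 2 * L1) * 1449239655))
     (cell_coeffs S 1449239650 1449239655 L1 L2 (n + 1))"

text \<open>
  The sign with which increments count: positive if \<open>\<beta>\<close> is claimed to increase.
\<close>

definition direction :: "bool \<Rightarrow> real" where
  "direction inc = (if inc then 1 else - 1)"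

lemma geo_up_bound: "0 < S \<Longrightarrow> real_of_int S * (577/1250) ^ length xs \<le> real_of_int (geo_up S xs)"
proof (induction xs)
  case (Cons x xs)
  have "real_of_int S * (577/1250) ^ length (x # xs) = real_of_int S * (577/1250) ^ length xs * 577 / 1250"
    by simp
  also have "\<dots> \<le> real_of_int (geo_up S xs * 577) / real_of_int 1250"
    using Cons by simp
  also have "\<dots> \<le> real_of_int ((geo_up S xs * 577) div 1250) + 1"
    using real_of_int_div3[of "geo_up S xs * 577" 1250] by linarith
  finally show ?case
    by simp
qed simp

lemma slope_low_correct:
  assumes S: "0 < S" and H: "\<And>l. l \<in> J \<Longrightarrow> encl S (res_coeff l n * m ^ n) H" and m: "0 < m"
    and X: "\<And>l. l \<in> J \<Longrightarrow> encl (S * S) (slope_term m l n) X"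
  shows "slope_bound m J (direction inc) n (real_of_int (slope_low inc H X) / (real_of_int S)\<^sup>2)"
proof -
  obtain p q r t where e: "H = (p, q)" "X = (r, t)"
    by (cases H, cases X)
  define s where "s = real_of_int S"
  have s: "0 < s" "0 < s\<^sup>2"
    using S by (auto simp: s_def)
  have X': "real_of_int r / s\<^sup>2 \<le> slope_term m l n" "- real_of_int t / s\<^sup>2 \<le> - slope_term m l n" if "l \<in> J" for l
    using X[OF that] s by (simp_all add: encl_def e field_simps power2_eq_square s_def)
  have H': "0 \<le> res_coeff l n" if "l \<in> J" "0 \<le> p" for l
  proof -
    have "0 \<le> s * (res_coeff l n * m ^ n)"
      using H[OF that(1)] that(2) by (simp add: encl_def e s_def)
    then show ?thesis
      using s zero_less_power[OF m, of n] by (simp add: zero_le_mult_iff not_le)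
  qed
  have H'': "res_coeff l n \<le> 0" if "l \<in> J" "q \<le> 0" for l
  proof -
    have "s * (res_coeff l n * m ^ n) \<le> 0"
      using H[OF that(1)] that(2) by (simp add: encl_def e s_def)
    then show ?thesis
      using s zero_less_power[OF m, of n] by (simp add: mult_le_0_iff not_le)
  qed
  have any: "real_of_int (min r (- t)) / s\<^sup>2 \<le> - \<bar>slope_term m l n\<bar>" if "l \<in> J" for l
  proof -
    have "real_of_int (min r (- t)) \<le> real_of_int r" "real_of_int (min r (- t)) \<le> - real_of_int t"
      by auto
    then have "real_of_int (min r (- t)) / s\<^sup>2 \<le> real_of_int r / s\<^sup>2" "real_of_int (min r (- t)) / s\<^sup>2 \<le> - real_of_int t / s\<^sup>2"
      using s by (intro divide_right_mono; simp)+
    with X'[OF that] show ?thesis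
      by linarith
  qed
  show ?thesis
    unfolding slope_bound_def e slope_low.simps direction_def s_def[symmetric]
    using X' H' H'' any by (cases inc; cases "0 \<le> p"; cases "q \<le> 0") auto
qed

lemma slope_sum_correct:
  assumes S: "0 < S" and m: "0 < m" and U: "\<And>l. l \<in> J \<Longrightarrow> encl S ((1 - 2 * l) * m) U"
  shows "length Hs = Suc n \<Longrightarrow> (\<And>l. l \<in> J \<Longrightarrow> list_all2 (encl S) (scaled_coeffs l m (Suc n)) Hs) \<Longrightarrow>
    \<exists>w. (\<forall>k\<in>{1..n}. slope_bound m J (direction inc) k (w k)) \<and>
        (\<Sum>k=1..n. w k) = real_of_int (slope_sum inc S U (int n) Hs) / (real_of_int S)\<^sup>2"
proof (induction n arbitrary: Hs)
  case 0
  then obtain H where "Hs = [H]"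
    by (auto simp: length_Suc_conv)
  then show ?case
    by simp
next
  case (Suc n)
  then obtain H' H Hs' where e: "Hs = H' # H # Hs'"
    by (auto simp: length_Suc_conv)
  have all: "encl S (res_coeff l (Suc (Suc n)) * m ^ Suc (Suc n)) H'" "encl S (res_coeff l (Suc n) * m ^ Suc n) H"
    "list_all2 (encl S) (scaled_coeffs l m (Suc n)) (H # Hs')" if "l \<in> J" for l
    using Suc.prems(2)[OF that] by (simp_all only: e scaled_coeffs_Suc list_all2_Cons)
  obtain w where w: "\<And>k. k \<in> {1..n} \<Longrightarrow> slope_bound m J (direction inc) k (w k)"
    "(\<Sum>k=1..n. w k) = real_of_int (slope_sum inc S U (int n) (H # Hs')) / (real_of_int S)\<^sup>2"
    using Suc.IH[of "H # Hs'"] Suc.prems(1) all(3) unfolding e by (metis length_Cons nat.inject)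
  define X where "X = iv_add (iv_mul U H) (iv_mul (2 * S * (int (Suc n) + 1), 2 * S * (int (Suc n) + 1)) H')"
  have X: "encl (S * S) (slope_term m l (Suc n)) X" if "l \<in> J" for l
    unfolding slope_term_def X_def
  proof (intro encl_add encl_mul U all that)
    show "encl S (2 * real (Suc (Suc n))) (2 * S * (int (Suc n) + 1), 2 * S * (int (Suc n) + 1))"
      by (simp add: encl_def algebra_simps)
  qed
  define v where "v = real_of_int (slope_low inc H X) / (real_of_int S)\<^sup>2"
  have v: "slope_bound m J (direction inc) (Suc n) v"
    unfolding v_def by (intro slope_low_correct S m X all)
  have "(\<Sum>k=1..Suc n. (w(Suc n := v)) k) = (\<Sum>k=1..n. w k) + v"
    by simp
  also have "\<dots> = real_of_int (slope_sum inc S U (int (Suc n)) Hs) / (real_of_int S)\<^sup>2"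
    unfolding w(2) by (simp add: e v_def X_def add_divide_distrib)
  finally have "(\<Sum>k=1..Suc n. (w(Suc n := v)) k) = real_of_int (slope_sum inc S U (int (Suc n)) Hs) / (real_of_int S)\<^sup>2" .
  moreover have "slope_bound m J (direction inc) k ((w(Suc n := v)) k)" if "k \<in> {1..Suc n}" for k
    using w(1)[of k] v that by (cases "k = Suc n") auto
  ultimately show ?case
    by blast
qed

definition angle :: "real \<Rightarrow> real" where
  "angle l = arccos (1 - 2 * l)"

lemma angle_props:
  assumes "0 \<le> l" "l \<le> 1"
  shows "0 \<le> angle l" "angle l \<le> pi" "half_cos (angle l) = l"
  using assms by (auto simp: angle_def half_cos_def arccos_lbound arccos_ubound)

lemma angle_less: "0 \<le> l \<Longrightarrow> l < l' \<Longrightarrow> l' \<le> 1 \<Longrightarrow> angle l < angle l'"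
  unfolding angle_def by (rule arccos_less_arccos) auto

lemma cell_slope_correct:
  assumes S: "0 < S" and L: "0 < L1" "L2 \<le> 5000000" and n: "8 \<le> n"
    and m: "m \<in> radii 1449239650 1449239655"
    and l: "l \<in> cell L1 L2" "l' \<in> cell L1 L2" "l \<le> l'"
  shows "real_of_int (cell_slope inc S L1 L2 n) / (real_of_int S)\<^sup>2 / (2 * m) * (angle l' - angle l)
    \<le> direction inc * (res_beta l' m - res_beta l m)"
proof -
  define N where "N = nat n"
  have N: "n = int N" "8 \<le> N"
    using n by (auto simp: N_def)
  define U where "U = iv_div (10 ^ 16) (S * (10 ^ 7 - 2 * L2) * 1449239650, S * (10 ^ 7 - 2 * L1) * 1449239655)"
  define Hs where "Hs = cell_coeffs S 1449239650 1449239655 L1 L2 (n + 1)"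
  define c where "c = real_of_int L1 / 10 ^ 7 * (1 - real_of_int L1 / 10 ^ 7)"
  note E = cell_encl[OF S L _ _ m]
  have Hs: "list_all2 (encl S) (scaled_coeffs k m (Suc N)) Hs" if "k \<in> cell L1 L2" for k
    using cell_coeffs_correct[OF S L _ that m, of "Suc N"] by (simp add: Hs_def N(1) add.commute)
  have len: "length Hs = Suc N"
    using list_all2_lengthD[OF Hs[OF l(1)]] by (simp add: scaled_coeffs_def del: upt_Suc)
  have m': "0 < m" "m \<le> 29/20" "50 * m / 157 \<le> 577/1250"
    using m by (auto simp: radii_def)
  have U: "encl S ((1 - 2 * k) * m) U" if "k \<in> cell L1 L2" for k
    unfolding U_def by (rule E(1)) (use that in auto)
  obtain w where w: "\<And>k. k \<in> {1..N} \<Longrightarrow> slope_bound m (cell L1 L2) (direction inc) k (w k)"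
    "(\<Sum>k=1..N. w k) = real_of_int (slope_sum inc S U (int N) Hs) / (real_of_int S)\<^sup>2"
    using slope_sum_correct[OF S m'(1) U len Hs, where inc = inc] by blast
  have lb: "0 < l" "l \<le> 1/2" "0 < l'" "l' \<le> 1/2"
    using E(5,6) l by auto
  have L1: "0 < real_of_int L1" "real_of_int L1 \<le> 5000000"
    using L l(1) by (auto simp: cell_def)
  have c: "0 < c"
    unfolding c_def using L1 by (intro mult_pos_pos) auto
  have tail: "(577/1250) ^ N * (7703 * real N + 22010) / 10000 / c \<le>
      real_of_int ((S * geo_up S (tl Hs) * (7703 * n + 22010) * 10 ^ 14) div (10 ^ 4 * L1 * (10 ^ 7 - L1)) + 1) / (real_of_int S)\<^sup>2"
  proof -
    define s where "s = real_of_int S"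
    have s: "0 < s" using S by (simp add: s_def)
    have "s\<^sup>2 * ((577/1250) ^ N * (7703 * N + 22010) / 10000 / c)
      = s * (s * (577/1250) ^ length (tl Hs)) * (7703 * N + 22010) / 10000 / c"
      by (simp add: len power2_eq_square)
    also have "\<dots> \<le> s * real_of_int (geo_up S (tl Hs)) * (7703 * N + 22010) / 10000 / c"
      using s c geo_up_bound[OF S, of "tl Hs"] by (intro divide_right_mono mult_right_mono mult_left_mono) (auto simp: s_def)
    also have "\<dots> = real_of_int (S * geo_up S (tl Hs) * (7703 * n + 22010) * 10 ^ 14) / real_of_int (10 ^ 4 * L1 * (10 ^ 7 - L1))"
      using L1 by (simp add: c_def s_def N(1) field_simps)
    also have "\<dots> \<le> real_of_int ((S * geo_up S (tl Hs) * (7703 * n + 22010) * 10 ^ 14) div (10 ^ 4 * L1 * (10 ^ 7 - L1)) + 1)"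
      using real_of_int_div3[of "S * geo_up S (tl Hs) * (7703 * n + 22010) * 10 ^ 14" "10 ^ 4 * L1 * (10 ^ 7 - L1)"] by linarith
    finally show ?thesis
      using s by (simp add: s_def[symmetric] pos_le_divide_eq mult.commute)
  qed
  have "real_of_int (cell_slope inc S L1 L2 n) / (real_of_int S)\<^sup>2 / (2 * m) * (angle l' - angle l)
    \<le> direction inc * (res_beta (half_cos (angle l')) m - res_beta (half_cos (angle l)) m)"
  proof (rule res_beta_increment[OF _ m' _ _ _ _ _ c N(2), where J = "cell L1 L2" and w = w])
    show "slope_bound m (cell L1 L2) (direction inc) k (w k)" if "k \<in> {1..N}" for k
      using that by (rule w(1))
    show "direction inc = 1 \<or> direction inc = - 1"
      by (simp add: direction_def)
    show "0 \<le> angle l" "angle l \<le> angle l'" "angle l' \<le> pi"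
      using angle_props[of l] angle_props[of l'] angle_less[of l l'] lb l(3) by (cases "l = l'"; force)+
    show "{half_cos (angle l)..half_cos (angle l')} \<subseteq> cell L1 L2"
      using lb l by (simp add: angle_props) (auto simp: cell_def)
    show "0 < k \<and> k \<le> 1/2 \<and> c \<le> k * (1 - k)" if "k \<in> cell L1 L2" for k
      using E(4-6)[OF _ that] by (simp add: c_def)
    show "real_of_int (cell_slope inc S L1 L2 n) / (real_of_int S)\<^sup>2 \<le> (\<Sum>n = 1..N. w n) - (577/1250) ^ N * (7703 * real N + 22010) / 10000 / c"
      using tail unfolding w(2) cell_slope_def slope_total_def U_def[symmetric] Hs_def[symmetric] N(1)[symmetric] of_int_diff diff_divide_distrib
      by linarith
  qed
  then show ?thesis
    using lb by (simp add: angle_props)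
qed

definition beta_monotone :: "bool \<Rightarrow> int \<Rightarrow> int \<Rightarrow> bool" where
  "beta_monotone inc L1 L2 \<longleftrightarrow> (\<forall>m\<in>radii 1449239650 1449239655. \<forall>l\<in>cell L1 L2. \<forall>l'\<in>cell L1 L2.
     l < l' \<longrightarrow> 0 < direction inc * (res_beta l' m - res_beta l m))"

text \<open>
  Consecutive cells starting at \<open>a\<close>, each given by its right end and the number of coefficients used.
\<close>

fun slope_chain :: "bool \<Rightarrow> int \<Rightarrow> int \<Rightarrow> (int \<times> int) list \<Rightarrow> bool" where
  "slope_chain inc S a [] = True"
| "slope_chain inc S a ((b, n) # xs) = (0 < cell_slope inc S a b n \<and> a \<le> b \<and> b \<le> 5000000 \<and> 8 \<le> n \<and> slope_chain inc S b xs)"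

lemma beta_monotone_trans:
  assumes "beta_monotone inc a b" "beta_monotone inc b c" "a \<le> b" "b \<le> c"
  shows "beta_monotone inc a c"
  unfolding beta_monotone_def
proof (intro ballI impI)
  fix m l l' assume m: "m \<in> radii 1449239650 1449239655" and l: "l \<in> cell a c" "l' \<in> cell a c" "l < l'"
  define x where "x = real_of_int b / 10 ^ 7"
  have x: "x \<in> cell a b" "x \<in> cell b c"
    using assms(3,4) by (auto simp: x_def cell_def divide_right_mono)
  consider "l' \<le> x" | "x \<le> l" | "l < x" "x < l'"
    by linarith
  then show "0 < direction inc * (res_beta l' m - res_beta l m)"
  proof cases
    case 1
    then show ?thesis
      using assms(1) m l by (auto simp: beta_monotone_def cell_def x_def)
  next
    case 2
    then show ?thesis
      using assms(2) m l by (auto simp: beta_monotone_def cell_def x_def)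
  next
    case 3
    have "l \<in> cell a b" "l' \<in> cell b c"
      using 3 l by (auto simp: cell_def x_def)
    then have "0 < direction inc * (res_beta x m - res_beta l m)" "0 < direction inc * (res_beta l' m - res_beta x m)"
      using assms(1,2) m x 3 unfolding beta_monotone_def by blast+
    then show ?thesis
      by (simp add: right_diff_distrib)
  qed
qed

lemma beta_monotone_refl: "beta_monotone inc a a"
  by (auto simp: beta_monotone_def cell_def)

lemma slope_chain_correct:
  assumes "0 < S"
  shows "0 < a \<Longrightarrow> slope_chain inc S a xs \<Longrightarrow> a \<le> last (a # map fst xs) \<and> beta_monotone inc a (last (a # map fst xs))"
proof (induction xs arbitrary: a)
  case Nil
  then show ?case
    by (simp add: beta_monotone_refl)
next
  case (Cons x xs)
  obtain b n where x: "x = (b, n)"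
    by (cases x)
  have b: "0 < cell_slope inc S a b n" "a \<le> b" "b \<le> 5000000" "8 \<le> n" "slope_chain inc S b xs"
    using Cons.prems(2) by (auto simp: x)
  have "beta_monotone inc a b"
    unfolding beta_monotone_def
  proof (intro ballI impI)
    fix m l l' assume m: "m \<in> radii 1449239650 1449239655" and l: "l \<in> cell a b" "l' \<in> cell a b" "l < l'"
    note E = cell_encl[OF assms Cons.prems(1) b(3) _ _ m]
    have "0 < real_of_int (cell_slope inc S a b n) / (real_of_int S)\<^sup>2 / (2 * m) * (angle l' - angle l)"
      using b(1) assms E(5-7) l angle_less[of l l'] by force
    also have "\<dots> \<le> direction inc * (res_beta l' m - res_beta l m)"
      using assms Cons.prems(1) b m l by (intro cell_slope_correct) auto
    finally show "0 < direction inc * (res_beta l' m - res_beta l m)" .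
  qed
  moreover have "b \<le> last (b # map fst xs) \<and> beta_monotone inc b (last (b # map fst xs))"
    using Cons.IH[OF _ b(5)] Cons.prems(1) b(2) by simp
  ultimately show ?case
    using beta_monotone_trans[of inc a b "last (b # map fst xs)"] b(2) by (simp add: x)
qed

section \<open>Verification of the off-diagonal inequality\<close>

fun abs_hi :: "interval \<Rightarrow> int" where
  "abs_hi (a, b) = max (- a) b"

fun abs_lo :: "interval \<Rightarrow> int" where
  "abs_lo (a, b) = max 0 (max a (- b))"

text \<open>
  The coefficients are listed with decreasing index, hence so are the weights; the list of weights
  may be shorter, which leaves out the coefficients of lowest index.
\<close>

fun weighted_hi :: "int list \<Rightarrow> interval list \<Rightarrow> int" where
  "weighted_hi [] Hs = 0"
| "weighted_hi (w # ws) [] = 0"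
| "weighted_hi (w # ws) (H # Hs) = w * abs_hi H + weighted_hi ws Hs"

text \<open>
  The last entry is the coefficient with index 1, which is known exactly and is treated separately.
\<close>

fun sum_lo :: "interval list \<Rightarrow> int" where
  "sum_lo [] = 0"
| "sum_lo [H] = 0"
| "sum_lo (H # H' # Hs) = abs_lo H + sum_lo (H' # Hs)"

lemma abs_hi_lo:
  assumes "encl S x H" "0 < S"
  shows "of_int S * \<bar>x\<bar> \<le> of_int (abs_hi H)" "of_int (abs_lo H) \<le> of_int S * \<bar>x\<bar>"
proof -
  obtain a b where H: "H = (a, b)"
    by (cases H)
  have e: "of_int S * \<bar>x\<bar> = \<bar>of_int S * x\<bar>"
    using assms(2) by (simp add: abs_mult)
  show "of_int S * \<bar>x\<bar> \<le> of_int (abs_hi H)" "of_int (abs_lo H) \<le> of_int S * \<bar>x\<bar>"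
    using assms(1) unfolding e H encl_def by (auto simp: of_int_max)
qed

lemma weighted_hi_correct:
  assumes "0 < S" "\<And>n. 0 \<le> f n"
  shows "list_all2 (encl S) (scaled_coeffs l m (Suc P)) Hs \<Longrightarrow>
    of_int S * (\<Sum>n<P. of_int (f n) * \<bar>res_coeff l (n + 2) * m ^ (n + 2)\<bar>) \<le> of_int (weighted_hi (rev (map f [0..<P])) Hs)"
proof (induction P arbitrary: Hs)
  case (Suc P)
  obtain H Hs' where e: "Hs = H # Hs'" and H: "encl S (res_coeff l (Suc (Suc P)) * m ^ Suc (Suc P)) H"
    and Hs': "list_all2 (encl S) (scaled_coeffs l m (Suc P)) Hs'"
    using Suc.prems by (subst (asm) scaled_coeffs_Suc) (auto simp: list_all2_Cons1)
  have "of_int (f P) * (of_int S * \<bar>res_coeff l (P + 2) * m ^ (P + 2)\<bar>) \<le> of_int (f P) * of_int (abs_hi H)"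
    using abs_hi_lo(1)[OF H assms(1)] assms(2) by (intro mult_left_mono) auto
  with Suc.IH[OF Hs'] show ?case
    by (simp add: e algebra_simps)
qed simp

lemma sum_lo_correct:
  assumes "0 < S"
  shows "list_all2 (encl S) (scaled_coeffs l m (Suc P)) Hs \<Longrightarrow>
    of_int (sum_lo Hs) \<le> of_int S * (\<Sum>n<P. \<bar>res_coeff l (n + 2) * m ^ (n + 2)\<bar>)"
proof (induction P arbitrary: Hs)
  case 0
  then obtain H where "Hs = [H]"
    by (auto simp: scaled_coeffs_def list_all2_Cons1)
  then show ?case
    by simp
next
  case (Suc P)
  obtain H Hs' where e: "Hs = H # Hs'" and H: "encl S (res_coeff l (Suc (Suc P)) * m ^ Suc (Suc P)) H"
    and Hs': "list_all2 (encl S) (scaled_coeffs l m (Suc P)) Hs'"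
    using Suc.prems by (subst (asm) scaled_coeffs_Suc) (auto simp: list_all2_Cons1)
  obtain H' Hs'' where e': "Hs' = H' # Hs''"
    using Hs' by (auto simp: scaled_coeffs_Suc list_all2_Cons1)
  show ?case
    using Suc.IH[OF Hs'] abs_hi_lo(2)[OF H assms(1)] by (simp add: e e' algebra_simps)
qed

text \<open>
  Pascal's rule relates the partial sums for \<open>k + 1\<close> to those for \<open>k\<close>; the full series has exactly the
  value on the right.
\<close>

lemma sum_binomial_geometric_le:
  fixes q :: real
  assumes q: "0 \<le> q" "q < 1"
  shows "(\<Sum>n\<le>N. q ^ n * real (n choose k)) \<le> q ^ k / (1 - q) ^ Suc k"
proof (induction k arbitrary: N)
  case 0
  have "(\<Sum>n\<le>N. q ^ n) = (1 - q ^ Suc N) / (1 - q)"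
    using q sum_gp0[of q N] by simp
  then show ?case
    using q by (simp add: divide_right_mono)
next
  case (Suc k)
  define A where "A k N = (\<Sum>n\<le>N. q ^ n * real (n choose k))" for k N
  have mono: "A k N \<le> A k (Suc N)" for k N
    using q by (simp add: A_def)
  have "A (Suc k) (Suc N) = q * (A k N + A (Suc k) N)"
    unfolding A_def by (subst sum.atMost_Suc_shift) (simp add: sum_distrib_left sum.distrib[symmetric] algebra_simps)
  also have "\<dots> \<le> q * (A k N + A (Suc k) (Suc N))"
    using q mono by (intro mult_left_mono add_left_mono) auto
  finally have "(1 - q) * A (Suc k) (Suc N) \<le> q * A k N"
    by (simp add: algebra_simps)
  also have "\<dots> \<le> q * (q ^ k / (1 - q) ^ Suc k)"
    using Suc.IH[of N] q by (intro mult_left_mono) (auto simp: A_def)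
  finally have "A (Suc k) (Suc N) \<le> q ^ Suc k / (1 - q) ^ Suc k / (1 - q)"
    using q by (subst pos_le_divide_eq) (auto simp: mult.commute)
  then have "A (Suc k) N \<le> q ^ Suc k / (1 - q) ^ Suc k / (1 - q)"
    using mono[of "Suc k" N] by linarith
  then show ?case
    by (simp add: A_def mult.commute)
qed

lemma sum_even_part_weight_geometric_le:
  fixes q \<eta> :: real
  assumes q: "0 \<le> q" "q < 1" and \<eta>: "0 \<le> \<eta>" and j: "1 \<le> j"
  shows "(\<Sum>n\<le>N. q ^ n * even_part_weight \<eta> j n) \<le> (q / (1 - q)) ^ (2 * j - 2) * (q / (1 - q) + \<eta>)\<^sup>2 / (1 - q)"
proof -
  define C where "C k = (\<Sum>n\<le>N. q ^ n * real (n choose k))" for k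
  obtain i where i: "j = Suc i"
    using j by (cases j) auto
  define r where "r = q / (1 - q)"
  have C: "C k \<le> r ^ k / (1 - q)" for k
    using sum_binomial_geometric_le[OF q, where N = N and k = k] by (simp add: C_def r_def power_divide mult.commute)
  have "(\<Sum>n\<le>N. q ^ n * even_part_weight \<eta> j n) = C (2 * j) + 2 * \<eta> * C (2 * j - 1) + \<eta>\<^sup>2 * C (2 * j - 2)"
    unfolding C_def sum_distrib_left sum.distrib[symmetric] using j
    by (intro sum.cong) (auto simp: even_part_weight_def algebra_simps)
  also have "\<dots> \<le> r ^ (2 * j) / (1 - q) + 2 * \<eta> * (r ^ (2 * j - 1) / (1 - q)) + \<eta>\<^sup>2 * (r ^ (2 * j - 2) / (1 - q))"
    using \<eta> by (intro add_mono mult_left_mono C) auto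
  also have "\<dots> = r ^ (2 * j - 2) * (r + \<eta>)\<^sup>2 / (1 - q)"
    by (simp add: i power2_eq_square algebra_simps add_divide_distrib)
  finally show ?thesis
    by (simp add: r_def)
qed

text \<open>
  The sum is split at \<open>P\<close>. Beyond, the majorant \<open>K q\<^sup>n\<close> is summed as the difference of the whole
  series and its initial segment, which avoids summation of the tail term by term.
\<close>

lemma even_part_sum_le:
  fixes h :: "nat \<Rightarrow> real"
  assumes q: "0 \<le> q" "q < 1" and \<eta>: "0 \<le> \<eta>" and j: "1 \<le> j" and h: "\<And>n. 0 \<le> h n" "\<And>n. h n \<le> K * q ^ n" and K: "0 \<le> K"
    and F: "F = (q / (1 - q)) ^ (2 * j - 2) * (q / (1 - q) + \<eta>)\<^sup>2 / (1 - q)"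
  shows "(\<Sum>n\<le>N. h n * even_part_weight \<eta> j n) \<le>
    (\<Sum>n<P. h n * even_part_weight \<eta> j n) + K * (F - (\<Sum>n<P. q ^ n * even_part_weight \<eta> j n))"
proof -
  define N' where "N' = N + P"
  have split: "(\<Sum>n\<le>N'. f n) = (\<Sum>n<P. f n) + (\<Sum>n=P..N'. f n)" for f :: "nat \<Rightarrow> real"
    using sum.union_disjoint[of "{..<P}" "{P..N'}" f] by (simp add: ivl_disj_un ivl_disj_int N'_def)
  have "(\<Sum>n\<le>N. h n * even_part_weight \<eta> j n) \<le> (\<Sum>n\<le>N'. h n * even_part_weight \<eta> j n)"
    using h \<eta> by (intro sum_mono2) (auto simp: N'_def even_part_weight_nonneg)
  also have "\<dots> = (\<Sum>n<P. h n * even_part_weight \<eta> j n) + (\<Sum>n=P..N'. h n * even_part_weight \<eta> j n)"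
    by (rule split)
  also have "(\<Sum>n=P..N'. h n * even_part_weight \<eta> j n) \<le> (\<Sum>n=P..N'. K * q ^ n * even_part_weight \<eta> j n)"
    using h \<eta> by (intro sum_mono mult_right_mono) (auto simp: even_part_weight_nonneg)
  also have "\<dots> = K * ((\<Sum>n\<le>N'. q ^ n * even_part_weight \<eta> j n) - (\<Sum>n<P. q ^ n * even_part_weight \<eta> j n))"
    unfolding split by (simp add: sum_distrib_left mult.assoc)
  also have "\<dots> \<le> K * (F - (\<Sum>n<P. q ^ n * even_part_weight \<eta> j n))"
    unfolding F using sum_even_part_weight_geometric_le[OF q \<eta> j, of N'] K by (intro mult_left_mono) auto
  finally show ?thesis
    by simp
qed

text \<open>
  The weights for \<open>\<eta> = 1/5\<close>, multiplied by 25 to make them integers. This value of \<open>\<eta>\<close> leaves enough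
  room for all parameters between 1/20 and 1/2.
\<close>

definition weight25 :: "nat \<Rightarrow> nat \<Rightarrow> int" where
  "weight25 j n = 25 * int (n choose (2 * j)) + 10 * int (n choose (2 * j - 1)) + int (n choose (2 * j - 2))"

lemma even_part_weight_fifth: "1 \<le> j \<Longrightarrow> even_part_weight (1/5) j n = of_int (weight25 j n) / 25"
  by (simp add: even_part_weight_def weight25_def power2_eq_square)

fun horner :: "real \<Rightarrow> real \<Rightarrow> int list \<Rightarrow> real" where
  "horner q a [] = a"
| "horner q a (w # ws) = horner q (a * q + of_int w) ws"

lemma horner_rev_map: "horner q a (rev (map f [0..<P])) = a * q ^ P + (\<Sum>n<P. q ^ n * of_int (f n))"
  by (induction P arbitrary: a) (simp_all add: algebra_simps)

text \<open>
  Row \<open>j\<close> contains the weights for \<open>n = 18, \<dots>, 0\<close> and, in the first component, a bound for the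
  weighted tail beyond \<open>n = 18\<close> in units of \<open>10\<^sup>-\<^sup>6 / (l (1 - l))\<close>. The last row bounds the whole sum for
  all \<open>j \<ge> 10\<close>, where the bound decreases in \<open>j\<close>.
\<close>

definition even_table :: "(int \<times> int list) list" where
  "even_table = [(662, [4006, 3571, 3161, 2776, 2416, 2081, 1771, 1486, 1226, 991, 781, 596, 436, 301, 191, 106, 46, 11, 1]),
    (17905, [84813, 66436, 51220, 38780, 28756, 20813, 14641, 9955, 6495, 4026, 2338, 1246, 590, 235, 71, 13, 1, 0, 0]),
    (159210, [552840, 373660, 245700, 156520, 96096, 56485, 31515, 16500, 7980, 3486, 1330, 420, 100, 15, 1, 0, 0, 0, 0]),
    (622397, [1430754, 814606, 444158, 230230, 112398, 51051, 21219, 7887, 2535, 669, 133, 17, 1, 0, 0, 0, 0, 0, 0]),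
    (1264869, [1623908, 753610, 327470, 131560, 48048, 15587, 4345, 990, 170, 19, 1, 0, 0, 0, 0, 0, 0, 0, 0]),
    (1550685, [826098, 297908, 97188, 28028, 6916, 1391, 211, 21, 1, 0, 0, 0, 0, 0, 0, 0, 0, 0, 0]),
    (1368114, [180744, 46988, 10420, 1880, 256, 23, 1, 0, 0, 0, 0, 0, 0, 0, 0, 0, 0, 0, 0]),
    (1043533, [15045, 2465, 305, 25, 1, 0, 0, 0, 0, 0, 0, 0, 0, 0, 0, 0, 0, 0, 0]),
    (769548, [358, 27, 1, 0, 0, 0, 0, 0, 0, 0, 0, 0, 0, 0, 0, 0, 0, 0, 0]),
    (565711, [])]"

fun prefix_sums :: "int \<Rightarrow> int list \<Rightarrow> int list" where
  "prefix_sums a [] = []"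
| "prefix_sums a (x # xs) = a # prefix_sums (a + x) xs"

text \<open>
  Columns of Pascal's triangle by repeated prefix sums, so that the table can be checked with integer
  additions only.
\<close>

primrec binomial_column :: "nat \<Rightarrow> int list" where
  "binomial_column 0 = replicate 19 1"
| "binomial_column (Suc k) = prefix_sums 0 (binomial_column k)"

lemma prefix_sums_binomial:
  "prefix_sums (int (a choose Suc k)) (map (\<lambda>n. int (n choose k)) [a..<b]) = map (\<lambda>n. int (n choose Suc k)) [a..<b]"
proof (induction "b - a" arbitrary: a)
  case (Suc d)
  then have "[a..<b] = a # [Suc a..<b]"
    by (simp add: upt_conv_Cons)
  with Suc.hyps(1)[of "Suc a"] Suc.hyps(2) show ?case
    by (simp add: add.commute)
qed simp

lemma binomial_column_eq: "binomial_column k = map (\<lambda>n. int (n choose k)) [0..<19]"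
proof (induction k)
  case 0
  show ?case
    by (rule nth_equalityI) (simp_all del: upt_Suc)
next
  case (Suc k)
  then show ?case
    using prefix_sums_binomial[of 0 k 19] by (simp del: upt_Suc)
qed

lemma binomial_column_table:
  "list_all (\<lambda>(j, ws). rev ws = map2 (+) (map2 (\<lambda>x y. 25 * x + 10 * y) (binomial_column (2 * j)) (binomial_column (2 * j - 1))) (binomial_column (2 * j - 2)))
     (zip [1..<10] (map snd (butlast even_table)))"
  by code_simp

text \<open>
  Here \<open>577/673 = q / (1 - q)\<close>, \<open>3558/673 = 5 (q / (1 - q) + 1/5)\<close> and \<open>1250/673 = 1 / (1 - q)\<close>;
  the factor 173950 is \<open>0.17395\<close> in units of \<open>10\<^sup>-\<^sup>6\<close>, and \<open>0.17395 \<ge> 0.26 m q\<close>.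
\<close>

lemma even_table_tails:
  "list_all (\<lambda>(j, k, ws). 173950 * ((577/673) ^ (2 * j - 2) * (3558/673)\<^sup>2 * (1250/673) - horner (577/1250) 0 ws) \<le> real_of_int k)
    (zip [1..<11] even_table)"
  by (simp add: even_table_def upt_rec power_divide)

fun even_rows :: "int \<Rightarrow> int \<Rightarrow> (int \<times> int list) list \<Rightarrow> interval list \<Rightarrow> bool" where
  "even_rows Q T [] Hs = True"
| "even_rows Q T ((k, ws) # rs) Hs = (weighted_hi ws Hs + k * T < Q \<and> even_rows Q T rs Hs)"

definition even_check :: "int \<Rightarrow> int \<Rightarrow> interval list \<Rightarrow> bool" where
  "even_check S L1 Hs = even_rows (24 * sum_lo Hs + 8 * ((S * 1449239650) div 10 ^ 9))
     ((S * 10 ^ 8) div (L1 * (10 ^ 7 - L1)) + 1) even_table Hs"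

fun even_chain :: "int \<Rightarrow> int \<Rightarrow> int list \<Rightarrow> bool" where
  "even_chain S a [] = True"
| "even_chain S a (b # bs) = (even_check S a (cell_coeffs S 1449239650 1449239655 a b 20)
     \<and> a \<le> b \<and> b \<le> 5000000 \<and> even_chain S b bs)"

lemma even_rows_nth: "even_rows Q T rs Hs \<Longrightarrow> i < length rs \<Longrightarrow>
   weighted_hi (snd (rs ! i)) Hs + fst (rs ! i) * T < Q"
proof (induction rs arbitrary: i)
  case (Cons r rs)
  then show ?case
    by (cases r; cases i) auto
qed simp

lemma length_even_table: "length even_table = 10"
  by (simp add: even_table_def)

lemma even_table_row:
  assumes "1 \<le> j" "j \<le> 9"
  shows "snd (even_table ! (j - 1)) = rev (map (weight25 j) [0..<19])"
proof -
  define ws where "ws = map snd (butlast even_table) ! (j - 1)"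
  have "(j, ws) \<in> set (zip [1..<10] (map snd (butlast even_table)))"
    unfolding in_set_conv_nth ws_def using assms
    by (intro exI[of _ "j - 1"]) (simp add: length_even_table del: upt_Suc)
  then have "rev ws = map2 (+) (map2 (\<lambda>x y. 25 * x + 10 * y) (binomial_column (2 * j)) (binomial_column (2 * j - 1))) (binomial_column (2 * j - 2))"
    using binomial_column_table unfolding list_all_iff by blast
  also have "\<dots> = map (weight25 j) [0..<19]"
    unfolding binomial_column_eq by (rule nth_equalityI) (simp_all add: weight25_def del: upt_Suc)
  finally have "ws = rev (map (weight25 j) [0..<19])"
    by (simp add: rev_swap)
  moreover have "snd (even_table ! (j - 1)) = ws"
    using assms by (simp add: ws_def nth_butlast length_even_table)
  ultimately show ?thesis
    by simp
qed

lemma even_table_last_row: "snd (even_table ! 9) = []"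
  by (simp add: even_table_def)

lemma even_table_tail:
  assumes "1 \<le> j" "j \<le> 10"
  shows "173950 * ((577/673) ^ (2 * j - 2) * (3558/673)\<^sup>2 * (1250/673) - horner (577/1250) 0 (snd (even_table ! (j - 1)))) \<le> real_of_int (fst (even_table ! (j - 1)))"
proof -
  have "(j, even_table ! (j - 1)) \<in> set (zip [1..<11] even_table)"
    unfolding in_set_conv_nth using assms
    by (intro exI[of _ "j - 1"]) (simp add: length_even_table del: upt_Suc)
  with even_table_tails show ?thesis
    unfolding list_all_iff by (cases "even_table ! (j - 1)") auto
qed

text \<open>
  The rows of the table bound the sums required by \<open>res_maj_mult_less\<close> for \<open>\<eta> = 1/5\<close>. The strict
  inequality between integers leaves a gap of 1, which allows a common bound \<open>Q\<close> for all rows.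
\<close>

lemma even_check_correct:
  assumes S: "0 < S" and L: "0 < L1" "L2 \<le> 5000000" and l: "l \<in> cell L1 L2" and m: "m \<in> radii 1449239650 1449239655"
    and s: "0 < s" "s < 1" and ok: "even_check S L1 (cell_coeffs S 1449239650 1449239655 L1 L2 20)"
  shows "res_maj l (m * (1 + s)) * res_maj l (m * (1 - s)) < (res_maj l m)\<^sup>2"
proof -
  define h where "h n = \<bar>res_coeff l n\<bar> * m ^ n" for n
  define Hs where "Hs = cell_coeffs S 1449239650 1449239655 L1 L2 20"
  define Q where "Q = 24 * sum_lo Hs + 8 * ((S * 1449239650) div 10 ^ 9)"
  define T where "T = (S * 10 ^ 8) div (L1 * (10 ^ 7 - L1)) + 1"
  define c where "c = real_of_int L1 / 10 ^ 7 * (1 - real_of_int L1 / 10 ^ 7)"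
  define q :: real where "q = 577/1250"
  define K where "K = 17395/100000 / c"
  note E = cell_encl[OF S L _ l m]
  have m': "0 < m" "m \<le> 29/20" "50 * m / 157 \<le> 577/1250" "m * (1 + s) < 157/50" "m \<le> 1449239655/10^9" "1449239650/10^9 \<le> m"
  proof -
    show "0 < m" "m \<le> 29/20" "50 * m / 157 \<le> 577/1250" "m \<le> 1449239655/10^9" "1449239650/10^9 \<le> m"
      using m by (auto simp: radii_def)
    have "m * (1 + s) \<le> 29/20 * 2"
      using m s by (intro mult_mono) (auto simp: radii_def)
    then show "m * (1 + s) < 157/50"
      by simp
  qed
  have lb: "0 < l" "l < 1" "c \<le> l * (1 - l)"
    using E(4-6) by (auto simp: c_def)
  have L1: "0 < real_of_int L1" "real_of_int L1 \<le> 5000000"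
    using L l by (auto simp: cell_def)
  have c: "0 < c"
    unfolding c_def using L1 by (intro mult_pos_pos) auto
  have Hs: "list_all2 (encl S) (scaled_coeffs l m (Suc 19)) Hs"
    using cell_coeffs_correct[OF S L _ l m, of 20] by (simp add: Hs_def)
  have habs: "\<bar>res_coeff l n * m ^ n\<bar> = h n" for n
    using m' by (simp add: h_def abs_mult)
  have h0: "0 \<le> h n" for n
    using m' by (simp add: h_def)
  have hq: "h (n + 2) \<le> K * q ^ n" for n
  proof -
    have "h (n + 2) \<le> 13/50 * m / c * q ^ Suc n"
      using scaled_coeff_tail[OF lb(1,2) c lb(3) m'(1-3), of "Suc n"] by (simp add: h_def q_def)
    also have "\<dots> = (13/50 * m * q) * (q ^ n / c)"
      by simp
    also have "\<dots> \<le> 17395/100000 * (q ^ n / c)"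
      using m'(5) c by (intro mult_right_mono) (auto simp: q_def)
    finally show ?thesis
      by (simp add: K_def)
  qed
  have KT: "real_of_int S * K \<le> 173950 * real_of_int T"
  proof -
    have "real_of_int S / c = 10 ^ 6 * (real_of_int (S * 10 ^ 8) / real_of_int (L1 * (10 ^ 7 - L1)))"
      using L1 by (simp add: c_def field_simps)
    also have "\<dots> \<le> 10 ^ 6 * real_of_int T"
      unfolding T_def using real_of_int_div3[of "S * 10 ^ 8" "L1 * (10 ^ 7 - L1)"] by (intro mult_left_mono) auto
    finally have "real_of_int S / c \<le> 10 ^ 6 * real_of_int T" .
    then show ?thesis
      by (simp add: K_def)
  qed
  have "even_rows Q T even_table Hs"
    using ok by (simp add: even_check_def Q_def T_def Hs_def)
  note rows = even_rows_nth[OF this]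
  define Qr where "Qr = (real_of_int Q - 1) / (25 * real_of_int S)"
  have Spos: "0 < real_of_int S"
    using S by simp
  have T0: "0 \<le> real_of_int T"
    using S L1 L by (simp add: T_def pos_imp_zdiv_nonneg_iff)
  have row: "(\<Sum>n\<le>N. h (n + 2) * even_part_weight (1/5) j n) \<le> Qr" if j: "1 \<le> j" for j N
  proof -
    define i where "i = min j 10 - 1"
    define P :: nat where "P = (if j \<le> 9 then 19 else 0)"
    have i: "i < 10" "i + 1 \<le> j"
      using j by (auto simp: i_def)
    define F where "F = (q / (1 - q)) ^ (2 * j - 2) * (q / (1 - q) + 1/5)\<^sup>2 / (1 - q)"
    have ws: "snd (even_table ! i) = rev (map (weight25 j) [0..<P])"
    proof (cases "j \<le> 9")
      case True
      then show ?thesis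
        using even_table_row[OF j] by (simp add: i_def P_def min_def)
    next
      case False
      then show ?thesis
        by (simp add: i_def P_def even_table_last_row)
    qed
    have k: "173950 * (25 * F - (\<Sum>n<P. q ^ n * of_int (weight25 j n))) \<le> real_of_int (fst (even_table ! i))"
    proof -
      have "25 * F = (577/673) ^ (2 * j - 2) * (3558/673)\<^sup>2 * (1250/673)"
        by (simp add: F_def q_def power2_eq_square)
      also have "\<dots> \<le> (577/673) ^ (2 * (i + 1) - 2) * (3558/673)\<^sup>2 * (1250/673)"
        using i by (intro mult_right_mono power_decreasing) auto
      finally have "25 * F \<le> (577/673) ^ (2 * (i + 1) - 2) * (3558/673)\<^sup>2 * (1250/673)" .
      moreover have "173950 * ((577/673) ^ (2 * (i + 1) - 2) * (3558/673)\<^sup>2 * (1250/673) - (\<Sum>n<P. q ^ n * of_int (weight25 j n))) \<le> real_of_int (fst (even_table ! i))"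
        using even_table_tail[of "i + 1"] i ws by (simp only: horner_rev_map add_diff_cancel_right' q_def) simp
      ultimately show ?thesis
        by (meson order_trans mult_left_mono diff_right_mono zero_le_numeral)
    qed
    have w0: "0 \<le> weight25 j n" for n
      by (simp add: weight25_def)
    have hi: "real_of_int S * (\<Sum>n<P. of_int (weight25 j n) * h (n + 2)) \<le> of_int (weighted_hi (rev (map (weight25 j) [0..<P])) Hs)"
    proof (cases "j \<le> 9")
      case True
      then show ?thesis
        using weighted_hi_correct[OF S _ Hs, where f = "weight25 j", unfolded habs, OF w0] by (simp add: P_def del: upt_Suc)
    qed (simp add: P_def)
    have "(\<Sum>n\<le>N. h (n + 2) * even_part_weight (1/5) j n) \<le>
        (\<Sum>n<P. h (n + 2) * even_part_weight (1/5) j n) + K * (F - (\<Sum>n<P. q ^ n * even_part_weight (1/5) j n))"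
      by (rule even_part_sum_le[OF _ _ _ j _ hq]) (use c h0 in \<open>auto simp: q_def F_def K_def\<close>)
    also have "\<dots> = (\<Sum>n<P. of_int (weight25 j n) * h (n + 2)) / 25 + K / 25 * (25 * F - (\<Sum>n<P. q ^ n * of_int (weight25 j n)))"
    proof -
      have "(\<Sum>n<P. h (n + 2) * even_part_weight (1/5) j n) = (\<Sum>n<P. of_int (weight25 j n) * h (n + 2)) / 25"
        "(\<Sum>n<P. q ^ n * even_part_weight (1/5) j n) = (\<Sum>n<P. q ^ n * of_int (weight25 j n)) / 25"
        unfolding sum_divide_distrib by (auto intro!: sum.cong simp: even_part_weight_fifth[OF j])
      note e = this
      show ?thesis
        unfolding e by (simp add: field_simps)
    qed
    finally have 1: "(\<Sum>n\<le>N. h (n + 2) * even_part_weight (1/5) j n) \<le> 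
      (\<Sum>n<P. of_int (weight25 j n) * h (n + 2)) / 25 + K / 25 * (25 * F - (\<Sum>n<P. q ^ n * of_int (weight25 j n)))" .
    have F0: "0 \<le> 25 * F - (\<Sum>n<P. q ^ n * of_int (weight25 j n))"
    proof -
      have "(\<Sum>n<P. q ^ n * even_part_weight (1/5) j n) \<le> (\<Sum>n\<le>P. q ^ n * even_part_weight (1/5) j n)"
        by (intro sum_mono2) (auto simp: q_def even_part_weight_nonneg)
      also have "\<dots> \<le> F"
        unfolding F_def by (rule sum_even_part_weight_geometric_le) (use j in \<open>auto simp: q_def\<close>)
      finally show ?thesis
        by (simp add: even_part_weight_fifth[OF j] sum_divide_distrib[symmetric])
    qed
    have "real_of_int S * (K * (25 * F - (\<Sum>n<P. q ^ n * of_int (weight25 j n)))) = (real_of_int S * K) * (25 * F - (\<Sum>n<P. q ^ n * of_int (weight25 j n)))"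
      by simp
    also have "\<dots> \<le> (173950 * real_of_int T) * (25 * F - (\<Sum>n<P. q ^ n * of_int (weight25 j n)))"
      by (intro mult_right_mono KT F0)
    also have "\<dots> = real_of_int T * (173950 * (25 * F - (\<Sum>n<P. q ^ n * of_int (weight25 j n))))"
      by simp
    also have "\<dots> \<le> real_of_int T * real_of_int (fst (even_table ! i))"
      by (intro mult_left_mono k T0)
    finally have 2: "real_of_int S * (K * (25 * F - (\<Sum>n<P. q ^ n * of_int (weight25 j n)))) \<le> real_of_int (fst (even_table ! i) * T)"
      by (simp add: mult.commute)
    have "25 * real_of_int S * (\<Sum>n\<le>N. h (n + 2) * even_part_weight (1/5) j n) \<le>
       real_of_int S * (\<Sum>n<P. of_int (weight25 j n) * h (n + 2)) + real_of_int S * (K * (25 * F - (\<Sum>n<P. q ^ n * of_int (weight25 j n))))"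
      using mult_left_mono[OF 1, of "25 * real_of_int S"] Spos by (simp add: algebra_simps)
    also have "\<dots> \<le> real_of_int (weighted_hi (rev (map (weight25 j) [0..<P])) Hs + fst (even_table ! i) * T)"
      using hi 2 by simp
    also have "\<dots> \<le> real_of_int (Q - 1)"
      using rows[of i] i unfolding length_even_table ws by linarith
    finally show ?thesis
      using Spos by (simp add: Qr_def pos_le_divide_eq mult.commute)
  qed
  have "Qr < (1 - (1/5)\<^sup>2) * (\<Sum>n\<le>18. h (n + 2)) + 2 * (1/5) * (1 - 1/5) * m"
  proof -
    have "real_of_int (sum_lo Hs) \<le> real_of_int S * (\<Sum>n\<le>18. h (n + 2))"
    proof -
      have "{..<19} = {..18::nat}"
        by auto
      then show ?thesis
        using sum_lo_correct[OF S Hs, unfolded habs] by (simp only:)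
    qed
    moreover have "real_of_int ((S * 1449239650) div 10 ^ 9) \<le> real_of_int S * m"
    proof -
      have "real_of_int ((S * 1449239650) div 10 ^ 9) \<le> real_of_int (S * 1449239650) / real_of_int (10 ^ 9)"
        by (rule real_of_int_div4)
      also have "\<dots> = real_of_int S * (1449239650 / 10 ^ 9)"
        by simp
      also have "\<dots> \<le> real_of_int S * m"
        using Spos m'(6) by (intro mult_left_mono) auto
      finally show ?thesis .
    qed
    ultimately have "real_of_int Q \<le> real_of_int S * (24 * (\<Sum>n\<le>18. h (n + 2)) + 8 * m)"
      unfolding Q_def by (simp add: algebra_simps)
    then show ?thesis
      using Spos by (simp add: Qr_def pos_divide_less_eq power2_eq_square algebra_simps)
  qed
  then show ?thesis
    using lb m' s row by (intro res_maj_mult_less[where Q = Qr and \<eta> = "1/5" and M = 18]) (auto simp: h_def)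
qed

lemma even_chain_correct:
  assumes S: "0 < S" and m: "m \<in> radii 1449239650 1449239655" and s: "0 < s" "s < 1"
  shows "0 < a \<Longrightarrow> even_chain S a bs \<Longrightarrow> bs \<noteq> [] \<Longrightarrow> l \<in> cell a (last bs) \<Longrightarrow>
    res_maj l (m * (1 + s)) * res_maj l (m * (1 - s)) < (res_maj l m)\<^sup>2"
proof (induction bs arbitrary: a)
  case (Cons b bs)
  have b: "even_check S a (cell_coeffs S 1449239650 1449239655 a b 20)" "a \<le> b" "b \<le> 5000000" "even_chain S b bs"
    using Cons.prems(2) by auto
  consider "l \<in> cell a b" | "bs \<noteq> []" "l \<in> cell b (last bs)"
    using Cons.prems(4) by (cases "bs = []"; cases "l \<le> real_of_int b / 10 ^ 7") (auto simp: cell_def)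
  then show ?case
  proof cases
    case 1
    then show ?thesis
      using even_check_correct[OF S Cons.prems(1) b(3) _ m s b(1)] by blast
  next
    case 2
    then show ?thesis
      using Cons.IH[OF _ b(4)] Cons.prems(1) b(2) by simp
  qed
qed simp

text \<open>
  The constant \<open>0.7003\<close> bounds \<open>0.26 m / (1 - q)\<close> for \<open>q = 577/1250\<close>.
\<close>

lemma res_maj_le_scaled:
  assumes S: "0 < S" and l: "0 < l" "l < 1" and m: "0 < m" "m \<le> 29/20" "50 * m / 157 \<le> 577/1250"
    and Hs: "list_all2 (encl S) (scaled_coeffs l m (Suc P)) Hs"
  shows "res_maj l m \<le> m + real_of_int (weighted_hi (rev (map (\<lambda>_. 1) [0..<P])) Hs) / real_of_int S
    + 7003/10000 * (577/1250) ^ Suc P / (l * (1 - l))"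
proof -
  define q :: real where "q = 577/1250"
  define c where "c = l * (1 - l)"
  have c: "0 < c" using l by (simp add: c_def)
  define h where "h n = \<bar>res_coeff l n\<bar> * m ^ n" for n
  have habs: "\<bar>res_coeff l n * m ^ n\<bar> = h n" for n
    using m by (simp add: h_def abs_mult)
  have head: "(\<Sum>n<P. h (n + 2)) \<le> real_of_int (weighted_hi (rev (map (\<lambda>_. 1) [0..<P])) Hs) / real_of_int S"
    using weighted_hi_correct[OF S _ Hs, of "\<lambda>_. 1", unfolded habs] S by (simp add: pos_le_divide_eq mult.commute)
  have sm: "summable h"
    unfolding h_def using l m by (intro summable_res_maj) auto
  have "res_maj l m = (\<Sum>n<P+2. h n) + (\<Sum>n. h (n + (P + 2)))"
  proof -
    have "res_maj l m = suminf h"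
      unfolding res_maj_def by (rule arg_cong[where f = suminf]) (auto simp: h_def)
    then show ?thesis
      using suminf_split_initial_segment[OF sm, of "P + 2"] by simp
  qed
  also have "(\<Sum>n<P+2. h n) = m + (\<Sum>n<P. h (n + 2))"
  proof -
    have "(\<Sum>n<P+2. h n) = (\<Sum>n<2. h n) + (\<Sum>n<P. h (n + 2))"
      by (induction P) (simp_all add: eval_nat_numeral)
    then show ?thesis
      using m by (simp add: h_def eval_nat_numeral)
  qed
  also have "(\<Sum>n. h (n + (P + 2))) \<le> (\<Sum>n. 13/50 * m / c * q ^ Suc P * q ^ n)"
  proof (rule suminf_le)
    fix n
    have "h (n + (P + 2)) \<le> 13/50 * m / c * q ^ (n + Suc P)"
      using scaled_coeff_tail[OF l c _ m, of "n + Suc P"] by (simp add: h_def q_def c_def)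
    then show "h (n + (P + 2)) \<le> 13/50 * m / c * q ^ Suc P * q ^ n"
      by (simp only: power_add mult_ac)
  next
    show "summable (\<lambda>n. h (n + (P + 2)))"
      using sm by (subst summable_iff_shift)
    show "summable (\<lambda>n. 13/50 * m / c * q ^ Suc P * q ^ n)"
      by (intro summable_mult summable_geometric) (simp add: q_def)
  qed
  also have "(\<Sum>n. 13/50 * m / c * q ^ Suc P * q ^ n) = 13/50 * m / c * q ^ Suc P / (1 - q)"
    by (subst suminf_mult) (simp_all add: q_def suminf_geometric summable_geometric)
  also have "\<dots> = (13/50 * m / (1 - q)) * (q ^ Suc P / c)"
    by simp
  also have "\<dots> \<le> 7003/10000 * (q ^ Suc P / c)"
    using m c by (intro mult_right_mono) (auto simp: q_def)
  finally show ?thesis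
    using head by (simp add: q_def c_def)
qed

lemma res_maj_ge_scaled:
  assumes S: "0 < S" and l: "0 < l" "l < 1" and m: "0 < m" "m < 157/50"
    and Hs: "list_all2 (encl S) (scaled_coeffs l m (Suc P)) Hs"
  shows "m + real_of_int (sum_lo Hs) / real_of_int S \<le> res_maj l m"
proof -
  define h where "h n = \<bar>res_coeff l n\<bar> * m ^ n" for n
  have habs: "\<bar>res_coeff l n * m ^ n\<bar> = h n" for n
    using m by (simp add: h_def abs_mult)
  have "real_of_int (sum_lo Hs) / real_of_int S \<le> (\<Sum>n<P. h (n + 2))"
    using sum_lo_correct[OF S Hs, unfolded habs] S by (simp add: pos_divide_le_eq mult.commute)
  moreover have "m + (\<Sum>n<P. h (n + 2)) = (\<Sum>n\<le>P+1. h n)"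
  proof -
    have "(\<Sum>n\<le>P+1. h n) = (\<Sum>n<2. h n) + (\<Sum>n<P. h (n + 2))"
      by (induction P) (simp_all add: eval_nat_numeral)
    then show ?thesis
      using m by (simp add: h_def eval_nat_numeral)
  qed
  moreover have "(\<Sum>n\<le>P+1. h n) \<le> res_maj l m"
    unfolding h_def using l m by (intro res_maj_partial_sum_le) auto
  ultimately show ?thesis
    by linarith
qed

section \<open>The computations\<close>

text \<open>
  The cells become shorter towards the maximum near 0.358655, where the slope vanishes, and need more
  coefficients there.
\<close>

lemma slope_chain_inc_1:
  "slope_chain True (2 ^ 30) 500000 [(902652, 8), (1181538, 8), (1492715, 8), (1762126, 12), (1881550, 10),
    (2020572, 10), (2085636, 10), (2125444, 10), (2575857, 8), (2878679, 10)]"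
  by code_simp

lemma slope_chain_inc_2:
  "slope_chain True (2 ^ 30) 2878679 [(3041553, 12), (3276277, 8), (3390822, 10), (3446720, 10), (3473999, 12),
    (3487311, 12), (3493807, 14), (3500000, 8), (3544303, 10), (3565922, 12)]"
  by code_simp

lemma slope_chain_inc_3:
  "slope_chain True (2 ^ 30) 3565922 [(3576472, 12), (3581620, 14), (3584133, 14), (3585359, 18), (3585957, 18),
    (3586249, 18)]"
  by code_simp

lemma slope_chain_inc_4:
  "slope_chain True (2 ^ 30) 3586249 [(3586428, 22), (3586492, 22), (3586522, 22), (3586530, 22)]"
  by code_simp

lemma slope_chain_dec_1:
  "slope_chain False (2 ^ 34) 3586570 [(3586595, 24), (3586637, 22), (3586753, 22)]"
  by code_simp

lemma slope_chain_dec_2: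
  "slope_chain False (2 ^ 30) 3586753 [(3586943, 18), (3587333, 18), (3588132, 18), (3589769, 18), (3593124, 14)]"
  by code_simp

lemma slope_chain_dec_3:
  "slope_chain False (2 ^ 30) 3593124 [(3600000, 14), (3615556, 12), (3643210, 12), (3720026, 12), (3845952, 8),
    (4104000, 8), (5000000, 8)]"
  by code_simp

text \<open>
  Around the maximum the slope has no sign, but it is small.
\<close>

lemma cell_slope_inner: "- 9 * 2 ^ 80 < cell_slope False (2 ^ 40) 3586530 3586570 24 * 10 ^ 5"
  by code_simp

lemma even_chain_1: "even_chain (2 ^ 30) 500000 [1107199, 1632466, 2151770, 2590992]"
  by code_simp

lemma even_chain_2: "even_chain (2 ^ 30) 2590992 [3015553, 3472353, 3874237, 4212704]"
  by code_simp

lemma even_chain_3: "even_chain (2 ^ 30) 4212704 [4521869, 4887937, 5000000]"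
  by code_simp

text \<open>
  At the left end 0.358653 of the interval around the maximum, for the lower and then for the upper bound of the
  critical radius.
\<close>

lemma critical_coeffs_hi:
  "weighted_hi (rev (map (\<lambda>_. 1) [0..<29])) (cell_coeffs (2 ^ 44) 1449239650 1449239650 3586530 3586530 30) * 10 ^ 11
     \<le> 63580918656 * 2 ^ 44"
  by code_simp

lemma critical_coeffs_lo:
  "63580919267 * 2 ^ 44 \<le> sum_lo (cell_coeffs (2 ^ 44) 1449239655 1449239655 3586530 3586530 28) * 10 ^ 11"
  by code_simp

lemma res_beta_inner_increasing: "beta_monotone True 500000 3586530"
proof -
  note c = slope_chain_correct[where S = "2 ^ 30" and inc = True]
  have b: "beta_monotone True 500000 2878679" "beta_monotone True 2878679 3565922"
    "beta_monotone True 3565922 3586249" "beta_monotone True 3586249 3586530"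
    using c[OF _ _ slope_chain_inc_1] c[OF _ _ slope_chain_inc_2] c[OF _ _ slope_chain_inc_3] c[OF _ _ slope_chain_inc_4]
    by simp_all
  show ?thesis
    by (rule beta_monotone_trans[OF beta_monotone_trans[OF beta_monotone_trans[OF b(1,2)] b(3)] b(4)]) simp_all
qed

lemma res_beta_outer_decreasing: "beta_monotone False 3586570 5000000"
proof -
  note c = slope_chain_correct[where inc = False]
  have b: "beta_monotone False 3586570 3586753" "beta_monotone False 3586753 3593124"
    "beta_monotone False 3593124 5000000"
    using c[OF _ _ slope_chain_dec_1] c[OF _ _ slope_chain_dec_2] c[OF _ _ slope_chain_dec_3]
    by simp_all
  show ?thesis
    by (rule beta_monotone_trans[OF beta_monotone_trans[OF b(1,2)] b(3)]) simp_all
qed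

lemma res_maj_off_diagonal:
  assumes l: "1/20 \<le> l" "l \<le> 1/2" and m: "m \<in> radii 1449239650 1449239655" and s: "0 < s" "s < 1"
  shows "res_maj l (m * (1 + s)) * res_maj l (m * (1 - s)) < (res_maj l m)\<^sup>2"
proof -
  note c = even_chain_correct[OF _ m s, where S = "2 ^ 30"]
  consider "l \<in> cell 500000 2590992" | "l \<in> cell 2590992 4212704" | "l \<in> cell 4212704 5000000"
    using l unfolding cell_def by fastforce
  then show ?thesis
    using c[OF _ _ even_chain_1] c[OF _ _ even_chain_2] c[OF _ _ even_chain_3] by cases simp_all
qed

lemma critical_res_beta_lower: "(res_beta (358653/10^6) (1449239650/10^9))\<^sup>2 \<le> 1 - 2 / 10 ^ 9"
proof -
  define l m :: real where "l = 358653/10^6" and "m = 1449239650/10^9"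
  have lm: "0 < l" "l < 1" "0 < m" "m \<le> 29/20" "50 * m / 157 \<le> 577/1250"
    by (simp_all add: l_def m_def)
  have Hs: "list_all2 (encl (2 ^ 44)) (scaled_coeffs l m (Suc 29)) (cell_coeffs (2 ^ 44) 1449239650 1449239650 3586530 3586530 30)"
    using cell_coeffs_correct[of "2 ^ 44" 3586530 3586530 1449239650 l m 1449239650 30] by (simp add: cell_def radii_def l_def m_def)
  have "real_of_int (weighted_hi (rev (map (\<lambda>_. 1) [0..<29])) (cell_coeffs (2 ^ 44) 1449239650 1449239650 3586530 3586530 30)) * 10 ^ 11 \<le> 63580918656 * 2 ^ 44"
    using critical_coeffs_hi[THEN of_int_le_iff[where 'a = real, THEN iffD2]]
    by (simp only: of_int_mult of_int_power of_int_numeral)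
  then have "res_maj l m \<le> m + 63580918656 / 10 ^ 11 + 7003/10000 * (577/1250) ^ 30 / (l * (1 - l))"
    using res_maj_le_scaled[OF _ lm Hs] by (simp add: field_simps)
  also have "\<dots> \<le> 20850488369 / 10 ^ 10"
    by (simp add: l_def m_def power_divide)
  finally have "(res_maj l m)\<^sup>2 \<le> (20850488369 / 10 ^ 10)\<^sup>2"
    using lm by (intro power_mono res_maj_nonneg) auto
  then have "l * (1 - l) * (res_maj l m)\<^sup>2 \<le> l * (1 - l) * (20850488369 / 10 ^ 10)\<^sup>2"
    using lm by (intro mult_left_mono) auto
  also have "\<dots> \<le> 1 - 2 / 10 ^ 9"
    by (simp add: l_def power_divide)
  finally show ?thesis
    using lm by (simp add: res_beta_def power_mult_distrib l_def m_def)
qed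

lemma critical_res_beta_upper: "1 < (res_beta (358653/10^6) (1449239655/10^9))\<^sup>2"
proof -
  define l m :: real where "l = 358653/10^6" and "m = 1449239655/10^9"
  have lm: "0 < l" "l < 1" "0 < m" "m < 157/50"
    by (simp_all add: l_def m_def)
  have Hs: "list_all2 (encl (2 ^ 44)) (scaled_coeffs l m (Suc 27)) (cell_coeffs (2 ^ 44) 1449239655 1449239655 3586530 3586530 28)"
    using cell_coeffs_correct[of "2 ^ 44" 3586530 3586530 1449239655 l m 1449239655 28] by (simp add: cell_def radii_def l_def m_def)
  have "63580919267 * 2 ^ 44 \<le> real_of_int (sum_lo (cell_coeffs (2 ^ 44) 1449239655 1449239655 3586530 3586530 28)) * 10 ^ 11"
    using critical_coeffs_lo[THEN of_int_le_iff[where 'a = real, THEN iffD2]]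
    by (simp only: of_int_mult of_int_power of_int_numeral)
  then have "m + 63580919267 / 10 ^ 11 \<le> res_maj l m"
    using res_maj_ge_scaled[OF _ lm Hs] by (simp add: field_simps)
  then have "(m + 63580919267 / 10 ^ 11)\<^sup>2 \<le> (res_maj l m)\<^sup>2"
    using lm by (intro power_mono) auto
  then have "l * (1 - l) * (m + 63580919267 / 10 ^ 11)\<^sup>2 \<le> l * (1 - l) * (res_maj l m)\<^sup>2"
    using lm by (intro mult_left_mono) auto
  moreover have "1 < l * (1 - l) * (m + 63580919267 / 10 ^ 11)\<^sup>2"
    by (simp add: l_def m_def power2_eq_square)
  ultimately show ?thesis
    using lm by (simp add: res_beta_def power_mult_distrib l_def m_def)
qed

text \<open>
  Outside the interval around the maximum monotonicity reduces the claim to the ends of that interval. Inside,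
  the small slope and the small length of the interval, \<open>2 * 10\<^sup>-\<^sup>5\<close> in the angle, change the value
  at the left end by less than its distance to 1.
\<close>

lemma res_beta_lower_radius_less_1:
  assumes l: "1/20 \<le> l" "l \<le> 1/2"
  shows "res_beta l (1449239650/10^9) < 1"
proof -
  define m :: real where "m = 1449239650/10^9"
  define a b :: real where "a = 358653/10^6" and "b = 358657/10^6"
  have m: "m \<in> radii 1449239650 1449239655"
    by (simp add: m_def radii_def)
  have A: "res_beta a m \<le> 1 - 99 / 10 ^ 11"
  proof (rule power2_le_imp_le)
    show "(res_beta a m)\<^sup>2 \<le> (1 - 99 / 10 ^ 11)\<^sup>2"
      by (rule order_trans[OF critical_res_beta_lower[folded a_def m_def]]) (simp add: power2_eq_square)
  qed simp
  have B: "res_beta k m \<le> res_beta a m + 9 / 10 ^ 10" if k: "a \<le> k" "k \<le> b" for k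
  proof -
    have cells: "a \<in> cell 3586530 3586570" "k \<in> cell 3586530 3586570"
      using k by (auto simp: cell_def a_def b_def)
    define \<delta> where "\<delta> = angle k - angle a"
    have ang: "0 \<le> angle a" "angle a \<le> angle k" "angle k \<le> pi" "half_cos (angle a) = a" "half_cos (angle k) = k"
      using angle_props[of a] angle_props[of k] angle_less[of a k] k by (cases "a = k"; force simp: a_def b_def)+
    have \<delta>: "0 \<le> \<delta>" "\<delta> \<le> 2/10^5"
    proof -
      show "0 \<le> \<delta>"
        using ang by (simp add: \<delta>_def)
      show "\<delta> \<le> 2/10^5"
      proof (cases "angle a < angle k")
        case True
        have D: "(half_cos has_real_derivative sin t / 2) (at t)" for t
          unfolding half_cos_def by (auto intro!: derivative_eq_intros)
        obtain z where z: "angle a < z" "z < angle k" "half_cos (angle k) - half_cos (angle a) = (angle k - angle a) * (sin z / 2)"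
          using MVT2[OF True, of half_cos "\<lambda>t. sin t / 2"] D by blast
        have "a \<le> half_cos z" "half_cos z \<le> k"
          using half_cos_mono[of "angle a" z] half_cos_mono[of z "angle k"] z ang by auto
        then have "a * (1 - a) \<le> (sin z / 2)\<^sup>2"
          using k logistic_mono[of a "half_cos z"] by (simp add: half_cos_mult b_def)
        then have "(1/5)\<^sup>2 \<le> (sin z / 2)\<^sup>2"
          by (simp add: a_def power2_eq_square)
        moreover have "0 \<le> sin z / 2"
          using z ang by (simp add: sin_ge_zero)
        ultimately have "1/5 \<le> sin z / 2"
          by (rule power2_le_imp_le)
        then have "\<delta> * (1/5) \<le> \<delta> * (sin z / 2)"
          using True by (intro mult_left_mono) (auto simp: \<delta>_def)
        also have "\<dots> = k - a"
          using z(3) by (simp add: ang \<delta>_def)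
        finally show ?thesis
          using k by (simp add: a_def b_def)
      qed (simp add: \<delta>_def)
    qed
    have "- 9 / 10 ^ 5 / (2 * m) * \<delta> \<le> real_of_int (cell_slope False (2 ^ 40) 3586530 3586570 24) / (real_of_int (2 ^ 40))\<^sup>2 / (2 * m) * \<delta>"
    proof (intro mult_right_mono divide_right_mono)
      have "- 9 * 2 ^ 80 \<le> real_of_int (cell_slope False (2 ^ 40) 3586530 3586570 24) * 10 ^ 5"
        using cell_slope_inner[THEN less_imp_le, THEN of_int_le_iff[where 'a = real, THEN iffD2]]
        by (simp only: of_int_mult of_int_power of_int_numeral of_int_minus)
      then show "- 9 / 10 ^ 5 \<le> real_of_int (cell_slope False (2 ^ 40) 3586530 3586570 24) / (real_of_int (2 ^ 40))\<^sup>2"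
        by (simp add: field_simps)
    qed (use \<delta> in \<open>auto simp: m_def\<close>)
    also have "\<dots> \<le> direction False * (res_beta k m - res_beta a m)"
      unfolding \<delta>_def using cells m k by (intro cell_slope_correct) auto
    finally show ?thesis
      using \<delta> by (simp add: direction_def m_def)
  qed
  consider "l < a" | "a \<le> l" "l \<le> b" | "b < l"
    by linarith
  then have "res_beta l m < 1"
  proof cases
    case 1
    have "0 < direction True * (res_beta a m - res_beta l m)"
      using res_beta_inner_increasing m 1 l unfolding beta_monotone_def by (auto simp: cell_def a_def)
    then show ?thesis
      using A by (simp add: direction_def)
  next
    case 2
    then show ?thesis
      using A B[of l] by simp
  next
    case 3
    have "0 < direction False * (res_beta l m - res_beta b m)"
      using res_beta_outer_decreasing m 3 l unfolding beta_monotone_def by (auto simp: cell_def b_def)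
    then show ?thesis
      using A B[of b] by (simp add: direction_def a_def b_def)
  qed
  then show ?thesis
    by (simp add: m_def)
qed

section \<open>The critical radius\<close>

lemma exp_sum_le_20:
  fixes x y :: real
  assumes "x + y \<le> 29/10"
  shows "exp x * exp y \<le> 20"
proof -
  have "exp 1 \<le> (272/100 :: real)"
    using e_less_272 by simp
  then have "exp (1::real) ^ 3 \<le> (272/100) ^ 3"
    by (intro power_mono) auto
  then have e3: "exp (3::real) \<le> (272/100) ^ 3"
    by (simp add: exp_of_nat_mult[of 3 1, simplified])
  have "exp (x + y) * (11/10) \<le> exp (29/10) * exp (1/10)"
    using assms exp_ge_add_one_self[of "1/10::real"] by (intro mult_mono) auto
  also have "\<dots> = exp (3::real)"
    by (simp add: exp_add[symmetric])
  also note e3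
  finally have "exp (x + y) \<le> (272/100) ^ 3 * (10/11)"
    by simp
  also have "\<dots> \<le> (20 :: real)"
    by (simp add: power3_eq_cube)
  finally show ?thesis
    by (simp add: exp_add)
qed

text \<open>
  With \<open>u = e\<^sup>x - 1\<close> and \<open>v = e\<^sup>y - 1\<close> the inequality \<open>l (1 - l) a b < 1\<close> amounts to
  \<open>l (1 - 2 l) u v + l (u + v) < 1\<close>, and the left-hand side is at most \<open>l (e\<^sup>x\<^sup>+\<^sup>y - 1)\<close>.
\<close>

lemma small_parameter_majorant:
  fixes l x y :: real
  assumes l: "0 \<le> l" "l \<le> 1/20" and xy: "0 \<le> x" "0 \<le> y" "x + y \<le> 29/10"
  defines "a \<equiv> (exp x - 1) / (1 - l * (exp x - 1))" and "b \<equiv> (exp y - 1) / (1 - l * (exp y - 1))"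
  shows "l * (exp x - 1) < 1" "a \<le> 400" "l * (1 - l) * (a * b) \<le> 19/20"
proof -
  define u v where "u = exp x - 1" and "v = exp y - 1"
  have uv: "0 \<le> u" "0 \<le> v"
    using xy by (auto simp: u_def v_def)
  have S: "u * v + u + v \<le> 19"
    using exp_sum_le_20[OF xy(3)] by (simp add: u_def v_def algebra_simps)
  have "u \<le> 19" "v \<le> 19"
    using S uv mult_nonneg_nonneg[OF uv] by linarith+
  then have lu: "l * u \<le> 19/20" "l * v \<le> 19/20"
    using mult_mono[of l "1/20" u 19] mult_mono[of l "1/20" v 19] l uv by auto
  then show "l * (exp x - 1) < 1"
    by (simp add: u_def)
  have ab: "a = u / (1 - l * u)" "b = v / (1 - l * v)"
    by (simp_all add: a_def b_def u_def v_def)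
  have "1/20 \<le> 1 - l * u"
    using lu by linarith
  then have "380 * (1/20) \<le> 380 * (1 - l * u)"
    by (intro mult_left_mono) auto
  then have "u \<le> 380 * (1 - l * u)"
    using \<open>u \<le> 19\<close> by simp
  then show "a \<le> 400"
    using lu by (simp add: ab pos_divide_le_eq) 
  define D where "D = (1 - l * u) * (1 - l * v)"
  have D: "0 < D" "D \<le> 1"
    unfolding D_def using lu l uv by (auto intro!: mult_le_one)
  have "l * (u * v + u + v) \<le> 1/20 * 19"
    using l S uv by (intro mult_mono) auto
  moreover have "0 \<le> l * l * (u * v)"
    using uv by simp
  ultimately have "l * (1 - l) * (u * v) \<le> D - 1/20"
    by (simp add: D_def algebra_simps)
  also have "\<dots> \<le> 19/20 * D"
    using D by simp
  finally have "l * (1 - l) * (u * v) \<le> 19/20 * D" .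
  then have "l * (1 - l) * (u * v) / D \<le> 19/20"
    using D by (simp add: pos_divide_le_eq)
  then show "l * (1 - l) * (a * b) \<le> 19/20"
    by (simp add: ab D_def)
qed

lemma logistic_lower:
  fixes a l :: real
  assumes "a \<le> l" "l \<le> 1 - a"
  shows "a * (1 - a) \<le> l * (1 - l)"
  using mult_nonneg_nonneg[of "l - a" "1 - a - l"] assms by (simp add: algebra_simps)

lemma res_maj_0: "res_maj l 0 = 0"
proof -
  have "(\<lambda>n. \<bar>res_coeff l n\<bar> * 0 ^ n) = (\<lambda>_. 0)"
    by (auto simp: power_0_left)
  then show ?thesis
    by (simp add: res_maj_def)
qed

lemma res_maj_bound:
  fixes l x :: real
  assumes l: "0 < l" "l < 1" and x: "0 \<le> x" "x \<le> 29/10"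
  shows "l * (1 - l) * res_maj l x \<le> 10"
proof -
  define c where "c = l * (1 - l)"
  have c: "0 < c"
    using l by (simp add: c_def)
  define h where "h n = \<bar>res_coeff l n\<bar> * x ^ n" for n
  have sm: "summable h"
    unfolding h_def using l x by (intro summable_res_maj) auto
  have "res_maj l x = suminf h"
    unfolding res_maj_def by (rule arg_cong[where f = suminf]) (auto simp: h_def)
  also have "\<dots> = (\<Sum>n. h (Suc n))"
    using suminf_split_head[OF sm] by (simp add: h_def)
  also have "\<dots> \<le> (\<Sum>n. 13/50 * x / c * (50 * x / 157) ^ n)"
  proof (rule suminf_le)
    fix n
    have "\<bar>res_coeff l (Suc n)\<bar> \<le> 13/50 * (50/157) ^ n / c"
      using res_coeff_Suc_bound[of l n] l c unfolding c_def[symmetric] by (subst pos_le_divide_eq) (auto simp: mult.commute)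
    then have "h (Suc n) \<le> 13/50 * (50/157) ^ n / c * x ^ Suc n"
      unfolding h_def using x by (intro mult_right_mono) auto
    also have "\<dots> = 13/50 * x / c * (50 * x / 157) ^ n"
      by (simp add: power_divide power_mult_distrib field_simps)
    finally show "h (Suc n) \<le> 13/50 * x / c * (50 * x / 157) ^ n" .
  next
    show "summable (\<lambda>n. h (Suc n))"
      using sm by (simp add: summable_Suc_iff)
    show "summable (\<lambda>n. 13/50 * x / c * (50 * x / 157) ^ n)"
      using x by (intro summable_mult summable_geometric) auto
  qed
  also have "\<dots> = 13/50 * x / c * (1 / (1 - 50 * x / 157))"
    using x by (subst suminf_mult) (auto simp: suminf_geometric intro!: summable_geometric)
  also have "\<dots> \<le> 10 / c"
  proof -
    have "13/50 * x \<le> 10 * (1 - 50 * x / 157)"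
      using x by simp
    then have "13/50 * x * (1 / (1 - 50 * x / 157)) \<le> 10"
      using x by (simp add: divide_le_eq)
    then have "13/50 * x * (1 / (1 - 50 * x / 157)) / c \<le> 10 / c"
      using c by (intro divide_right_mono) auto
    then show ?thesis
      by (simp only: times_divide_eq_left[of "13/50 * x" c])
  qed
  finally show ?thesis
    using c by (simp add: c_def pos_le_divide_eq mult.commute)
qed

text \<open>
  A majorant that is bounded uniformly in \<open>l \<in> [0, 1]\<close>: the differential comparison takes over where
  \<open>l (1 - l)\<close> is small.
\<close>

definition param_maj :: "real \<Rightarrow> real \<Rightarrow> real" where
  "param_maj l x = (if 1/20 \<le> l \<and> l \<le> 19/20 then res_maj l x
     else (exp x - 1) / (1 - min l (1 - l) * (exp x - 1)))"

lemma abs_res_coeff_min: "\<bar>res_coeff (min l (1 - l)) n\<bar> = \<bar>res_coeff l n\<bar>" for l :: real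
  by (simp add: min_def res_coeff_reflect abs_mult power_abs)

lemma param_maj_partial_sum:
  assumes "0 \<le> l" "l \<le> 1" "0 \<le> x" "x \<le> 29/10"
  shows "(\<Sum>n\<le>N. \<bar>res_coeff l n\<bar> * x ^ n) \<le> param_maj l x"
proof (cases "1/20 \<le> l \<and> l \<le> 19/20")
  case True
  then show ?thesis
    using assms by (auto simp: param_maj_def intro!: res_maj_partial_sum_le)
next
  case False
  then have k: "0 \<le> min l (1 - l)" "min l (1 - l) \<le> 1/20"
    using assms by (auto simp: min_def)
  have "(\<Sum>n\<le>N. \<bar>res_coeff (min l (1 - l)) n\<bar> * x ^ n) \<le> (exp x - 1) / (1 - min l (1 - l) * (exp x - 1))"
    using k assms small_parameter_majorant(1)[OF k, of x 0] by (intro res_coeff_partial_sum_small) auto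
  then show ?thesis
    unfolding param_maj_def if_not_P[OF False] abs_res_coeff_min .
qed

lemma param_maj_le_400:
  assumes "0 \<le> l" "l \<le> 1" "0 \<le> x" "x \<le> 29/10"
  shows "param_maj l x \<le> 400"
proof (cases "1/20 \<le> l \<and> l \<le> 19/20")
  case True
  have c: "19/400 \<le> l * (1 - l)"
    using logistic_lower[of "1/20" l] True by simp
  have "19/400 * res_maj l x \<le> l * (1 - l) * res_maj l x"
    using c True assms by (intro mult_right_mono res_maj_nonneg) auto
  also have "\<dots> \<le> 10"
    using True assms by (intro res_maj_bound) auto
  finally show ?thesis
    using True by (simp add: param_maj_def)
next
  case False
  then have k: "0 \<le> min l (1 - l)" "min l (1 - l) \<le> 1/20"
    using assms by (auto simp: min_def)
  show ?thesis
    using small_parameter_majorant(2)[OF k, of x 0] assms unfolding param_maj_def if_not_P[OF False] by simp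
qed

lemma param_maj_edge:
  assumes "0 \<le> l" "l \<le> 1" "\<not> (1/20 \<le> l \<and> l \<le> 19/20)" "0 \<le> x" "0 \<le> y" "x + y \<le> 29/10"
  shows "l * (1 - l) * (param_maj l x * param_maj l y) \<le> 19/20"
proof -
  have k: "0 \<le> min l (1 - l)" "min l (1 - l) \<le> 1/20"
    using assms by (auto simp: min_def)
  have e: "l * (1 - l) = min l (1 - l) * (1 - min l (1 - l))"
    by (simp add: min_def)
  show ?thesis
    unfolding param_maj_def if_not_P[OF assms(3)] e by (rule small_parameter_majorant(3)[OF k assms(4-6)])
qed

abbreviation parameter_box :: "(real \<times> real) set" where
  "parameter_box \<equiv> {1/20..1/2} \<times> radii 1449239650 1449239655"

text \<open>
  The series converges uniformly on the box, by the decay of the coefficients.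
\<close>

lemma continuous_on_res_beta: "continuous_on parameter_box (\<lambda>p. res_beta (fst p) (snd p))"
proof -
  have lim: "uniform_limit parameter_box (\<lambda>n p. \<Sum>i<n. \<bar>res_coeff (fst p) i\<bar> * snd p ^ i) (\<lambda>p. \<Sum>i. \<bar>res_coeff (fst p) i\<bar> * snd p ^ i) sequentially"
  proof (rule Weierstrass_m_test)
    fix n p assume "p \<in> parameter_box"
    then obtain l m where p: "p = (l, m)" "1/20 \<le> l" "l \<le> 1/2" "0 < m" "m \<le> 29/20" "50 * m / 157 \<le> 577/1250"
      by (cases p) (auto simp: radii_def)
    have c: "19/400 \<le> l * (1 - l)"
      using logistic_lower[of "1/20" l] p by simp
    show "norm (\<bar>res_coeff (fst p) n\<bar> * snd p ^ n) \<le> 20 * (577/1250) ^ n"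
    proof (cases n)
      case (Suc k)
      have "\<bar>res_coeff l (Suc k)\<bar> * m ^ Suc k \<le> 13/50 * m / (19/400) * (577/1250) ^ k"
        using p c by (intro scaled_coeff_tail) auto
      also have "\<dots> \<le> 20 * (577/1250) * (577/1250) ^ k"
        using p by (intro mult_right_mono) auto
      finally show ?thesis
        using p by (simp add: Suc abs_mult)
    qed (simp add: p)
  next
    show "summable (\<lambda>n. 20 * (577/1250) ^ n :: real)"
      by (intro summable_mult summable_geometric) auto
  qed
  have coeff: "continuous_on parameter_box (\<lambda>p. res_coeff (fst p) n)" for n
  proof -
    have "continuous_on UNIV (\<lambda>l::real. res_coeff l n)"
      using has_real_derivative_res_coeff by (intro continuous_at_imp_continuous_on) (blast intro: DERIV_isCont)
    then show ?thesis
      by (rule continuous_on_compose2[where f = fst]) (auto intro: continuous_intros)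
  qed
  have "continuous_on parameter_box (\<lambda>p. \<Sum>i<n. \<bar>res_coeff (fst p) i\<bar> * snd p ^ i)" for n
    by (intro continuous_on_sum continuous_on_mult continuous_on_rabs continuous_on_power continuous_on_snd continuous_on_id coeff)
  then have maj: "continuous_on parameter_box (\<lambda>p. \<Sum>i. \<bar>res_coeff (fst p) i\<bar> * snd p ^ i)"
    by (intro uniform_limit_theorem[OF always_eventually[OF allI] lim]) auto
  have "continuous_on parameter_box (\<lambda>p. sqrt (fst p * (1 - fst p)))"
    by (intro continuous_on_real_sqrt continuous_on_mult continuous_on_diff continuous_on_const continuous_on_fst continuous_on_id)
  from continuous_on_mult[OF this maj] show ?thesis
    unfolding res_beta_def res_maj_def .
qed

lemma res_beta_square: "0 < l \<Longrightarrow> l < 1 \<Longrightarrow> (res_beta l m)\<^sup>2 = l * (1 - l) * (res_maj l m)\<^sup>2"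
  by (simp add: res_beta_def power_mult_distrib)

lemma res_beta_nonneg: "0 < l \<Longrightarrow> l < 1 \<Longrightarrow> 0 \<le> m \<Longrightarrow> m < 157/50 \<Longrightarrow> 0 \<le> res_beta l m"
  by (simp add: res_beta_def res_maj_nonneg)

text \<open>
  The radius at which the maximum of \<open>\<beta>\<close> over the parameter is equal to 1. Such a radius is unique
  because \<open>C2\<close> is twice its value.
\<close>

definition critical_radius :: "real \<Rightarrow> bool" where
  "critical_radius m \<longleftrightarrow> m \<in> radii 1449239650 1449239655 \<and> m < 1449239655/10^9
     \<and> (\<exists>l. 1/20 \<le> l \<and> l \<le> 1/2 \<and> res_beta l m = 1)
     \<and> (\<forall>l. 1/20 \<le> l \<and> l \<le> 1/2 \<longrightarrow> res_beta l m \<le> 1)"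

text \<open>
  The points of the box with \<open>\<beta> \<ge> 1\<close> form a nonempty compact set; one with the least radius is
  taken. If \<open>\<beta>\<close> exceeded 1 at that radius for some \<open>l\<close>, the intermediate value theorem would give a smaller
  radius with \<open>\<beta> = 1\<close>.
\<close>

lemma critical_radius_exists: "\<exists>m. critical_radius m"
proof -
  define r1 r2 :: real where "r1 = 1449239650/10^9" and "r2 = 1449239655/10^9"
  have R: "radii 1449239650 1449239655 = {r1..r2}"
    by (simp add: radii_def r1_def r2_def)
  define T where "T = {p \<in> parameter_box. 1 \<le> res_beta (fst p) (snd p)}"
  have "compact parameter_box"
    by (intro compact_Times) (auto simp: R)
  moreover have "closed T"
    unfolding T_def using continuous_on_res_beta \<open>compact parameter_box\<close> continuous_on_const
    by (intro continuous_on_closed_Collect_le) (auto dest: compact_imp_closed)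
  ultimately have "compact T"
    using compact_Int_closed[of parameter_box T] by (simp add: T_def Int_absorb1 inf_absorb2)
  have up: "1 < res_beta (358653/10^6) r2"
    using critical_res_beta_upper res_beta_nonneg[of "358653/10^6" r2] power2_le_iff_abs_le[of 1 "res_beta (358653/10^6) r2"]
      power_le_one[of "res_beta (358653/10^6) r2" 2] by (force simp: r2_def)
  then have "(358653/10^6, r2) \<in> T"
    by (auto simp: T_def R r1_def r2_def)
  then have "T \<noteq> {}"
    by blast
  have "continuous_on T snd"
    by (intro continuous_intros)
  from continuous_attains_inf[OF \<open>compact T\<close> \<open>T \<noteq> {}\<close> this]
  obtain p where p: "p \<in> T" "\<And>p'. p' \<in> T \<Longrightarrow> snd p \<le> snd p'"
    by blast
  define l0 m where "l0 = fst p" and "m = snd p"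
  have lm: "1/20 \<le> l0" "l0 \<le> 1/2" "r1 \<le> m" "m \<le> r2" "1 \<le> res_beta l0 m"
    using p(1) by (auto simp: T_def R l0_def m_def)
  have le1: "res_beta l m \<le> 1" if l: "1/20 \<le> l" "l \<le> 1/2" for l
  proof (rule ccontr)
    assume gt: "\<not> res_beta l m \<le> 1"
    have "continuous_on {r1..m} (\<lambda>r. res_beta l r)"
    proof -
      have "continuous_on {r1..m} (\<lambda>r. res_beta (fst (l, r)) (snd (l, r)))"
        by (rule continuous_on_compose2[OF continuous_on_res_beta, where f = "\<lambda>r. (l, r)"])
          (use l lm in \<open>auto intro!: continuous_intros simp: R\<close>)
      then show ?thesis
        by simp
    qed
    then obtain r where r: "r1 \<le> r" "r \<le> m" "res_beta l r = 1"
      using IVT'[of "\<lambda>r. res_beta l r" r1 1 m] res_beta_lower_radius_less_1[OF l] gt lm by (auto simp: r1_def)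
    have "(l, r) \<in> T"
      using r l lm by (auto simp: T_def R)
    then have "m \<le> r"
      using p(2) by (force simp: m_def)
    with r gt show False
      by simp
  qed
  have "m \<noteq> r2"
    using up le1[of "358653/10^6"] by auto
  moreover have "res_beta l0 m = 1"
    using lm le1[of l0] by simp
  ultimately have "critical_radius m"
    unfolding critical_radius_def using lm le1 by (auto simp: R r2_def)
  then show ?thesis
    by blast
qed

text \<open>
  For a pair with sum \<open>2 m\<close> the off-diagonal inequality compares with the diagonal, where the product is
  \<open>\<beta>\<^sup>2 \<le> 1\<close>. It does not cover the case that one of \<open>x\<close>, \<open>y\<close> vanishes, in which the product is 0.
\<close>

lemma critical_product:
  assumes m: "critical_radius m" and l: "1/20 \<le> l" "l \<le> 19/20" and xy: "0 \<le> x" "0 \<le> y" "x + y = 2 * m"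
  shows "l * (1 - l) * (res_maj l x * res_maj l y) \<le> 1"
    and "x \<noteq> y \<Longrightarrow> l * (1 - l) * (res_maj l x * res_maj l y) < 1"
proof -
  define k where "k = min l (1 - l)"
  have k: "1/20 \<le> k" "k \<le> 1/2" "l * (1 - l) = k * (1 - k)" "res_maj l z = res_maj k z" for z
    using l by (auto simp: k_def min_def res_maj_reflect)
  have mr: "m \<in> radii 1449239650 1449239655" "0 < m" "m < 157/50"
    using m by (auto simp: critical_radius_def radii_def)
  have "res_beta k m \<le> 1" "0 \<le> res_beta k m"
    using m k mr by (auto simp: critical_radius_def intro!: res_beta_nonneg)
  then have diag: "k * (1 - k) * (res_maj k m)\<^sup>2 \<le> 1"
    using res_beta_square[of k m] k power_le_one[of "res_beta k m" 2] by simp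
  have less: "k * (1 - k) * (res_maj k a * res_maj k b) < 1" if ab: "0 \<le> b" "b < a" "a + b = 2 * m" for a b
  proof (cases "b = 0")
    case True
    then show ?thesis
      by (simp add: res_maj_0)
  next
    case False
    define s where "s = (a - b) / (2 * m)"
    have ms: "m * s = (a - b) / 2"
      using mr by (simp add: s_def)
    have "a = m + (a - b) / 2" "b = m - (a - b) / 2"
      using ab(3) by (simp_all add: field_simps)
    then have s: "a = m * (1 + s)" "b = m * (1 - s)"
      unfolding distrib_left right_diff_distrib mult_1_right ms .
    have s01: "0 < s" "s < 1"
      using ab mr False by (simp_all add: s_def)
    have "res_maj k a * res_maj k b < (res_maj k m)\<^sup>2"
      unfolding s by (rule res_maj_off_diagonal[OF k(1,2) mr(1) s01])
    then have "k * (1 - k) * (res_maj k a * res_maj k b) < k * (1 - k) * (res_maj k m)\<^sup>2"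
      using k by (intro mult_strict_left_mono) auto
    with diag show ?thesis
      by linarith
  qed
  have neq: "k * (1 - k) * (res_maj k x * res_maj k y) < 1" if "x \<noteq> y"
    using less[of y x] less[of x y] xy that by (cases "x < y") (auto simp: mult.commute add.commute)
  then show "x \<noteq> y \<Longrightarrow> l * (1 - l) * (res_maj l x * res_maj l y) < 1"
    by (simp add: k)
  show "l * (1 - l) * (res_maj l x * res_maj l y) \<le> 1"
  proof (cases "x = y")
    case True
    then show ?thesis
      using diag xy by (simp add: k power2_eq_square)
  next
    case False
    then show ?thesis
      using neq by (simp add: k)
  qed
qed

text \<open>
  Stretching \<open>(x, y)\<close> to the critical sum by the factor \<open>1/t\<close> shows that the ratio of the geometric
  series is at most \<open>t\<^sup>2\<close>.
\<close>

lemma Gamma_BCH_real_finite_below: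
  assumes m: "critical_radius m" and xy: "0 \<le> x" "0 \<le> y" "x + y < 2 * m"
  shows "Gamma_BCH_real x y \<noteq> \<infinity>"
proof -
  have mr: "0 < m" "2 * m \<le> 29/10"
    using m by (auto simp: critical_radius_def radii_def)
  define t where "t = (x + y) / (2 * m)"
  have t: "0 \<le> t" "t < 1"
    using xy mr by (auto simp: t_def)
  have inner: "l * (1 - l) * (res_maj l x * res_maj l y) \<le> t\<^sup>2" if l: "1/20 \<le> l" "l \<le> 19/20" for l
  proof (cases "t = 0")
    case True
    then have "x = 0"
      using xy mr by (simp add: t_def)
    then show ?thesis
      by (simp add: res_maj_0)
  next
    case False
    then have t0: "0 < t"
      using t by simp
    have sc: "x / t \<le> 2 * m" "y / t \<le> 2 * m" "0 \<le> x / t" "0 \<le> y / t" "x / t + y / t = 2 * m"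
    proof -
      have "x + y = t * (2 * m)"
        using mr by (simp add: t_def)
      then show s: "x / t + y / t = 2 * m"
        using t0 by (simp add: add_divide_distrib[symmetric])
      show nn: "0 \<le> x / t" "0 \<le> y / t"
        using t0 xy by auto
      from s nn show "x / t \<le> 2 * m" "y / t \<le> 2 * m"
        by linarith+
    qed
    have l01: "0 < l" "l < 1"
      using l by linarith+
    have lt: "x / t < 157/50" "y / t < 157/50" "y < 157/50"
      using sc(1,2) mr xy by linarith+
    have tt: "0 \<le> t" "t \<le> 1" "t * (x / t) = x" "t * (y / t) = y"
      using t t0 by simp_all
    have le: "res_maj l x \<le> t * res_maj l (x / t)" "res_maj l y \<le> t * res_maj l (y / t)"
      using res_maj_scale[OF l01 sc(3) lt(1) tt(1,2)] res_maj_scale[OF l01 sc(4) lt(2) tt(1,2)]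
      unfolding tt(3,4) .
    have "0 \<le> t * res_maj l (x / t)" "0 \<le> res_maj l y"
      using res_maj_nonneg[OF l01 sc(3) lt(1)] res_maj_nonneg[OF l01 xy(2) lt(3)] tt(1) by simp_all
    then have "res_maj l x * res_maj l y \<le> (t * res_maj l (x / t)) * (t * res_maj l (y / t))"
      using mult_mono[OF le] by blast
    then have "l * (1 - l) * (res_maj l x * res_maj l y) \<le> l * (1 - l) * ((t * res_maj l (x / t)) * (t * res_maj l (y / t)))"
      using l by (intro mult_left_mono) auto
    also have "\<dots> = t\<^sup>2 * (l * (1 - l) * (res_maj l (x / t) * res_maj l (y / t)))"
      by (simp add: power2_eq_square)
    also have "\<dots> \<le> t\<^sup>2 * 1"
      using sc by (intro mult_left_mono critical_product(1)[OF m l]) auto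
    finally show ?thesis
      by simp
  qed
  have x': "x \<le> 29/10" "y \<le> 29/10" "x + y \<le> 29/10"
    using xy mr by auto
  show ?thesis
  proof (rule Gamma_BCH_real_finite[OF xy(1,2), where a = "\<lambda>l. param_maj l x" and b = "\<lambda>l. param_maj l y" and A = 400 and \<kappa> = "max (t\<^sup>2) (19/20)"])
    show "(\<Sum>n\<le>N. \<bar>res_coeff l n\<bar> * x ^ n) \<le> param_maj l x" "(\<Sum>n\<le>N. \<bar>res_coeff l n\<bar> * y ^ n) \<le> param_maj l y"
      if "0 \<le> l" "l \<le> 1" for l N
      using that x' xy by (auto intro: param_maj_partial_sum)
    show "param_maj l x \<le> 400 \<and> param_maj l y \<le> 400" if "0 \<le> l" "l \<le> 1" for l
      using that x' xy by (auto intro: param_maj_le_400)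
    show "l * (1 - l) * (param_maj l x * param_maj l y) \<le> max (t\<^sup>2) (19/20)" if "0 \<le> l" "l \<le> 1" for l
    proof (cases "1/20 \<le> l \<and> l \<le> 19/20")
      case True
      then show ?thesis
        using inner[of l] by (simp add: param_maj_def le_max_iff_disj)
    next
      case False
      then show ?thesis
        using param_maj_edge[OF that False xy(1,2) x'(3)] by (simp add: le_max_iff_disj)
    qed
    show "max (t\<^sup>2) (19/20) < 1"
      using t by (simp add: power_less_one_iff abs_square_less_1)
  qed
qed

section \<open>Divergence at the critical radius\<close>

lemma sum_convolution_le_square:
  fixes g :: "nat \<Rightarrow> real"
  assumes "\<And>i. 0 \<le> g i"
  shows "(\<Sum>k\<le>A. \<Sum>i\<le>k. g i * g (k - i)) \<le> (\<Sum>i\<le>A. g i)\<^sup>2"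
proof -
  have "(\<Sum>k\<le>A. \<Sum>i\<le>k. g i * g (k - i)) = (\<Sum>(i, j)\<in>{(i, j). i + j \<le> A}. g i * g j)"
    by (rule sum.triangle_reindex_eq[symmetric])
  also have "\<dots> \<le> (\<Sum>(i, j)\<in>{..A} \<times> {..A}. g i * g j)"
    using assms by (intro sum_mono2) auto
  also have "\<dots> = (\<Sum>i\<le>A. g i)\<^sup>2"
    by (simp add: power2_eq_square sum_product sum.cartesian_product)
  finally show ?thesis .
qed

text \<open>
  On \<open>[1/25, 24/25]\<close> the majorant at the radius is at most \<open>10 / (l (1 - l)) \<le> 261\<close>. The derivative
  of the coefficients in \<open>l\<close> is given by the square of the resolvent, whose majorant is at most the
  square of that of the resolvent. Both bounds are independent of \<open>A\<close>.
\<close>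

lemma signed_sum_bounds:
  fixes s :: "nat \<Rightarrow> real"
  assumes s: "\<And>k. \<bar>s k\<bar> \<le> 1" and l: "1/25 \<le> l" "l \<le> 24/25" and m: "0 \<le> m" "m \<le> 29/10"
  shows "\<bar>\<Sum>k=1..A. s k * m ^ k * res_coeff l k\<bar> \<le> 261"
    and "\<bar>\<Sum>k=1..A. s k * m ^ k * fps_nth ((resolvent_fps l)\<^sup>2) k\<bar> \<le> 261\<^sup>2"
proof -
  define g where "g k = \<bar>res_coeff l k\<bar> * m ^ k" for k
  have g0: "0 \<le> g k" for k
    using m by (simp add: g_def)
  have c: "24/625 \<le> l * (1 - l)"
    using logistic_lower[of "1/25" l] l by simp
  have maj0: "0 \<le> res_maj l m"
    using l m by (intro res_maj_nonneg) auto
  have "24/625 * res_maj l m \<le> l * (1 - l) * res_maj l m"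
    using c maj0 by (rule mult_right_mono)
  also have "\<dots> \<le> 10"
    using l m by (intro res_maj_bound) auto
  finally have maj: "res_maj l m \<le> 261"
    by simp
  have G: "(\<Sum>k\<le>A. g k) \<le> 261"
    using res_maj_partial_sum_le[of l m A] l m maj by (simp add: g_def)
  have abs_le: "\<bar>\<Sum>k=1..A. s k * m ^ k * f k\<bar> \<le> (\<Sum>k\<le>A. m ^ k * \<bar>f k\<bar>)" for f :: "nat \<Rightarrow> real"
  proof -
    have "\<bar>\<Sum>k=1..A. s k * m ^ k * f k\<bar> \<le> (\<Sum>k=1..A. \<bar>s k * m ^ k * f k\<bar>)"
      by (rule sum_abs)
    also have "\<dots> \<le> (\<Sum>k=1..A. m ^ k * \<bar>f k\<bar>)"
    proof (intro sum_mono)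
      fix k
      have "\<bar>s k\<bar> * (m ^ k * \<bar>f k\<bar>) \<le> 1 * (m ^ k * \<bar>f k\<bar>)"
        using s m by (intro mult_right_mono) auto
      then show "\<bar>s k * m ^ k * f k\<bar> \<le> m ^ k * \<bar>f k\<bar>"
        using m by (simp add: abs_mult mult.assoc)
    qed
    also have "\<dots> \<le> (\<Sum>k\<le>A. m ^ k * \<bar>f k\<bar>)"
      using m by (intro sum_mono2) auto
    finally show ?thesis .
  qed
  show "\<bar>\<Sum>k=1..A. s k * m ^ k * res_coeff l k\<bar> \<le> 261"
    using abs_le[of "res_coeff l"] G by (simp add: g_def mult.commute)
  have "m ^ k * \<bar>fps_nth ((resolvent_fps l)\<^sup>2) k\<bar> \<le> (\<Sum>i\<le>k. g i * g (k - i))" for k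
  proof -
    have "\<bar>fps_nth ((resolvent_fps l)\<^sup>2) k\<bar> \<le> (\<Sum>i\<le>k. \<bar>res_coeff l i\<bar> * \<bar>res_coeff l (k - i)\<bar>)"
      unfolding fps_square_nth res_coeff_def[symmetric] by (rule order_trans[OF sum_abs]) (simp add: abs_mult)
    then have "m ^ k * \<bar>fps_nth ((resolvent_fps l)\<^sup>2) k\<bar> \<le> m ^ k * (\<Sum>i\<le>k. \<bar>res_coeff l i\<bar> * \<bar>res_coeff l (k - i)\<bar>)"
      using m by (intro mult_left_mono) auto
    also have "\<dots> = (\<Sum>i\<le>k. g i * g (k - i))"
      unfolding sum_distrib_left
    proof (intro sum.cong refl)
      fix i assume "i \<in> {..k}"
      then have "m ^ k = m ^ i * m ^ (k - i)"
        by (simp add: power_add[symmetric])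
      then show "m ^ k * (\<bar>res_coeff l i\<bar> * \<bar>res_coeff l (k - i)\<bar>) = g i * g (k - i)"
        by (simp add: g_def)
    qed
    finally show ?thesis .
  qed
  then have "(\<Sum>k\<le>A. m ^ k * \<bar>fps_nth ((resolvent_fps l)\<^sup>2) k\<bar>) \<le> (\<Sum>k\<le>A. \<Sum>i\<le>k. g i * g (k - i))"
    by (intro sum_mono)
  also have "\<dots> \<le> (\<Sum>i\<le>A. g i)\<^sup>2"
    using g0 by (rule sum_convolution_le_square)
  also have "\<dots> \<le> 261\<^sup>2"
    using G g0 by (intro power_mono sum_nonneg) auto
  finally show "\<bar>\<Sum>k=1..A. s k * m ^ k * fps_nth ((resolvent_fps l)\<^sup>2) k\<bar> \<le> 261\<^sup>2"
    using abs_le[of "\<lambda>k. fps_nth ((resolvent_fps l)\<^sup>2) k"] by linarith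
qed

text \<open>
  By the preceding bounds the derivative is at most \<open>261\<^sup>2 + 261\<^sup>3 / 2 \<le> 10\<^sup>7\<close> in modulus.
\<close>

lemma signed_square_lipschitz:
  fixes s :: "nat \<Rightarrow> real" and A :: nat
  assumes s: "\<And>k. \<bar>s k\<bar> \<le> 1" and m: "0 \<le> m" "m \<le> 29/10" and l: "1/25 \<le> k0" "k0 \<le> l" "l \<le> 24/25"
  defines "r \<equiv> \<lambda>l. l * (1 - l) * (\<Sum>k=1..A. s k * m ^ k * res_coeff l k)\<^sup>2"
  shows "r k0 - 10 ^ 7 * (l - k0) \<le> r l"
proof (cases "k0 = l")
  case False
  define F D where "F z = (\<Sum>k=1..A. s k * m ^ k * res_coeff z k)" 
    and "D z = (\<Sum>k=1..A. s k * m ^ k * fps_nth ((resolvent_fps z)\<^sup>2) k)" for z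
  have F: "(F has_real_derivative D z) (at z)" for z
    unfolding F_def D_def by (auto intro!: derivative_eq_intros has_real_derivative_res_coeff sum.cong)
  have R: "(r has_real_derivative ((1 - 2 * z) * (F z)\<^sup>2 + 2 * (z * (1 - z)) * F z * D z)) (at z)" for z
    unfolding r_def F_def[symmetric] by (auto intro!: derivative_eq_intros F simp: algebra_simps power2_eq_square)
  obtain z where z: "k0 < z" "z < l" "r l - r k0 = (l - k0) * ((1 - 2 * z) * (F z)\<^sup>2 + 2 * (z * (1 - z)) * F z * D z)"
    using MVT2[of k0 l r "\<lambda>z. (1 - 2 * z) * (F z)\<^sup>2 + 2 * (z * (1 - z)) * F z * D z"] R False l by force
  have zz: "1/25 \<le> z" "z \<le> 24/25"
    using z l by auto
  have FD: "\<bar>F z\<bar> \<le> 261" "\<bar>D z\<bar> \<le> 261\<^sup>2"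
    unfolding F_def D_def using signed_sum_bounds[where A = A, OF s zz m] by auto
  have "z * (1 - z) \<le> 1/4"
    using zero_le_power2[of "z - 1/2"] by (simp add: power2_eq_square algebra_simps)
  then have zq: "\<bar>2 * (z * (1 - z))\<bar> \<le> 1/2"
    using zz by (simp add: abs_mult)
  have "\<bar>(1 - 2 * z) * (F z)\<^sup>2 + 2 * (z * (1 - z)) * F z * D z\<bar> \<le> \<bar>1 - 2 * z\<bar> * \<bar>F z\<bar>\<^sup>2 + \<bar>2 * (z * (1 - z))\<bar> * \<bar>F z\<bar> * \<bar>D z\<bar>"
    by (rule order_trans[OF abs_triangle_ineq]) (simp only: abs_mult power_abs abs_power2 order_refl)
  also have "\<dots> \<le> 1 * 261\<^sup>2 + 1/2 * 261 * 261\<^sup>2"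
    using FD zq zz by (intro add_mono mult_mono power_mono) auto
  also have "\<dots> \<le> 10 ^ 7"
    by (simp add: power2_eq_square)
  finally have b: "- (10 ^ 7) \<le> (1 - 2 * z) * (F z)\<^sup>2 + 2 * (z * (1 - z)) * F z * D z"
    by linarith
  have "(l - k0) * (- (10 ^ 7)) \<le> r l - r k0"
    unfolding z(3) using b l by (intro mult_left_mono) auto
  then show ?thesis
    by (simp add: algebra_simps)
qed simp

text \<open>
  With the signs of the coefficients at the critical parameter \<open>k0\<close>, \<open>r A k0\<close> tends to \<open>\<beta>\<^sup>2 = 1\<close>.
  For given \<open>J\<close> choose \<open>A\<close> with \<open>r A k0 \<ge> 1 - 1 / (4 (J + 1))\<close>. By the Lipschitz bound \<open>r A\<close> is at least
  \<open>1 - 1 / (2 (j + 1))\<close> on an interval of length \<open>1 / (4 * 10\<^sup>7 (j + 1))\<close> to the right of \<open>k0\<close>, so its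
  power with exponent \<open>j + 1\<close> is at least 1/2 there by Bernoulli's inequality.
\<close>

lemma Gamma_BCH_real_critical:
  assumes m: "critical_radius m"
  shows "Gamma_BCH_real m m = \<infinity>"
proof (rule ccontr)
  assume fin: "Gamma_BCH_real m m \<noteq> \<infinity>"
  have mr: "0 \<le> m" "m \<le> 29/10" "m < 157/50"
    using m by (auto simp: critical_radius_def radii_def)
  obtain k0 where k0: "1/20 \<le> k0" "k0 \<le> 1/2" "res_beta k0 m = 1"
    using m by (auto simp: critical_radius_def)
  define s where "s k = sgn (res_coeff k0 k)" for k
  have s: "\<bar>s k\<bar> \<le> 1" for k
    by (simp add: s_def abs_sgn_eq)
  define F where "F A l = (\<Sum>k=1..A. s k * m ^ k * res_coeff l k)" for A l
  define r where "r A l = l * (1 - l) * (F A l)\<^sup>2" for A l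
  obtain B where B: "(\<Sum>j<J. integral {0..1} (\<lambda>l. l * (F A l)\<^sup>2 * (r A l) ^ j)) \<le> B" for A J
    using Gamma_BCH_real_lower_bound[OF mr(1) fin] s unfolding F_def r_def by blast
  have "(\<lambda>A. F A k0) \<longlonglongrightarrow> res_maj k0 m"
  proof -
    have "(\<lambda>k. \<bar>res_coeff k0 k\<bar> * m ^ k) sums res_maj k0 m"
      unfolding res_maj_def using k0 mr by (intro summable_sums summable_res_maj) auto
    moreover have "(\<Sum>k\<le>A. \<bar>res_coeff k0 k\<bar> * m ^ k) = F A k0" for A
    proof -
      have "{..A} = insert 0 {1..A}"
        by auto
      then show ?thesis
        by (auto simp: F_def s_def abs_sgn[of "res_coeff k0 _"] mult_ac)
    qed
    ultimately show ?thesis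
      by (simp add: sums_def_le)
  qed
  then have "(\<lambda>A. r A k0) \<longlonglongrightarrow> k0 * (1 - k0) * (res_maj k0 m)\<^sup>2"
    unfolding r_def by (intro tendsto_intros)
  then have lim: "(\<lambda>A. r A k0) \<longlonglongrightarrow> 1"
    using res_beta_square[of k0 m] k0 by simp
  have cont: "continuous_on S (F A)" for A S
    unfolding F_def using has_real_derivative_res_coeff
    by (intro continuous_intros continuous_at_imp_continuous_on) (blast intro: DERIV_isCont)
  have part: "(\<Sum>j<J. 1 / (8 * 10 ^ 7) * inverse (real (Suc j))) \<le> B" for J
  proof -
    have "1 - 1 / (4 * real (Suc J)) < (1 :: real)"
      by simp
    from order_tendstoD(1)[OF lim this] obtain A where A: "1 - 1 / (4 * real (Suc J)) < r A k0"
      by (auto simp: eventually_sequentially)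
    have "1 / (8 * 10 ^ 7) * inverse (real (Suc j)) \<le> integral {0..1} (\<lambda>l. l * (F A l)\<^sup>2 * (r A l) ^ j)" if j: "j < J" for j
    proof -
      define \<delta> where "\<delta> = 1 / (4 * 10 ^ 7 * real (Suc j))"
      have "1 \<le> real (Suc j)"
        by simp
      then have \<delta>: "0 < \<delta>" "\<delta> \<le> 1/100" "10 ^ 7 * \<delta> = 1 / (4 * real (Suc j))"
        unfolding \<delta>_def by (auto simp: divide_simps)
      have sub: "{k0..k0 + \<delta>} \<subseteq> {0..1}"
        using k0 \<delta> by auto
      have half: "1/2 \<le> l * (F A l)\<^sup>2 * (r A l) ^ j" if l: "l \<in> {k0..k0 + \<delta>}" for l
      proof -
        have "r A k0 - 10 ^ 7 * (l - k0) \<le> r A l"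
          unfolding r_def F_def using l k0 \<delta> by (intro signed_square_lipschitz s mr) auto
        moreover have "10 ^ 7 * (l - k0) \<le> 1 / (4 * real (Suc j))"
          using l \<delta> by auto
        moreover have "1 / (4 * real (Suc J)) \<le> 1 / (4 * real (Suc j))"
          using j by (simp add: frac_le)
        ultimately have "1 - 2 * (1 / (4 * real (Suc j))) \<le> r A l"
          using A by linarith
        moreover have "1 + (- 1 / (2 * real (Suc j))) = 1 - 2 * (1 / (4 * real (Suc j)))"
          by (simp add: field_simps)
        ultimately have rl: "1 + (- 1 / (2 * real (Suc j))) \<le> r A l"
          by (simp only:)
        have "- 1 \<le> - 1 / (2 * real (Suc j))"
          by (simp add: divide_simps)
        from Bernoulli_inequality[OF this, of "Suc j"]
        have "1 + real (Suc j) * (- 1 / (2 * real (Suc j))) \<le> (1 + (- 1 / (2 * real (Suc j)))) ^ Suc j" .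
        moreover have "1 + real (Suc j) * (- 1 / (2 * real (Suc j))) = 1/2"
          by (simp add: divide_simps del: of_nat_Suc)
        ultimately have "1/2 \<le> (1 + (- 1 / (2 * real (Suc j)))) ^ Suc j"
          by linarith
        also have "\<dots> \<le> (r A l) ^ Suc j"
          using rl by (intro power_mono) (auto simp: divide_simps)
        also have "\<dots> = r A l * (r A l) ^ j"
          by simp
        also have "\<dots> \<le> l * (F A l)\<^sup>2 * (r A l) ^ j"
        proof (rule mult_right_mono)
          have "(l * (F A l)\<^sup>2) * (1 - l) \<le> (l * (F A l)\<^sup>2) * 1"
            using l k0 \<delta> by (intro mult_left_mono) auto
          then show "r A l \<le> l * (F A l)\<^sup>2"
            by (simp add: r_def mult_ac)
          show "0 \<le> r A l ^ j"
            using l k0 \<delta> by (auto simp: r_def)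
        qed
        finally show ?thesis .
      qed
      have int: "(\<lambda>l. l * (F A l)\<^sup>2 * (r A l) ^ j) integrable_on {a..b}" for a b
        unfolding r_def by (intro integrable_continuous_real continuous_intros cont)
      have "1 / (8 * 10 ^ 7) * inverse (real (Suc j)) = integral {k0..k0 + \<delta>} (\<lambda>l. 1/2)"
        using \<delta> by (simp add: \<delta>_def inverse_eq_divide)
      also have "\<dots> \<le> integral {k0..k0 + \<delta>} (\<lambda>l. l * (F A l)\<^sup>2 * (r A l) ^ j)"
        by (rule integral_le[OF _ int half]) auto
      also have "\<dots> \<le> integral {0..1} (\<lambda>l. l * (F A l)\<^sup>2 * (r A l) ^ j)"
        by (rule integral_subset_le[OF sub int int]) (auto simp: r_def intro!: mult_nonneg_nonneg)
      finally show ?thesis .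
    qed
    then have "(\<Sum>j<J. 1 / (8 * 10 ^ 7) * inverse (real (Suc j))) \<le> (\<Sum>j<J. integral {0..1} (\<lambda>l. l * (F A l)\<^sup>2 * (r A l) ^ j))"
      by (intro sum_mono) auto
    with B[of A J] show ?thesis
      by linarith
  qed
  have "summable (\<lambda>j. 1 / (8 * 10 ^ 7) * inverse (real (Suc j)))"
    by (rule summableI_nonneg_bounded[OF _ part]) simp
  then have "summable (\<lambda>j. inverse (real (Suc j)))"
    by (subst (asm) summable_cmult_iff) simp
  then have "summable (\<lambda>j. inverse (real j))"
    by (subst (asm) summable_Suc_iff)
  then show False
    using not_summable_harmonic[where 'a = real] by simp
qed

lemma C2_eq:
  assumes m: "critical_radius m"
  shows "C2 = 2 * m"
  unfolding C2_def
proof (rule Least_equality)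
  have "0 \<le> m"
    using m by (auto simp: critical_radius_def radii_def)
  then show "\<exists>x y. 0 \<le> x \<and> 0 \<le> y \<and> Gamma_BCH_real x y = \<infinity> \<and> 2 * m = x + y"
    using Gamma_BCH_real_critical[OF m] by (intro exI[of _ m]) simp
  show "2 * m \<le> c" if "\<exists>x y. 0 \<le> x \<and> 0 \<le> y \<and> Gamma_BCH_real x y = \<infinity> \<and> c = x + y" for c
    using that Gamma_BCH_real_finite_below[OF m] not_le_imp_less by blast
qed

section \<open>The cumulative convergence radius\<close>

text \<open>
  At the critical radius \<open>\<beta>\<close> is at most 1, so by strict monotonicity it is less than 1 outside the
  interval from 0.358653 to 0.358657.
\<close>

lemma critical_parameter_location:
  assumes m: "critical_radius m" and l: "1/20 \<le> l" "l \<le> 1/2" and ge: "1 \<le> res_beta l m"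
  shows "0.35865 < l" "l < 0.35866"
proof -
  have mr: "m \<in> radii 1449239650 1449239655" and le: "res_beta k m \<le> 1" if "1/20 \<le> k" "k \<le> 1/2" for k
    using m that by (auto simp: critical_radius_def)
  have mr: "m \<in> radii 1449239650 1449239655"
    using m by (auto simp: critical_radius_def)
  show "0.35865 < l"
  proof (rule ccontr)
    assume "\<not> 0.35865 < l"
    then have "0 < direction True * (res_beta (358653/10^6) m - res_beta l m)"
      using res_beta_inner_increasing mr l unfolding beta_monotone_def by (auto simp: cell_def)
    then show False
      using ge le[of "358653/10^6"] by (simp add: direction_def)
  qed
  show "l < 0.35866"
  proof (rule ccontr)
    assume "\<not> l < 0.35866"
    then have "0 < direction False * (res_beta l m - res_beta (358657/10^6) m)"
      using res_beta_outer_decreasing mr l unfolding beta_monotone_def by (auto simp: cell_def)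
    then show False
      using ge le[of "358657/10^6"] by (simp add: direction_def)
  qed
qed

theorem theorem3p24:
  shows "2.89847930 \<le> C2 \<and> C2 < 2.89847931 \<and>
    (\<forall>l x y :: real. 0 \<le> l \<and> l \<le> 1 \<and> 0 \<le> x \<and> 0 \<le> y \<and>
        Gamma_lam_real l x y = \<infinity> \<and> x + y = C2 \<longrightarrow>
      x = C2 / 2 \<and> y = C2 / 2 \<and> 0.35865 < min l (1 - l) \<and> min l (1 - l) < 0.35866)"
proof -
  obtain m where m: "critical_radius m"
    using critical_radius_exists by blast
  have C: "C2 = 2 * m"
    by (rule C2_eq[OF m])
  have mr: "1449239650/10^9 \<le> m" "m < 1449239655/10^9"
    using m by (auto simp: critical_radius_def radii_def)
  have "x = m \<and> y = m \<and> 0.35865 < min l (1 - l) \<and> min l (1 - l) < 0.35866"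
    if l: "0 \<le> l" "l \<le> 1" and xy: "0 \<le> x" "0 \<le> y" and inf: "Gamma_lam_real l x y = \<infinity>" and sum: "x + y = 2 * m" for l x y :: real
  proof -
    have x': "x \<le> 29/10" "y \<le> 29/10" "x + y \<le> 29/10"
      using xy sum mr by auto
    have big: "1 \<le> l * (1 - l) * (param_maj l x * param_maj l y)"
    proof (rule ccontr)
      assume "\<not> 1 \<le> l * (1 - l) * (param_maj l x * param_maj l y)"
      then have "Gamma_lam_real l x y \<noteq> \<infinity>"
        using l xy x' by (intro Gamma_lam_real_finite[where a = "param_maj l x" and b = "param_maj l y"] param_maj_partial_sum) auto
      with inf show False
        by blast
    qed
    then have mid: "1/20 \<le> l \<and> l \<le> 19/20"
      using param_maj_edge[OF l _ xy x'(3)] by fastforce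
    then have big': "1 \<le> l * (1 - l) * (res_maj l x * res_maj l y)"
      using big by (simp add: param_maj_def)
    have "x = y"
      using critical_product(2)[OF m _ _ xy sum] mid big' by fastforce
    with sum have xm: "x = m" "y = m"
      by simp_all
    define k where "k = min l (1 - l)"
    have k: "1/20 \<le> k" "k \<le> 1/2" "l * (1 - l) = k * (1 - k)" "res_maj l m = res_maj k m"
      using mid by (auto simp: k_def min_def res_maj_reflect)
    have "1 \<le> k * (1 - k) * (res_maj k m)\<^sup>2"
      using big' k xm by (simp add: power2_eq_square)
    then have "1 \<le> (res_beta k m)\<^sup>2"
      by (subst res_beta_square) (use k in auto)
    moreover have "0 \<le> res_beta k m"
      using k mr by (intro res_beta_nonneg) auto
    ultimately have "1 \<le> res_beta k m"
      using power2_le_imp_le[of 1 "res_beta k m"] by simp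
    then show ?thesis
      using critical_parameter_location[OF m k(1,2)] xm by (simp add: k_def)
  qed
  then show ?thesis
    unfolding C using mr by auto
qed

end
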